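(* Let $G$ be a connected, simply connected stratified Lie group of rank $r\ge2$ and step $s\ge2$, of dimension $m$, with Lie algebra $\mathfrak g=\mathfrak g_1\oplus\cdots\oplus\mathfrak g_s$, identified with $\mathbb{R}^m$ by global coordinates in which the identity is $0$. Let $F=\mathbb{R}^n$ be the free nilpotent Lie group of rank $r$ and step $s$, realized by a Hall–Grayson–Grossman basis $Y_1,\dots,Y_n$, with extremal polynomials $P^v_i$ ($v\in\mathbb{R}^n$, $i=1,\dots,n$). Let $\pi:F\to G$ be a surjective Lie group homomorphism with $\pi_*Y_i\in\mathfrak g_1$ for $i=1,\dots,r$. Let $S=\{s_1<\dots<s_m\}\subset\{1,\dots,n\}$ be such that $\{\pi_*Y_s\}_{s\in S}$ is a basis of $\mathfrak g$, set $X_i=\pi_*Y_{s_i}$ ($i=1,\dots,m$, left-invariant vector fields on $G$), and let $\zeta_{ij}\in\mathbb{R}$ be defined by $\pi_*Y_i=\sum_{j=1}^m\zeta_{ij}X_j$ ($i=1,\dots,n$). Let $\gamma:[0,1]\to G$ be horizontal, i.e. Lipschitz with $\dot\gamma=\sum_{j=1}^rh_jX_j(\gamma)$ a.e. for some $h\in L^2([0,1];\mathbb{R}^r)$, with $\gamma(0)=0$, and let $\kappa:[0,1]\to F$ be its lift: $\kappa(0)=0$, $\dot\kappa=\sum_{j=1}^rh_jY_j(\kappa)$ a.e. Suppose $\gamma$ is an extremal with dual curve $\xi$, and let $\lambda_i(t)=\langle\xi(t),X_i(\gamma(t))\rangle$, $i=1,\dots,m$. Then there is $v\in\mathbb{R}^n$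 such that $v_i=\sum_{j=1}^m\zeta_{ij}v_{s_j}$ for all $i=1,\dots,n$, and $\lambda_i(t)=P^v_{s_i}(\kappa(t))$ for all $t\in[0,1]$ and $i=1,\dots,m$.
   Context: Extremal and dual curve (in the fixed coordinates of $G=\mathbb{R}^m$, writing $X_j=\sum_iX_{ji}\partial_{x_i}$): a horizontal $\gamma$ with controls $h$ is an extremal with dual curve $\xi$ if $\xi:[0,1]\to\mathbb{R}^m$ is Lipschitz and there is $\xi_0\in\{0,1\}$ such that (i) $\xi_0+|\xi(t)|\ne0$ for all $t$; (ii) $\xi_0h_j+\langle\xi,X_j(\gamma)\rangle=0$ on $[0,1]$ for $j=1,\dots,r$; (iii) $\dot\xi_k=-\sum_{j=1}^r\sum_{i=1}^m\frac{\partial X_{ji}}{\partial x_k}(\gamma)h_j\xi_i$ a.e. for $k=1,\dots,m$. Multi-indices $\mathcal I=\mathbb{N}^n$: $|\alpha|$, $\alpha!$, $x^\alpha$. Hall basis of the free nilpotent Lie algebra $\mathfrak f$ of rank $r$, step $s$, dimension $n$: take a basis $Y_1,\dots,Y_r$ of the first layer (degree 1); inductively the degree-$d$ basis elements are brackets $[Y_i,Y_j]$ of earlier elements with $i>j$, $d(i)+d(j)=d$, and, if $Y_i$ was constructed as $[Y_h,Y_k]$, then $k\le j$; they are listed after lower-degree elements. Strings: $(\ell)$ for $\ell\le r$; if $Y_\ell=[Y_a,Y_b]$ was so constructed, the string of $a$ followed by $b$. With string $(\ell_0,\dots,\ell_h)$, $I(\ell)_j=\#\{1\le p\le h:\ell_p=j\}$;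 $j\prec\ell$ iff the string of $j$ is an initial segment of that of $\ell$. $[Z,Y_\alpha]$ is the left-nested bracket of $Z$ with $Y_1$ ($\alpha_1$ times), then $Y_2$ ($\alpha_2$ times), ..., $Y_n$ ($\alpha_n$ times). Hall–Grayson–Grossman basis: the vector fields on $\mathbb{R}^n$ $Y_i=\sum_{\ell:\,i\prec\ell}\frac{(-1)^{|I(\ell)|}}{I(\ell)!}x^{I(\ell)}\partial_{x_\ell}$ ($i\le r$) and $Y_\ell=[Y_a,Y_b]$ (vector field bracket) for $\ell>r$ constructed as $[Y_a,Y_b]$; they are the left-invariant vector fields of a free nilpotent group structure on $\mathbb{R}^n$ with identity $0$, this group being $F$. Generalized structure constants: $[Y_i,Y_\alpha]=\sum_kc^k_{i\alpha}Y_k$. Extremal polynomials: $P^v_i(x)=\sum_{\alpha\in\mathcal I}\frac{(-1)^{|\alpha|}}{\alpha!}\big(\sum_kc^k_{i\alpha}v_k\big)x^\alpha$. *)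

theory Defs
  imports "HOL-Analysis.Analysis"
begin

text \<open>Points of R^d are modelled as functions nat => real supported on the
coordinates 1..d.  Vector fields are maps from points to vectors.\<close>

type_synonym pt = "nat \<Rightarrow> real"
type_synonym vf = "pt \<Rightarrow> pt"

definition origin :: pt where "origin = (\<lambda>_. 0)"

definition pts :: "nat \<Rightarrow> pt set" where
  "pts d = {x. \<forall>k. k \<notin> {1..d} \<longrightarrow> x k = 0}"

definition partial :: "nat \<Rightarrow> (pt \<Rightarrow> real) \<Rightarrow> pt \<Rightarrow> real" where
  "partial k f x = deriv (\<lambda>t. f (x(k := t))) (x k)"

fun cdiff :: "nat \<Rightarrow> nat \<Rightarrow> (pt \<Rightarrow> real) \<Rightarrow> bool" where
  "cdiff d 0 f = continuous_on (pts d) f"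
| "cdiff d (Suc k) f = (continuous_on (pts d) f \<and>
      (\<forall>i\<in>{1..d}. \<forall>x\<in>pts d. (\<lambda>t. f (x(i := t))) differentiable (at (x i))) \<and>
      (\<forall>i\<in>{1..d}. cdiff d k (partial i f)))"

definition smooth_fun :: "nat \<Rightarrow> (pt \<Rightarrow> real) \<Rightarrow> bool" where
  "smooth_fun d f = (\<forall>k. cdiff d k f)"

definition smooth_map :: "nat \<Rightarrow> nat \<Rightarrow> (pt \<Rightarrow> pt) \<Rightarrow> bool" where
  "smooth_map d e \<phi> = ((\<forall>x\<in>pts d. \<phi> x \<in> pts e) \<and> (\<forall>j\<in>{1..e}. smooth_fun d (\<lambda>x. \<phi> x j)))"

definition fst_part :: "nat \<Rightarrow> pt \<Rightarrow> pt" where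
  "fst_part d z = (\<lambda>k. if k \<in> {1..d} then z k else 0)"
definition snd_part :: "nat \<Rightarrow> pt \<Rightarrow> pt" where
  "snd_part d z = (\<lambda>k. if k \<in> {1..d} then z (k + d) else 0)"

definition lie_group :: "nat \<Rightarrow> (pt \<Rightarrow> pt \<Rightarrow> pt) \<Rightarrow> bool" where
  "lie_group d mul =
    ((\<forall>x\<in>pts d. \<forall>y\<in>pts d. mul x y \<in> pts d) \<and>
     (\<forall>x\<in>pts d. \<forall>y\<in>pts d. \<forall>z\<in>pts d. mul (mul x y) z = mul x (mul y z)) \<and>
     (\<forall>x\<in>pts d. mul origin x = x \<and> mul x origin = x) \<and>
     (\<exists>inv. smooth_map d d inv \<and> (\<forall>x\<in>pts d. mul x (inv x) = origin \<and> mul (inv x) x = origin)) \<and>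
     smooth_map (2 * d) d (\<lambda>z. mul (fst_part d z) (snd_part d z)))"

definition dmap :: "nat \<Rightarrow> (pt \<Rightarrow> pt) \<Rightarrow> pt \<Rightarrow> pt \<Rightarrow> pt" where
  "dmap d \<phi> x v = (\<lambda>j. \<Sum>k\<in>{1..d}. v k * partial k (\<lambda>y. \<phi> y j) x)"

definition vf_bracket :: "nat \<Rightarrow> vf \<Rightarrow> vf \<Rightarrow> vf" where
  "vf_bracket d X Y = (\<lambda>x i. \<Sum>k\<in>{1..d}.
      X x k * partial k (\<lambda>y. Y y i) x - Y x k * partial k (\<lambda>y. X y i) x)"

definition linv_ext :: "nat \<Rightarrow> (pt \<Rightarrow> pt \<Rightarrow> pt) \<Rightarrow> pt \<Rightarrow> vf" where
  "linv_ext d mul v = (\<lambda>p. dmap d (mul p) origin v)"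

definition lie_br :: "nat \<Rightarrow> (pt \<Rightarrow> pt \<Rightarrow> pt) \<Rightarrow> pt \<Rightarrow> pt \<Rightarrow> pt" where
  "lie_br d mul v w = vf_bracket d (linv_ext d mul v) (linv_ext d mul w) origin"

definition lin_span :: "nat \<Rightarrow> pt set \<Rightarrow> pt set" where
  "lin_span d A = {x \<in> pts d. \<exists>B c. finite B \<and> B \<subseteq> A \<and> x = (\<lambda>i. \<Sum>b\<in>B. c b * b i)}"

definition lsubspace :: "nat \<Rightarrow> pt set \<Rightarrow> bool" where
  "lsubspace d V = (V \<subseteq> pts d \<and> origin \<in> V \<and>
     (\<forall>x\<in>V. \<forall>y\<in>V. (\<lambda>i. x i + y i) \<in> V) \<and> (\<forall>a. \<forall>x\<in>V. (\<lambda>i. a * x i) \<in> V))"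

definition lindep_free :: "(nat \<Rightarrow> pt) \<Rightarrow> nat set \<Rightarrow> bool" where
  "lindep_free u J = (\<forall>c. (\<forall>i. (\<Sum>j\<in>J. c j * u j i) = 0) \<longrightarrow> (\<forall>j\<in>J. c j = 0))"

definition has_dim :: "nat \<Rightarrow> pt set \<Rightarrow> nat \<Rightarrow> bool" where
  "has_dim d V k = (\<exists>u. (\<forall>j\<in>{1..k}. u j \<in> V) \<and> lindep_free u {1..k} \<and> lin_span d (u ` {1..k}) = V)"

definition stratified :: "nat \<Rightarrow> (pt \<Rightarrow> pt \<Rightarrow> pt) \<Rightarrow> nat \<Rightarrow> nat \<Rightarrow> (nat \<Rightarrow> pt set) \<Rightarrow> bool" where
  "stratified d mul r s V =
    ((\<forall>k\<in>{1..s}. lsubspace d (V k)) \<and>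
     (\<forall>x\<in>pts d. \<exists>w. (\<forall>k\<in>{1..s}. w k \<in> V k) \<and> x = (\<lambda>i. \<Sum>k\<in>{1..s}. w k i)) \<and>
     (\<forall>w. (\<forall>k\<in>{1..s}. w k \<in> V k) \<and> (\<lambda>i. \<Sum>k\<in>{1..s}. w k i) = origin
          \<longrightarrow> (\<forall>k\<in>{1..s}. w k = origin)) \<and>
     (\<forall>k\<in>{1..<s}. lin_span d {lie_br d mul v w | v w. v \<in> V 1 \<and> w \<in> V k} = V (Suc k)) \<and>
     (\<forall>v\<in>V 1. \<forall>w\<in>V s. lie_br d mul v w = origin) \<and>
     has_dim d (V 1) r \<and> V s \<noteq> {origin})"

definition stratified_group :: "nat \<Rightarrow> (pt \<Rightarrow> pt \<Rightarrow> pt) \<Rightarrow> nat \<Rightarrow> nat \<Rightarrow> (nat \<Rightarrow> pt set) \<Rightarrow> bool" where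
  "stratified_group d mul r s V = (lie_group d mul \<and> stratified d mul r s V)"

text \<open>A Hall basis of rank r: indices 1..r are the generators, each l > r is
  constructed as [Y_a, Y_b] with L l = (a, b).\<close>

fun hstr_f :: "nat \<Rightarrow> nat \<Rightarrow> (nat \<Rightarrow> nat \<times> nat) \<Rightarrow> nat \<Rightarrow> nat list" where
  "hstr_f 0 r L l = [l]"
| "hstr_f (Suc k) r L l = (if l \<le> r then [l] else hstr_f k r L (fst (L l)) @ [snd (L l)])"

definition hstr :: "nat \<Rightarrow> (nat \<Rightarrow> nat \<times> nat) \<Rightarrow> nat \<Rightarrow> nat list" where
  "hstr r L l = hstr_f l r L l"

fun hdeg_f :: "nat \<Rightarrow> nat \<Rightarrow> (nat \<Rightarrow> nat \<times> nat) \<Rightarrow> nat \<Rightarrow> nat" where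
  "hdeg_f 0 r L l = 1"
| "hdeg_f (Suc k) r L l = (if l \<le> r then 1 else hdeg_f k r L (fst (L l)) + hdeg_f k r L (snd (L l)))"

definition hdeg :: "nat \<Rightarrow> (nat \<Rightarrow> nat \<times> nat) \<Rightarrow> nat \<Rightarrow> nat" where
  "hdeg r L l = hdeg_f l r L l"

definition hall_basis :: "nat \<Rightarrow> nat \<Rightarrow> nat \<Rightarrow> (nat \<Rightarrow> nat \<times> nat) \<Rightarrow> bool" where
  "hall_basis r s n L =
    (1 \<le> r \<and> r \<le> n \<and>
     (\<forall>l\<in>{r<..n}. fst (L l) < l \<and> snd (L l) < fst (L l) \<and> 1 \<le> snd (L l) \<and>
        (r < fst (L l) \<longrightarrow> snd (L (fst (L l))) \<le> snd (L l))) \<and>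
     inj_on L {r<..n} \<and>
     (\<forall>l\<in>{1..n}. hdeg r L l \<le> s) \<and>
     (\<forall>l1\<in>{1..n}. \<forall>l2\<in>{1..n}. l1 \<le> l2 \<longrightarrow> hdeg r L l1 \<le> hdeg r L l2) \<and>
     (\<forall>a\<in>{1..n}. \<forall>b\<in>{1..n}. b < a \<and> hdeg r L a + hdeg r L b \<le> s \<and>
        (a \<le> r \<or> snd (L a) \<le> b) \<longrightarrow> (\<exists>l\<in>{r<..n}. L l = (a, b))))"

definition hI :: "nat \<Rightarrow> (nat \<Rightarrow> nat \<times> nat) \<Rightarrow> nat \<Rightarrow> nat \<Rightarrow> nat" where
  "hI r L l j = count_list (tl (hstr r L l)) j"

definition hprec :: "nat \<Rightarrow> (nat \<Rightarrow> nat \<times> nat) \<Rightarrow> nat \<Rightarrow> nat \<Rightarrow> bool" where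
  "hprec r L j l = (take (length (hstr r L j)) (hstr r L l) = hstr r L j)"

definition Ygen :: "nat \<Rightarrow> nat \<Rightarrow> (nat \<Rightarrow> nat \<times> nat) \<Rightarrow> nat \<Rightarrow> vf" where
  "Ygen n r L i = (\<lambda>x l. if l \<in> {1..n} \<and> hprec r L i l then
      (-1) ^ (\<Sum>j\<in>{1..n}. hI r L l j) / (\<Prod>j\<in>{1..n}. fact (hI r L l j))
        * (\<Prod>j\<in>{1..n}. x j ^ hI r L l j)
     else 0)"

fun hgg_f :: "nat \<Rightarrow> nat \<Rightarrow> nat \<Rightarrow> (nat \<Rightarrow> nat \<times> nat) \<Rightarrow> nat \<Rightarrow> vf" where
  "hgg_f 0 n r L l = Ygen n r L l"
| "hgg_f (Suc k) n r L l = (if l \<le> r then Ygen n r L l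
      else vf_bracket n (hgg_f k n r L (fst (L l))) (hgg_f k n r L (snd (L l))))"

definition hgg :: "nat \<Rightarrow> nat \<Rightarrow> (nat \<Rightarrow> nat \<times> nat) \<Rightarrow> nat \<Rightarrow> vf" where
  "hgg n r L l = hgg_f l n r L l"

definition multi_idx :: "nat \<Rightarrow> (nat \<Rightarrow> nat) set" where
  "multi_idx n = {\<alpha>. \<forall>j. j \<notin> {1..n} \<longrightarrow> \<alpha> j = 0}"

definition nest_br :: "nat \<Rightarrow> nat \<Rightarrow> (nat \<Rightarrow> nat \<times> nat) \<Rightarrow> vf \<Rightarrow> (nat \<Rightarrow> nat) \<Rightarrow> vf" where
  "nest_br n r L Z \<alpha> = foldl (\<lambda>W j. vf_bracket n W (hgg n r L j)) Z
      (concat (map (\<lambda>j. replicate (\<alpha> j) j) [1..<n+1]))"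

definition gsc :: "nat \<Rightarrow> nat \<Rightarrow> (nat \<Rightarrow> nat \<times> nat) \<Rightarrow> nat \<Rightarrow> (nat \<Rightarrow> nat) \<Rightarrow> nat \<Rightarrow> real" where
  "gsc n r L i \<alpha> = (SOME c. (\<forall>k. k \<notin> {1..n} \<longrightarrow> c k = 0) \<and>
      (\<forall>x\<in>pts n. nest_br n r L (hgg n r L i) \<alpha> x = (\<lambda>j. \<Sum>k\<in>{1..n}. c k * hgg n r L k x j)))"

definition ext_poly :: "nat \<Rightarrow> nat \<Rightarrow> (nat \<Rightarrow> nat \<times> nat) \<Rightarrow> pt \<Rightarrow> nat \<Rightarrow> pt \<Rightarrow> real" where
  "ext_poly n r L v i x = infsum (\<lambda>\<alpha>.
      (-1) ^ (\<Sum>j\<in>{1..n}. \<alpha> j) / (\<Prod>j\<in>{1..n}. fact (\<alpha> j))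
      * (\<Sum>k\<in>{1..n}. gsc n r L i \<alpha> k * v k) * (\<Prod>j\<in>{1..n}. x j ^ \<alpha> j)) (multi_idx n)"

definition free_group_law :: "nat \<Rightarrow> nat \<Rightarrow> (nat \<Rightarrow> nat \<times> nat) \<Rightarrow> (pt \<Rightarrow> pt \<Rightarrow> pt) \<Rightarrow> bool" where
  "free_group_law n r L multF = (lie_group n multF \<and>
     (\<forall>i\<in>{1..n}. \<forall>p\<in>pts n. hgg n r L i p = linv_ext n multF (hgg n r L i origin) p))"

definition lie_hom_onto :: "nat \<Rightarrow> nat \<Rightarrow> (pt \<Rightarrow> pt \<Rightarrow> pt) \<Rightarrow> (pt \<Rightarrow> pt \<Rightarrow> pt) \<Rightarrow> (pt \<Rightarrow> pt) \<Rightarrow> bool" where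
  "lie_hom_onto n m multF multG \<pi> = (smooth_map n m \<pi> \<and> \<pi> ` pts n = pts m \<and>
     (\<forall>x\<in>pts n. \<forall>y\<in>pts n. \<pi> (multF x y) = multG (\<pi> x) (\<pi> y)))"

text \<open>pi_* Y at the identity (pi_* Y is the left-invariant extension of this vector).\<close>
definition push0 :: "nat \<Rightarrow> (pt \<Rightarrow> pt) \<Rightarrow> vf \<Rightarrow> pt" where
  "push0 n \<pi> Y = dmap n \<pi> origin (Y origin)"

definition lip_curve :: "nat \<Rightarrow> (real \<Rightarrow> pt) \<Rightarrow> bool" where
  "lip_curve d c = ((\<forall>t\<in>{0..1}. c t \<in> pts d) \<and>
     (\<forall>i\<in>{1..d}. \<exists>C. C-lipschitz_on {0..1} (\<lambda>t. c t i)))"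

definition ctrl_curve :: "nat \<Rightarrow> nat \<Rightarrow> (nat \<Rightarrow> vf) \<Rightarrow> (real \<Rightarrow> pt) \<Rightarrow> (nat \<Rightarrow> real \<Rightarrow> real) \<Rightarrow> bool" where
  "ctrl_curve d r Z c h = (lip_curve d c \<and>
     (AE t in lborel. t \<in> {0..1} \<longrightarrow> (\<forall>i\<in>{1..d}.
        ((\<lambda>\<tau>. c \<tau> i) has_real_derivative (\<Sum>j\<in>{1..r}. h j t * Z j (c t) i)) (at t within {0..1}))))"

definition L2_ctrl :: "nat \<Rightarrow> (nat \<Rightarrow> real \<Rightarrow> real) \<Rightarrow> bool" where
  "L2_ctrl r h = (\<forall>j\<in>{1..r}. h j \<in> borel_measurable (lebesgue_on {0..1}) \<and>
      integrable (lebesgue_on {0..1}) (\<lambda>t. (h j t)\<^sup>2))"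

definition horizontal :: "nat \<Rightarrow> nat \<Rightarrow> (nat \<Rightarrow> vf) \<Rightarrow> (real \<Rightarrow> pt) \<Rightarrow> (nat \<Rightarrow> real \<Rightarrow> real) \<Rightarrow> bool" where
  "horizontal d r X \<gamma> h = (L2_ctrl r h \<and> ctrl_curve d r X \<gamma> h)"

definition extremal :: "nat \<Rightarrow> nat \<Rightarrow> (nat \<Rightarrow> vf) \<Rightarrow> (real \<Rightarrow> pt) \<Rightarrow> (nat \<Rightarrow> real \<Rightarrow> real)
    \<Rightarrow> real \<Rightarrow> (real \<Rightarrow> pt) \<Rightarrow> bool" where
  "extremal d r X \<gamma> h \<xi>0 \<xi> =
    (lip_curve d \<xi> \<and> \<xi>0 \<in> {0, 1} \<and>
     (\<forall>t\<in>{0..1}. \<xi>0 + sqrt (\<Sum>i\<in>{1..d}. (\<xi> t i)\<^sup>2) \<noteq> 0) \<and>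
     (\<forall>t\<in>{0..1}. \<forall>j\<in>{1..r}. \<xi>0 * h j t + (\<Sum>i\<in>{1..d}. \<xi> t i * X j (\<gamma> t) i) = 0) \<and>
     (AE t in lborel. t \<in> {0..1} \<longrightarrow> (\<forall>k\<in>{1..d}.
        ((\<lambda>\<tau>. \<xi> \<tau> k) has_real_derivative
          - (\<Sum>j\<in>{1..r}. \<Sum>i\<in>{1..d}. partial k (\<lambda>y. X j y i) (\<gamma> t) * h j t * \<xi> t i))
          (at t within {0..1}))))"

end

theory Submission
  imports Defs
begin

text \<open>Let w be the initial covector and f u x the pairing of w with Ad (\<pi> x) u. Along F one has
  Y j (f u) = f [y j, u], where y j is the image of Y j in the Lie algebra of G. Since Y l is the
  l-th coordinate field where the first l - 1 coordinates vanish, expanding f u in x_1, then in x_2,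
  and so on, gives a finite Taylor sum: f (y i) is the extremal polynomial of v, v i being the
  pairing of w with y i. On the other hand the functions
  \<lambda> u = (\<xi>, u (\<gamma>)) satisfy d/dt \<lambda> u = \<Sum> h j \<lambda> [y j, u] almost everywhere, and so do the
  functions f u (\<kappa>), with the same initial values. By descending induction along the lower
  central filtration of the Lie algebra of G, the difference of the two is a Lipschitz function
  whose derivative vanishes almost everywhere, hence zero. The index set S starts with 1, ..., r
  because the first layer of G has dimension r.\<close>

subsection \<open>Smooth functions on coordinate space\<close>

text \<open>Along the curves one compares two solutions of a linear system whose coefficients are
  only in L^2, and no existence or uniqueness theory for such systems is invoked. For this reason u
  ranges over the whole Lie algebra of G and not just over the chosen basis: the system then closes
  up under u -> [y j, u], and since this map goes one step down the filtration, the system is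
  triangular. Ad is reached without the exponential map: \<open>ad u p\<close> is the vector whose
  right-invariant field agrees at p with the left-invariant field of u, and the formula for Y j (f
  u) expresses that left- and right-invariant fields commute. The order 1, ..., n in which
  coordinates are expanded is also the order in which [Z, Y_\<alpha>] is nested, so the iterated
  derivatives produce exactly the brackets in the generalized structure constants. The linear
  constraints on v record that each y i is the combination of the basis vectors y (sel j) with
  coefficients \<zeta>.\<close>

lemma pts_upd: "x \<in> pts d \<Longrightarrow> k \<in> {1..d} \<Longrightarrow> x(k := t) \<in> pts d"
  by (auto simp: pts_def)

lemma origin_pts [simp]: "origin \<in> pts d"
  by (auto simp: pts_def origin_def)

lemma pts_eqI: "x \<in> pts d \<Longrightarrow> y \<in> pts d \<Longrightarrow> (\<And>k. k \<in> {1..d} \<Longrightarrow> x k = y k) \<Longrightarrow> x = y"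
  by (rule ext) (metis (mono_tags, lifting) mem_Collect_eq pts_def)

text \<open>A coordinate slice through a point of \<open>pts d\<close> in a direction from 1 to d
  stays in \<open>pts d\<close>. Derivatives therefore never see values off that set, where the
  group law is unconstrained.\<close>

lemma partial_cong:
  assumes "\<And>x. x \<in> pts d \<Longrightarrow> f x = g x" "x \<in> pts d" "i \<in> {1..d}"
  shows "partial i f x = partial i g x"
proof -
  have "(\<lambda>t. f (x(i := t))) = (\<lambda>t. g (x(i := t)))"
    using assms pts_upd by (intro ext) blast
  then show ?thesis by (simp add: partial_def)
qed

lemma cdiff_cong:
  assumes "\<And>x. x \<in> pts d \<Longrightarrow> f x = g x"
  shows "cdiff d k f \<longleftrightarrow> cdiff d k g"
  using assms
proof (induction k arbitrary: f g)
  case 0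
  then show ?case by (auto intro: continuous_on_cong)
next
  case (Suc k)
  have eq: "(\<lambda>t. f (x(i := t))) = (\<lambda>t. g (x(i := t)))" if "x \<in> pts d" "i \<in> {1..d}" for x i
    using Suc.prems pts_upd[OF that] by (intro ext) blast
  have "cdiff d k (partial i f) \<longleftrightarrow> cdiff d k (partial i g)" if "i \<in> {1..d}" for i
    by (rule Suc.IH) (rule partial_cong[OF Suc.prems _ that])
  moreover have "continuous_on (pts d) f \<longleftrightarrow> continuous_on (pts d) g"
    by (rule continuous_on_cong) (use Suc.prems in auto)
  ultimately show ?case using eq by simp
qed

lemma smooth_fun_cong:
  assumes "\<And>x. x \<in> pts d \<Longrightarrow> f x = g x" "smooth_fun d f"
  shows "smooth_fun d g"
  using assms cdiff_cong unfolding smooth_fun_def by blast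

lemma cdiff_SucD: "cdiff d (Suc k) f \<Longrightarrow> cdiff d k f"
proof (induction k arbitrary: f)
  case (Suc k)
  then show ?case by (simp only: cdiff.simps(2)) blast
qed simp

lemma smooth_fun_continuous: "smooth_fun d f \<Longrightarrow> continuous_on (pts d) f"
  unfolding smooth_fun_def using cdiff.simps(1) by blast

lemma smooth_fun_partial: "smooth_fun d f \<Longrightarrow> i \<in> {1..d} \<Longrightarrow> smooth_fun d (partial i f)"
  unfolding smooth_fun_def using cdiff.simps(2) by blast

lemma cdiff_DERIV:
  assumes "cdiff d (Suc k) f" "x \<in> pts d" "i \<in> {1..d}"
  shows "((\<lambda>t. f (x(i := t))) has_real_derivative partial i f (x(i := t))) (at t)"
proof -
  have "(\<lambda>s. f ((x(i := t))(i := s))) differentiable (at ((x(i := t)) i))"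
    using assms(1,3) pts_upd[OF assms(2,3), of t] unfolding cdiff.simps by blast
  then have "(\<lambda>s. f (x(i := s))) differentiable (at t)" by simp
  then have "(\<lambda>s. f (x(i := s))) field_differentiable (at t)"
    using field_differentiable_def real_differentiable_def by blast
  then show ?thesis
    unfolding partial_def by (simp add: field_differentiable_derivI)
qed

lemma smooth_fun_DERIV:
  assumes "smooth_fun d f" "x \<in> pts d" "i \<in> {1..d}"
  shows "((\<lambda>t. f (x(i := t))) has_real_derivative partial i f (x(i := t))) (at t)"
  using assms cdiff_DERIV unfolding smooth_fun_def by blast

lemma partialI:
  assumes "((\<lambda>t. f (x(i := t))) has_real_derivative D) (at (x i))"
  shows "partial i f x = D"
  using assms DERIV_imp_deriv unfolding partial_def by blast

text \<open>The segment from x to y is replaced by a path changing one coordinate at a time, so the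
  one-variable mean value theorem suffices and only partial derivatives occur. The points
  \<open>z i\<close> lie in the box spanned by x and y, which later yields both convergence and
  bounds.\<close>

lemma cdiff_mvt:
  assumes f: "cdiff d (Suc N) f" and x: "x \<in> pts d" and y: "y \<in> pts d"
  shows "\<exists>z. (\<forall>i\<in>{1..d}. z i \<in> pts d \<and> (\<forall>k. z i k \<in> closed_segment (x k) (y k))) \<and>
    f y - f x = (\<Sum>i\<in>{1..d}. partial i f (z i) * (y i - x i))"
proof -
  define w where "w i = (\<lambda>k. if k \<le> i then y k else x k)" for i :: nat
  have wp: "w i \<in> pts d" for i
    using x y by (auto simp: w_def pts_def)
  have w0: "w 0 = x"
    by (rule pts_eqI[OF wp x]) (auto simp: w_def)
  have wd: "w d = y"
    by (rule pts_eqI[OF wp y]) (auto simp: w_def)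
  have "\<exists>z. z \<in> pts d \<and> (\<forall>k. z k \<in> closed_segment (x k) (y k)) \<and>
      f (w i) - f (w (i - 1)) = partial i f z * (y i - x i)" if i: "i \<in> {1..d}" for i
  proof -
    let ?w = "w (i - 1)"
    have upd: "?w(i := y i) = w i" "?w(i := x i) = ?w"
      using i by (auto simp: w_def fun_eq_iff)
    have D: "((\<lambda>t. f (?w(i := t))) has_real_derivative partial i f (?w(i := t))) (at t)" for t
      using cdiff_DERIV[OF f wp i] .
    have "\<exists>s. s \<in> closed_segment (x i) (y i) \<and>
      f (?w(i := y i)) - f (?w(i := x i)) = partial i f (?w(i := s)) * (y i - x i)"
    proof (cases "x i" "y i" rule: linorder_cases)
      case less
      from MVT2[OF this, of "\<lambda>t. f (?w(i := t))" "\<lambda>t. partial i f (?w(i := t))"] D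
      obtain s where "x i < s" "s < y i"
        "f (?w(i := y i)) - f (?w(i := x i)) = (y i - x i) * partial i f (?w(i := s))" by blast
      then show ?thesis by (intro exI[of _ s]) (auto simp: closed_segment_eq_real_ivl)
    next
      case equal
      then show ?thesis by (intro exI[of _ "x i"]) auto
    next
      case greater
      from MVT2[OF this, of "\<lambda>t. f (?w(i := t))" "\<lambda>t. partial i f (?w(i := t))"] D
      obtain s where s: "y i < s" "s < x i"
        "f (?w(i := x i)) - f (?w(i := y i)) = (x i - y i) * partial i f (?w(i := s))" by blast
      have "f (?w(i := y i)) - f (?w(i := x i)) = partial i f (?w(i := s)) * (y i - x i)"
        using s(3) by (simp add: algebra_simps)
      with s(1,2) show ?thesis by (intro exI[of _ s]) (auto simp: closed_segment_eq_real_ivl)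
    qed
    then obtain s where s: "s \<in> closed_segment (x i) (y i)"
      "f (?w(i := y i)) - f (?w(i := x i)) = partial i f (?w(i := s)) * (y i - x i)" by blast
    have "(?w(i := s)) k \<in> closed_segment (x k) (y k)" for k
      using s(1) by (simp add: w_def)
    then show ?thesis
      using s(2) pts_upd[OF wp i, where t = s] unfolding upd by blast
  qed
  then obtain z where z: "\<And>i. i \<in> {1..d} \<Longrightarrow> z i \<in> pts d \<and>
      (\<forall>k. z i k \<in> closed_segment (x k) (y k)) \<and>
      f (w i) - f (w (i - 1)) = partial i f (z i) * (y i - x i)"
    by metis
  have "(\<Sum>i\<in>{1..d}. f (w i) - f (w (i - 1))) = f (w d) - f (w 0)"
    by (induction d) auto
  then have "f y - f x = (\<Sum>i\<in>{1..d}. partial i f (z i) * (y i - x i))"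
    using z unfolding w0 wd by (metis (no_types, lifting) sum.cong)
  with z show ?thesis by blast
qed

lemma tendsto_fun_iff:
  fixes c :: "'a \<Rightarrow> nat \<Rightarrow> real"
  shows "(c \<longlongrightarrow> l) F \<longleftrightarrow> (\<forall>k. ((\<lambda>t. c t k) \<longlongrightarrow> l k) F)"
proof
  assume "(c \<longlongrightarrow> l) F"
  then show "\<forall>k. ((\<lambda>t. c t k) \<longlongrightarrow> l k) F"
    using continuous_on_tendsto_compose[OF continuous_on_product_coordinates] by force
next
  assume *: "\<forall>k. ((\<lambda>t. c t k) \<longlongrightarrow> l k) F"
  have "limitin (product_topology (\<lambda>i. euclidean) UNIV) c l F"
    unfolding limitin_componentwise using * by simp
  then show "(c \<longlongrightarrow> l) F"
    by (simp add: euclidean_product_topology)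
qed

lemma closed_segment_abs_le:
  fixes a b z :: real
  shows "z \<in> closed_segment a b \<Longrightarrow> \<bar>z - a\<bar> \<le> \<bar>b - a\<bar>"
  by (auto simp: closed_segment_eq_real_ivl split: if_splits)

text \<open>Dividing the mean value decomposition between \<open>c t0\<close> and \<open>c t\<close>
  by t - t0 leaves partial derivatives at points squeezed towards \<open>c t0\<close>; their
  continuity gives the limit. Derivatives within S are used so that the end points of [0,1] are
  covered.\<close>

lemma cdiff_chain_curve:
  assumes f: "cdiff d (Suc N) f" and c: "\<And>t. t \<in> S \<Longrightarrow> c t \<in> pts d" and t0: "t0 \<in> S"
    and D: "\<And>i. i \<in> {1..d} \<Longrightarrow> ((\<lambda>t. c t i) has_real_derivative c' i) (at t0 within S)"
  shows "((\<lambda>t. f (c t)) has_real_derivative (\<Sum>i\<in>{1..d}. partial i f (c t0) * c' i))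
    (at t0 within S)"
proof -
  define P where "P t z \<longleftrightarrow> (\<forall>i\<in>{1..d}. z i \<in> pts d \<and> (\<forall>k. z i k \<in> closed_segment (c t0 k) (c t k))) \<and>
    f (c t) - f (c t0) = (\<Sum>i\<in>{1..d}. partial i f (z i) * (c t i - c t0 i))" for t z
  have "\<exists>z. P t z" if "t \<in> S" for t
    using cdiff_mvt[OF f c[OF t0] c[OF that]] unfolding P_def .
  then obtain z where "\<And>t. t \<in> S \<Longrightarrow> P t (z t)"
    by metis
  then have z:
    "\<And>t i. t \<in> S \<Longrightarrow> i \<in> {1..d} \<Longrightarrow> z t i \<in> pts d"
    "\<And>t i k. t \<in> S \<Longrightarrow> i \<in> {1..d} \<Longrightarrow> z t i k \<in> closed_segment (c t0 k) (c t k)"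
    "\<And>t. t \<in> S \<Longrightarrow> f (c t) - f (c t0) = (\<Sum>i\<in>{1..d}. partial i f (z t i) * (c t i - c t0 i))"
    unfolding P_def by blast+
  let ?F = "at t0 within S"
  have evS: "eventually (\<lambda>t. t \<in> S) ?F"
    by (simp add: eventually_at_filter)
  have ck: "((\<lambda>t. c t k) \<longlongrightarrow> c t0 k) ?F" for k
  proof (cases "k \<in> {1..d}")
    case True
    then show ?thesis using D[of k] DERIV_continuous continuous_within by blast
  next
    case False
    then have "\<And>t. t \<in> S \<Longrightarrow> c t k = c t0 k"
      using c t0 by (auto simp: pts_def)
    then have "eventually (\<lambda>t. c t0 k = c t k) ?F"
      using evS by (auto elim!: eventually_mono)
    then show ?thesis using tendsto_cong tendsto_const by force
  qed
  have zk: "((\<lambda>t. z t i k) \<longlongrightarrow> c t0 k) ?F" if i: "i \<in> {1..d}" for i k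
  proof -
    have "((\<lambda>t. \<bar>c t k - c t0 k\<bar>) \<longlongrightarrow> 0) ?F"
      using ck[of k] by (simp add: LIM_zero tendsto_rabs_zero)
    then have "((\<lambda>t. z t i k - c t0 k) \<longlongrightarrow> 0) ?F"
      by (rule Lim_null_comparison[rotated])
        (use evS in eventually_elim, use z(2)[OF _ i] closed_segment_abs_le in auto)
    then show ?thesis by (simp add: LIM_zero_iff)
  qed
  have pz: "((\<lambda>t. partial i f (z t i)) \<longlongrightarrow> partial i f (c t0)) ?F" if i: "i \<in> {1..d}" for i
  proof -
    have "continuous_on (pts d) (partial i f)"
      using f i by (cases N) auto
    moreover have "((\<lambda>t. z t i) \<longlongrightarrow> c t0) ?F"
      using zk[OF i] tendsto_fun_iff by blast
    moreover have "eventually (\<lambda>t. z t i \<in> pts d) ?F"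
      using evS z(1)[OF _ i] by (auto elim!: eventually_mono)
    ultimately show ?thesis
      using continuous_on_tendsto_compose c[OF t0] by blast
  qed
  have "((\<lambda>t. \<Sum>i\<in>{1..d}. partial i f (z t i) * ((c t i - c t0 i) / (t - t0)))
     \<longlongrightarrow> (\<Sum>i\<in>{1..d}. partial i f (c t0) * c' i)) ?F"
    by (intro tendsto_sum tendsto_mult pz) (use D in \<open>auto simp: has_field_derivative_iff\<close>)
  moreover have "eventually (\<lambda>t. (\<Sum>i\<in>{1..d}. partial i f (z t i) * ((c t i - c t0 i) / (t - t0)))
      = (f (c t) - f (c t0)) / (t - t0)) ?F"
    using evS by eventually_elim (simp add: z(3) sum_divide_distrib)
  ultimately show ?thesis
    unfolding has_field_derivative_iff using tendsto_cong by force
qed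

text \<open>An explicit formula \<open>g i\<close> for the derivatives may stand in for
  \<open>partial i f\<close>: the two agree on \<open>pts d\<close>, and \<open>cdiff\<close>
  depends only on values there.\<close>

lemma cdiff_SucI:
  assumes "continuous_on (pts d) f"
    and D: "\<And>x i. x \<in> pts d \<Longrightarrow> i \<in> {1..d} \<Longrightarrow>
      ((\<lambda>t. f (x(i := t))) has_real_derivative g i x) (at (x i))"
    and g: "\<And>i. i \<in> {1..d} \<Longrightarrow> cdiff d k (g i)"
  shows "cdiff d (Suc k) f"
proof -
  have "cdiff d k (partial i f)" if i: "i \<in> {1..d}" for i
    using g[OF i] cdiff_cong[of d "partial i f" "g i", OF partialI[OF D[OF _ i]]] by blast
  then show ?thesis
    using assms(1) D unfolding cdiff.simps real_differentiable_def by blast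
qed

lemma cdiff_SucE:
  assumes "cdiff d (Suc k) f"
  shows "continuous_on (pts d) f" "\<And>i. i \<in> {1..d} \<Longrightarrow> cdiff d k (partial i f)"
    "\<And>x i. x \<in> pts d \<Longrightarrow> i \<in> {1..d} \<Longrightarrow>
      ((\<lambda>t. f (x(i := t))) has_real_derivative partial i f x) (at (x i))"
  using assms cdiff_DERIV[OF assms, of x i "x i" for x i] by auto

section \<open>Closure of the differentiability classes under algebraic operations and
  composition\<close>

lemma cdiff_const: "cdiff d k (\<lambda>x. c)"
proof (induction k arbitrary: c)
  case (Suc k)
  show ?case
    by (rule cdiff_SucI[where g = "\<lambda>i x. 0"]) (use Suc in auto)
qed simp

lemma cdiff_add:
  "cdiff d k f \<Longrightarrow> cdiff d k g \<Longrightarrow> cdiff d k (\<lambda>x. f x + g x)"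
proof (induction k arbitrary: f g)
  case 0
  then show ?case by (simp add: continuous_on_add)
next
  case (Suc k)
  note fD = cdiff_SucE[OF Suc.prems(1)] and gD = cdiff_SucE[OF Suc.prems(2)]
  show ?case
    by (rule cdiff_SucI[OF continuous_on_add[OF fD(1) gD(1)] DERIV_add[OF fD(3) gD(3)]])
      (use Suc.IH[OF fD(2) gD(2)] in auto)
qed

lemma cdiff_mult:
  "cdiff d k f \<Longrightarrow> cdiff d k g \<Longrightarrow> cdiff d k (\<lambda>x. f x * g x)"
proof (induction k arbitrary: f g)
  case 0
  then show ?case by (simp add: continuous_on_mult)
next
  case (Suc k)
  note fD = cdiff_SucE[OF Suc.prems(1)] and gD = cdiff_SucE[OF Suc.prems(2)]
  show ?case
  proof (rule cdiff_SucI[OF continuous_on_mult[OF fD(1) gD(1)]])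
    show "((\<lambda>t. f (x(i := t)) * g (x(i := t))) has_real_derivative
        partial i f x * g x + partial i g x * f x) (at (x i))"
      if "x \<in> pts d" "i \<in> {1..d}" for x i
      by (rule DERIV_cong[OF DERIV_mult[OF fD(3)[OF that] gD(3)[OF that]]]) simp
    show "cdiff d k (\<lambda>x. partial i f x * g x + partial i g x * f x)" if "i \<in> {1..d}" for i
      using fD(2) gD(2) that cdiff_SucD[OF Suc.prems(1)] cdiff_SucD[OF Suc.prems(2)]
      by (intro cdiff_add Suc.IH)
  qed
qed

lemma cdiff_sum:
  "finite A \<Longrightarrow> (\<And>a. a \<in> A \<Longrightarrow> cdiff d k (f a)) \<Longrightarrow> cdiff d k (\<lambda>x. \<Sum>a\<in>A. f a x)"
proof (induction A rule: finite_induct)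
  case (insert a A)
  then show ?case by (simp add: cdiff_add)
qed (simp add: cdiff_const)

lemma partial_comp:
  assumes f: "cdiff e (Suc N) f" and maps: "\<And>x. x \<in> pts d \<Longrightarrow> \<phi> x \<in> pts e"
    and \<phi>: "\<And>j. j \<in> {1..e} \<Longrightarrow> cdiff d (Suc N) (\<lambda>x. \<phi> x j)"
    and x: "x \<in> pts d" and k: "k \<in> {1..d}"
  shows "((\<lambda>t. f (\<phi> (x(k := t)))) has_real_derivative
      (\<Sum>j\<in>{1..e}. partial j f (\<phi> (x(k := t))) * partial k (\<lambda>x. \<phi> x j) (x(k := t)))) (at t)"
proof (rule cdiff_chain_curve[where c = "\<lambda>t. \<phi> (x(k := t))" and S = UNIV and ?t0.0 = t
      and c' = "\<lambda>j. partial k (\<lambda>x. \<phi> x j) (x(k := t))", OF f])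
  show "\<phi> (x(k := s)) \<in> pts e" for s
    by (rule maps[OF pts_upd[OF x k]])
  show "((\<lambda>t. \<phi> (x(k := t)) i) has_real_derivative
      partial k (\<lambda>x. \<phi> x i) (x(k := t))) (at t)" if "i \<in> {1..e}" for i
    by (rule cdiff_DERIV[OF \<phi>[OF that] x k])
  show "t \<in> UNIV" ..
qed

text \<open>By the chain rule the derivatives of the composite are sums of products of
  \<open>partial j f\<close> composed with \<phi> and derivatives of \<phi>; all of these have one
  order less, so the induction runs with f arbitrary.\<close>

lemma cdiff_comp:
  assumes "cdiff e N f" "\<And>x. x \<in> pts d \<Longrightarrow> \<phi> x \<in> pts e"
    "\<And>j. j \<in> {1..e} \<Longrightarrow> cdiff d N (\<lambda>x. \<phi> x j)"
  shows "cdiff d N (\<lambda>x. f (\<phi> x))"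
proof -
  have cont: "continuous_on (pts d) (\<lambda>x. g (\<phi> x))"
    if g: "continuous_on (pts e) g" and \<phi>: "\<And>x. x \<in> pts d \<Longrightarrow> \<phi> x \<in> pts e"
      "\<And>j. j \<in> {1..e} \<Longrightarrow> continuous_on (pts d) (\<lambda>x. \<phi> x j)" for g
  proof (rule continuous_on_compose2[OF g])
    \<comment> \<open>The product topology asks for all coordinates; those outside 1..e are
      constantly 0 because \<phi> maps into \<open>pts e\<close>.\<close>
    have "continuous_on (pts d) (\<lambda>x. \<phi> x j)" for j
    proof (cases "j \<in> {1..e}")
      case False
      have "\<phi> x j = 0" if "x \<in> pts d" for x
        using \<phi>(1)[OF that] False unfolding pts_def by blast
      then have "continuous_on (pts d) (\<lambda>x. \<phi> x j) = continuous_on (pts d) (\<lambda>x. 0 :: real)"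
        by (intro continuous_on_cong) auto
      then show ?thesis by simp
    qed (rule \<phi>(2))
    then show "continuous_on (pts d) \<phi>"
      by (rule continuous_on_coordinatewise_then_product)
    show "\<phi> ` pts d \<subseteq> pts e"
      using \<phi>(1) by blast
  qed
  show ?thesis
    using assms
  proof (induction N arbitrary: f)
    case 0
    then show ?case using cont by simp
  next
    case (Suc N)
    show ?case
    proof (rule cdiff_SucI)
      show "continuous_on (pts d) (\<lambda>x. f (\<phi> x))"
        by (rule cont[OF cdiff_SucE(1)[OF Suc.prems(1)] Suc.prems(2)
          cdiff_SucE(1)[OF Suc.prems(3)]])
      show "((\<lambda>t. f (\<phi> (x(i := t)))) has_real_derivative
          (\<Sum>j\<in>{1..e}. partial j f (\<phi> x) * partial i (\<lambda>x. \<phi> x j) x)) (at (x i))"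
        if "x \<in> pts d" "i \<in> {1..d}" for x i
        using partial_comp[OF Suc.prems that, of "x i"] by (simp only: fun_upd_triv)
      show "cdiff d N (\<lambda>x. \<Sum>j\<in>{1..e}. partial j f (\<phi> x) * partial i (\<lambda>x. \<phi> x j) x)"
        if "i \<in> {1..d}" for i
      proof (intro cdiff_sum cdiff_mult finite_atLeastAtMost)
        fix j assume j: "j \<in> {1..e}"
        show "cdiff d N (\<lambda>x. partial j f (\<phi> x))"
          by (rule Suc.IH[OF cdiff_SucE(2)[OF Suc.prems(1) j] Suc.prems(2)
            cdiff_SucD[OF Suc.prems(3)]])
        show "cdiff d N (partial i (\<lambda>x. \<phi> x j))"
          by (rule cdiff_SucE(2)[OF Suc.prems(3)[OF j] that])
      qed
    qed
  qed
qed

lemma smooth_fun_const: "smooth_fun d (\<lambda>x. c)"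
  by (simp add: smooth_fun_def cdiff_const)

lemma smooth_fun_add: "smooth_fun d f \<Longrightarrow> smooth_fun d g \<Longrightarrow> smooth_fun d (\<lambda>x. f x + g x)"
  by (simp add: smooth_fun_def cdiff_add)

lemma smooth_fun_mult: "smooth_fun d f \<Longrightarrow> smooth_fun d g \<Longrightarrow> smooth_fun d (\<lambda>x. f x * g x)"
  by (simp add: smooth_fun_def cdiff_mult)

lemma smooth_fun_sum:
  "finite A \<Longrightarrow> (\<And>a. a \<in> A \<Longrightarrow> smooth_fun d (f a)) \<Longrightarrow> smooth_fun d (\<lambda>x. \<Sum>a\<in>A. f a x)"
  by (simp add: smooth_fun_def cdiff_sum)

lemma smooth_fun_comp:
  assumes "smooth_fun e f" "\<And>x. x \<in> pts d \<Longrightarrow> \<phi> x \<in> pts e"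
    "\<And>j. j \<in> {1..e} \<Longrightarrow> smooth_fun d (\<lambda>x. \<phi> x j)"
  shows "smooth_fun d (\<lambda>x. f (\<phi> x))"
  using assms cdiff_comp unfolding smooth_fun_def by blast

lemma smooth_fun_coord: "smooth_fun d (\<lambda>x. x k)"
proof -
  have cont: "continuous_on (pts d) (\<lambda>x. x k)"
    by (rule continuous_on_subset[OF continuous_on_product_coordinates]) simp
  have "cdiff d N (\<lambda>x. x k)" for N
  proof (cases N)
    case (Suc M)
    show ?thesis
      unfolding Suc
    proof (rule cdiff_SucI[OF cont])
      show "((\<lambda>t. (x(i := t)) k) has_real_derivative (if i = k then 1 else 0)) (at (x i))"
        for x :: pt and i
        by (cases "i = k") auto
    qed (rule cdiff_const)
  qed (simp add: cont)
  then show ?thesis by (simp add: smooth_fun_def)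
qed

subsection \<open>Symmetry of second derivatives\<close>

text \<open>Two mean value steps: one in direction i for the increment of f in direction j, then one
  in direction j for \<open>partial i f\<close>. The second difference itself is symmetric in i and
  j.\<close>

lemma second_difference:
  assumes f: "smooth_fun d f" and x: "x \<in> pts d" and ij: "i \<in> {1..d}" "j \<in> {1..d}" "i \<noteq> j"
    and h: "0 < h"
  shows "\<exists>a b. 0 < a \<and> a < h \<and> 0 < b \<and> b < h \<and>
    f (x(i := x i + h, j := x j + h)) - f (x(i := x i + h)) - f (x(j := x j + h)) + f x
      = h * h * partial j (partial i f) (x(i := x i + a, j := x j + b))"
proof -
  let ?y = "x(j := x j + h)"
  have y: "?y \<in> pts d" using x ij pts_upd by blast
  have "\<exists>s. x i < s \<and> s < x i + h \<and>
      (f (?y(i := x i + h)) - f (x(i := x i + h))) - (f (?y(i := x i)) - f (x(i := x i)))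
      = ((x i + h) - x i) * (partial i f (?y(i := s)) - partial i f (x(i := s)))"
    by (rule MVT2[where f = "\<lambda>s. f (?y(i := s)) - f (x(i := s))"])
      (use h in \<open>auto intro!: DERIV_diff smooth_fun_DERIV[OF f] y x ij(1) simp del: fun_upd_apply\<close>)
  then obtain s where s: "x i < s" "s < x i + h"
      "(f (?y(i := x i + h)) - f (x(i := x i + h))) - (f (?y(i := x i)) - f (x(i := x i)))
      = h * (partial i f (?y(i := s)) - partial i f (x(i := s)))" by auto
  let ?w = "x(i := s)"
  have w: "?w \<in> pts d" using x ij pts_upd by blast
  have "\<exists>t. x j < t \<and> t < x j + h \<and>
      partial i f (?w(j := x j + h)) - partial i f (?w(j := x j))
      = ((x j + h) - x j) * partial j (partial i f) (?w(j := t))"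
    by (rule MVT2[where f = "\<lambda>t. partial i f (?w(j := t))"])
      (use h in \<open>auto intro!: smooth_fun_DERIV[OF smooth_fun_partial[OF f ij(1)]] w ij(2) simp del: fun_upd_apply\<close>)
  then obtain t where t: "x j < t" "t < x j + h"
      "partial i f (?w(j := x j + h)) - partial i f (?w(j := x j))
      = h * partial j (partial i f) (?w(j := t))" by auto
  have 1: "?w(j := x j) = x(i := s)" "?w(j := x j + h) = ?y(i := s)"
    "?y(i := x i + h) = x(i := x i + h, j := x j + h)" "?y(i := x i) = ?y" "x(i := x i) = x"
    using ij(3) by (auto simp: fun_eq_iff)
  show ?thesis
    using s t unfolding 1
    by (intro exI[of _ "s - x i"] exI[of _ "t - x j"]) (auto simp: algebra_simps)
qed

text \<open>Equating the two evaluations of the same second difference and cancelling h^2 gives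
  equal mixed derivatives at two points within h of x; continuity transfers the equality to x as h
  tends to 0.\<close>

lemma partial_commute:
  assumes f: "smooth_fun d f" and x: "x \<in> pts d" and ij: "i \<in> {1..d}" "j \<in> {1..d}"
  shows "partial i (partial j f) x = partial j (partial i f) x"
proof (cases "i = j")
  case False
  define h where "h n = 1 / real (Suc n)" for n
  have h: "h \<longlonglongrightarrow> 0" unfolding h_def using LIMSEQ_Suc[OF lim_1_over_n] .
  have hp: "h n > 0" for n by (simp add: h_def)
  have "\<exists>p q. (\<exists>a b a' b'. 0 < a \<and> a < h n \<and> 0 < b \<and> b < h n \<and> 0 < a' \<and> a' < h n \<and> 0 < b' \<and> b' < h n
      \<and> p = x(i := x i + a, j := x j + b) \<and> q = x(j := x j + a', i := x i + b'))
      \<and> partial j (partial i f) p = partial i (partial j f) q" for n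
  proof -
    have sw: "x(i := x i + h n, j := x j + h n) = x(j := x j + h n, i := x i + h n)"
      using False by (auto simp: fun_eq_iff)
    obtain a b where ab: "0 < a" "a < h n" "0 < b" "b < h n"
      "f (x(i := x i + h n, j := x j + h n)) - f (x(i := x i + h n)) - f (x(j := x j + h n)) + f x
      = h n * h n * partial j (partial i f) (x(i := x i + a, j := x j + b))"
      using second_difference[OF f x ij False hp] by blast
    obtain a' b' where ab': "0 < a'" "a' < h n" "0 < b'" "b' < h n"
      "f (x(j := x j + h n, i := x i + h n)) - f (x(j := x j + h n)) - f (x(i := x i + h n)) + f x
      = h n * h n * partial i (partial j f) (x(j := x j + a', i := x i + b'))"
      using second_difference[OF f x ij(2,1) False[symmetric] hp] by blast
    have "h n * h n * partial j (partial i f) (x(i := x i + a, j := x j + b)) =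
      h n * h n * partial i (partial j f) (x(j := x j + a', i := x i + b'))"
      using ab(5) ab'(5) unfolding sw by linarith
    then have "partial j (partial i f) (x(i := x i + a, j := x j + b)) =
      partial i (partial j f) (x(j := x j + a', i := x i + b'))"
      using hp[of n] by simp
    then show ?thesis
      using ab(1-4) ab'(1-4) by blast
  qed
  then obtain p q where pq0: "\<And>n. \<exists>a b a' b'. 0 < a \<and> a < h n \<and> 0 < b \<and> b < h n \<and> 0 < a' \<and> a' < h n \<and> 0 < b' \<and> b' < h n
      \<and> p n = x(i := x i + a, j := x j + b) \<and> q n = x(j := x j + a', i := x i + b')"
      and eq: "\<And>n. partial j (partial i f) (p n) = partial i (partial j f) (q n)"
    by metis
  have in_pts: "p n \<in> pts d" "q n \<in> pts d" for n
    using pq0[of n] x ij pts_upd by auto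
  have close: "\<bar>p n k - x k\<bar> \<le> h n" "\<bar>q n k - x k\<bar> \<le> h n" for n k
    using pq0[of n] hp[of n] by (auto split: if_splits)
  have "(\<lambda>n. p n k) \<longlonglongrightarrow> x k" "(\<lambda>n. q n k) \<longlonglongrightarrow> x k" for k
    by (rule LIM_zero_cancel, rule Lim_null_comparison[OF _ h], use close in auto)+
  then have "p \<longlonglongrightarrow> x" "q \<longlonglongrightarrow> x"
    by (simp_all add: tendsto_fun_iff)
  moreover have "(\<lambda>n. partial k (partial l f) (u n)) \<longlonglongrightarrow> partial k (partial l f) x"
    if "u \<longlonglongrightarrow> x" "k \<in> {1..d}" "l \<in> {1..d}" "\<And>n. u n \<in> pts d" for u k l
    by (rule continuous_on_tendsto_compose[OF smooth_fun_continuous that(1) x])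
      (use smooth_fun_partial f that in auto)
  ultimately have "(\<lambda>n. partial j (partial i f) (p n)) \<longlonglongrightarrow> partial j (partial i f) x"
    "(\<lambda>n. partial i (partial j f) (q n)) \<longlonglongrightarrow> partial i (partial j f) x"
    using ij in_pts by simp_all
  then show ?thesis
    using LIMSEQ_unique eq by simp
qed simp

subsection \<open>Lipschitz curves\<close>

text \<open>Tychonoff's theorem for the product topology on \<open>nat => real\<close>.\<close>

lemma compact_real_box: "compact {z :: nat \<Rightarrow> real. \<forall>k. z k \<in> {- R k..R k}}"
proof -
  have "compactin (product_topology (\<lambda>i. euclidean) UNIV) (Pi\<^sub>E UNIV (\<lambda>k. {- R k..R k}))"
    unfolding compactin_PiE by auto
  then show ?thesis
    by (simp add: euclidean_product_topology PiE_def Pi_def)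
qed

lemma lip_curve_bounded:
  assumes "lip_curve d c"
  shows "\<exists>B. \<forall>t\<in>{0..1}. \<bar>c t i\<bar> \<le> B"
proof (cases "i \<in> {1..d}")
  case True
  then obtain C where "C-lipschitz_on {0..1} (\<lambda>t. c t i)"
    using assms unfolding lip_curve_def by blast
  then have "bounded ((\<lambda>t. c t i) ` {0..1})"
    using lipschitz_on_continuous_on compact_continuous_image compact_imp_bounded by blast
  then show ?thesis
    by (auto simp: bounded_iff)
next
  case False
  then show ?thesis
    using assms by (intro exI[of _ 0]) (auto simp: lip_curve_def pts_def)
qed

text \<open>The curve lives in a compact coordinate box on which the partial derivatives are
  bounded. The intermediate points of the mean value formula stay in that box because each of their
  coordinates lies between two values of the curve.\<close>

lemma smooth_fun_lipschitz:
  assumes f: "smooth_fun d f" and c: "lip_curve d c"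
  shows "\<exists>C. C-lipschitz_on {0..1} (\<lambda>t. f (c t))"
proof -
  obtain R0 where R0: "\<And>i t. t \<in> {0..1} \<Longrightarrow> \<bar>c t i\<bar> \<le> R0 i"
    using lip_curve_bounded[OF c] by metis
  \<comment> \<open>The side is 0 outside 1..d, which places the box inside
    \<open>pts d\<close>.\<close>
  define R where "R k = (if k \<in> {1..d} then R0 k else 0)" for k
  define K where "K = {z :: nat \<Rightarrow> real. \<forall>k. z k \<in> {- R k..R k}}"
  have cp: "c t \<in> pts d" if "t \<in> {0..1}" for t
    using c that unfolding lip_curve_def by blast
  have cR: "c t k \<in> {- R k..R k}" if "t \<in> {0..1}" for t k
    using R0[OF that, of k] cp[OF that] unfolding R_def pts_def by auto
  have "z \<in> pts d" if "z \<in> K" for z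
  proof -
    have "z k = 0" if "k \<notin> {1..d}" for k
    proof -
      have "z k \<in> {- R k..R k}" using \<open>z \<in> K\<close> unfolding K_def by blast
      moreover have "R k = 0" using that unfolding R_def by argo
      ultimately show ?thesis by simp
    qed
    then show ?thesis by (simp add: pts_def)
  qed
  then have K: "compact K" "K \<subseteq> pts d"
    unfolding K_def using compact_real_box by auto
  have "\<exists>B. \<forall>z\<in>K. \<bar>partial i f z\<bar> \<le> B" if "i \<in> {1..d}" for i
  proof -
    have "bounded (partial i f ` K)"
      using smooth_fun_continuous[OF smooth_fun_partial[OF f that]] K
      by (meson compact_continuous_image compact_imp_bounded continuous_on_subset)
    then show ?thesis by (auto simp: bounded_iff)
  qed
  then obtain B where B: "\<And>i z. i \<in> {1..d} \<Longrightarrow> z \<in> K \<Longrightarrow> \<bar>partial i f z\<bar> \<le> B i"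
    by metis
  have "\<forall>i\<in>{1..d}. \<exists>C. C-lipschitz_on {0..1} (\<lambda>t. c t i)"
    using c by (simp add: lip_curve_def)
  then obtain C where C: "\<And>i. i \<in> {1..d} \<Longrightarrow> (C i)-lipschitz_on {0..1} (\<lambda>t. c t i)"
    using bchoice[of "{1..d}" "\<lambda>i C. C-lipschitz_on {0..1} (\<lambda>t. c t i)"] by blast
  have "(\<Sum>i\<in>{1..d}. \<bar>B i\<bar> * C i)-lipschitz_on {0..1} (\<lambda>t. f (c t))"
  proof (rule lipschitz_onI)
    show "0 \<le> (\<Sum>i\<in>{1..d}. \<bar>B i\<bar> * C i)"
      using C lipschitz_on_nonneg by (intro sum_nonneg mult_nonneg_nonneg) auto
    fix s t :: real assume st: "s \<in> {0..1}" "t \<in> {0..1}"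
    have "cdiff d (Suc 0) f" using f unfolding smooth_fun_def by blast
    from cdiff_mvt[OF this cp[OF st(2)] cp[OF st(1)]]
    obtain z where z: "\<And>i k. i \<in> {1..d} \<Longrightarrow> z i k \<in> closed_segment (c t k) (c s k)"
      "f (c s) - f (c t) = (\<Sum>i\<in>{1..d}. partial i f (z i) * (c s i - c t i))"
      by blast
    have zK: "z i \<in> K" if "i \<in> {1..d}" for i
    proof -
      have "z i k \<in> {- R k..R k}" for k
        using z(1)[OF that, of k] cR[OF st(1), of k] cR[OF st(2), of k]
        by (auto simp: closed_segment_eq_real_ivl split: if_splits)
      then show ?thesis by (simp add: K_def)
    qed
    have "\<bar>f (c s) - f (c t)\<bar> \<le> (\<Sum>i\<in>{1..d}. \<bar>partial i f (z i) * (c s i - c t i)\<bar>)"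
      unfolding z(2) by (rule sum_abs)
    also have "\<dots> \<le> (\<Sum>i\<in>{1..d}. \<bar>B i\<bar> * (C i * \<bar>s - t\<bar>))"
    proof (rule sum_mono)
      fix i assume i: "i \<in> {1..d}"
      have "\<bar>c s i - c t i\<bar> \<le> C i * \<bar>s - t\<bar>"
        using lipschitz_onD[OF C[OF i] st] by (simp add: dist_real_def)
      moreover have "\<bar>partial i f (z i)\<bar> \<le> \<bar>B i\<bar>"
        using B[OF i zK[OF i]] by linarith
      ultimately show "\<bar>partial i f (z i) * (c s i - c t i)\<bar> \<le> \<bar>B i\<bar> * (C i * \<bar>s - t\<bar>)"
        unfolding abs_mult by (intro mult_mono) auto
    qed
    finally show "dist (f (c s)) (f (c t)) \<le> (\<Sum>i\<in>{1..d}. \<bar>B i\<bar> * C i) * dist s t"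
      by (simp add: dist_real_def sum_distrib_right mult.assoc)
  qed
  then show ?thesis by blast
qed

lemma lipschitz_mult:
  fixes f g :: "real \<Rightarrow> real"
  assumes f: "C-lipschitz_on {0..1} f" and g: "D-lipschitz_on {0..1} g"
  shows "\<exists>E. E-lipschitz_on {0..1} (\<lambda>t. f t * g t)"
proof -
  have "bounded (f ` {0..1})" "bounded (g ` {0..1})"
    using f g lipschitz_on_continuous_on compact_continuous_image compact_imp_bounded by blast+
  then obtain A B where AB: "\<And>t. t \<in> {0..1} \<Longrightarrow> \<bar>f t\<bar> \<le> A" "\<And>t. t \<in> {0..1} \<Longrightarrow> \<bar>g t\<bar> \<le> B"
    unfolding bounded_iff by (metis image_eqI real_norm_def)
  have nn: "0 \<le> A" "0 \<le> B" "0 \<le> C" "0 \<le> D"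
    using AB(1)[of 0] AB(2)[of 0] lipschitz_on_nonneg f g by force+
  have "(A * D + B * C)-lipschitz_on {0..1} (\<lambda>t. f t * g t)"
  proof (rule lipschitz_onI)
    show "0 \<le> A * D + B * C" using nn by simp
    fix s t :: real assume st: "s \<in> {0..1}" "t \<in> {0..1}"
    have "f s * g s - f t * g t = f s * (g s - g t) + g t * (f s - f t)"
      by (simp add: algebra_simps)
    then have "\<bar>f s * g s - f t * g t\<bar> \<le> \<bar>f s\<bar> * \<bar>g s - g t\<bar> + \<bar>g t\<bar> * \<bar>f s - f t\<bar>"
      by (metis abs_mult abs_triangle_ineq)
    also have "\<dots> \<le> A * (D * \<bar>s - t\<bar>) + B * (C * \<bar>s - t\<bar>)"
      using AB st nn lipschitz_onD[OF f st] lipschitz_onD[OF g st]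
      by (intro add_mono mult_mono) (auto simp: dist_real_def)
    finally show "dist (f s * g s) (f t * g t) \<le> (A * D + B * C) * dist s t"
      by (simp add: dist_real_def algebra_simps)
  qed
  then show ?thesis by blast
qed

lemma lipschitz_sum:
  fixes f :: "'a \<Rightarrow> real \<Rightarrow> real"
  assumes "finite A" "\<And>a. a \<in> A \<Longrightarrow> \<exists>C. C-lipschitz_on {0..1} (f a)"
  shows "\<exists>C. C-lipschitz_on {0..1} (\<lambda>t. \<Sum>a\<in>A. f a t)"
  using assms
proof (induction A rule: finite_induct)
  case empty
  then show ?case using lipschitz_on_constant by fastforce
next
  case (insert a A)
  then obtain C D where "C-lipschitz_on {0..1} (f a)" "D-lipschitz_on {0..1} (\<lambda>t. \<Sum>a\<in>A. f a t)"
    by (metis insertCI)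
  then have "(C + D)-lipschitz_on {0..1} (\<lambda>t. f a t + (\<Sum>a\<in>A. f a t))"
    by (rule lipschitz_on_add)
  then show ?case using insert.hyps by auto
qed

text \<open>The image of [0,1] is null: the exceptional null set has null image because f is
  Lipschitz, and on the rest Sard's theorem applies to the vanishing derivative. But the image is
  connected, so two distinct values would force it to contain an interval of positive
  length.\<close>

lemma lipschitz_AE_deriv_zero_const:
  fixes f :: "real \<Rightarrow> real"
  assumes lip: "C-lipschitz_on {0..1} f"
    and ae: "AE t in lborel. t \<in> {0..1} \<longrightarrow> (f has_real_derivative 0) (at t within {0..1})"
    and t: "t \<in> {0..1}"
  shows "f t = f 0"
proof (rule ccontr)
  assume ne: "f t \<noteq> f 0"
  \<comment> \<open>Sard's theorem is formulated with the rank of a Jacobian matrix, so the values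
    are moved to \<open>real ^ 1\<close>, as is the domain in \<open>S\<close> below.\<close>
  define F where "F x = (vec (f x) :: real ^ 1)" for x
  define N where "N = {t \<in> {0..1}. \<not> (f has_real_derivative 0) (at t within {0..1})}"
  obtain N0 where N0: "N0 \<in> null_sets lborel"
    "{t \<in> space lborel. \<not> (t \<in> {0..1} \<longrightarrow> (f has_real_derivative 0) (at t within {0..1}))} \<subseteq> N0"
    using ae unfolding eventually_ae_filter by blast
  have "negligible N0"
    using N0(1) by (simp add: negligible_iff_null_sets null_sets_completionI)
  then have N: "negligible N"
    by (rule negligible_subset) (use N0(2) in \<open>auto simp: N_def\<close>)
  have distF: "norm (F y - F x) = \<bar>f y - f x\<bar>" for x y
  proof -
    have "F y - F x = vec (f y - f x)" by (simp add: F_def vec_eq_iff)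
    then show ?thesis by (simp add: norm_real)
  qed
  have 1: "negligible (F ` N)"
  proof (rule negligible_locally_Lipschitz_image[OF _ N])
    fix x assume x: "x \<in> N"
    have "norm (F y - F x) \<le> C * norm (y - x)" if "y \<in> N" for y
      using that x lipschitz_onD[OF lip, of y x] unfolding distF by (auto simp: N_def dist_real_def)
    then show "\<exists>T B. open T \<and> x \<in> T \<and> (\<forall>y\<in>N \<inter> T. norm (F y - F x) \<le> B * norm (y - x))"
      by (intro exI[of _ UNIV] exI[of _ C]) auto
  qed simp
  define S where "S = {x :: real ^ 1. x $ 1 \<in> {0..1} - N}"
  have 2: "negligible ((\<lambda>x. F (x $ 1)) ` S)"
  proof (rule baby_Sard[where f' = "\<lambda>x y. 0"])
    fix x assume x: "x \<in> S"
    have "(f has_derivative (\<lambda>h. 0)) (at (x $ 1) within {0..1})"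
      using x by (auto simp: S_def N_def has_field_derivative_def mult_zero_left[abs_def])
    then have "((\<lambda>h. (f h)) has_derivative (\<lambda>h. 0)) (at (x $ 1) within (\<lambda>x. x $ 1) ` S)"
      by (rule has_derivative_subset) (auto simp: S_def)
    from has_derivative_in_compose[of "\<lambda>x. x $ 1" "\<lambda>x. x $ 1" x S, OF _ this]
    have "((\<lambda>x. f (x $ 1)) has_derivative (\<lambda>h. 0)) (at x within S)"
      by (simp add: bounded_linear_imp_has_derivative bounded_linear_vec_nth)
    then have "((\<lambda>x. \<chi> i. f (x $ 1)) has_derivative (\<lambda>h. \<chi> i. 0)) (at x within S)"
      by (subst has_derivative_componentwise_within) (auto simp: Basis_vec_def inner_axis)
    then show "((\<lambda>x. F (x $ 1)) has_derivative (\<lambda>y. 0)) (at x within S)"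
      by (simp add: F_def vec_def zero_vec_def)
  next
    have "matrix (\<lambda>y :: real ^ 1. 0 :: real ^ 1) = 0" by (simp add: matrix_def vec_eq_iff)
    then show "rank (matrix (\<lambda>y :: real ^ 1. 0 :: real ^ 1)) < CARD(1)" by simp
  qed simp
  have "F ` {0..1} \<subseteq> F ` N \<union> (\<lambda>x. F (x $ 1)) ` S"
  proof
    fix y assume "y \<in> F ` {0..1}"
    then obtain s where s: "s \<in> {0..1}" "y = F s" by blast
    show "y \<in> F ` N \<union> (\<lambda>x. F (x $ 1)) ` S"
    proof (cases "s \<in> N")
      case False
      then have "vec s \<in> S" "y = F ((vec s :: real ^ 1) $ 1)"
        using s by (simp_all add: S_def)
      then show ?thesis by blast
    qed (use s in blast)
  qed
  with 1 2 have neg: "negligible (F ` {0..1})"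
    using negligible_Un negligible_subset by blast
  have conn: "connected (f ` {0..1})"
    by (rule connected_continuous_image[OF lipschitz_on_continuous_on[OF lip]]) simp
  define a b where "a = min (f 0) (f t)" and "b = max (f 0) (f t)"
  have ab: "a < b" "a \<in> f ` {0..1}" "b \<in> f ` {0..1}"
    using ne t by (auto simp: a_def b_def min_def max_def)
  have "cbox (vec a) (vec b) \<subseteq> F ` {0..1}"
  proof
    fix y :: "real ^ 1" assume "y \<in> cbox (vec a) (vec b)"
    then have "a \<le> y $ 1" "y $ 1 \<le> b" by (auto simp: mem_box_cart)
    then have "y $ 1 \<in> f ` {0..1}"
      using connectedD_interval[OF conn ab(2,3)] by blast
    then show "y \<in> F ` {0..1}"
      by (auto simp: F_def vec_eq_iff image_iff)
  qed
  then have "negligible (cbox (vec a) (vec b) :: (real ^ 1) set)"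
    using neg negligible_subset by blast
  then have "box (vec a) (vec b) = ({} :: (real ^ 1) set)"
    using negligible_interval(1) by blast
  moreover have "vec ((a + b) / 2) \<in> box (vec a) (vec b :: real ^ 1)"
    using ab(1) by (auto simp: mem_box_cart)
  ultimately show False by blast
qed

section \<open>Rules for partial derivatives of smooth functions\<close>

lemma smooth_fun_DERIV_at:
  assumes "smooth_fun d f" "x \<in> pts d" "i \<in> {1..d}"
  shows "((\<lambda>t. f (x(i := t))) has_real_derivative partial i f x) (at (x i))"
  using smooth_fun_DERIV[OF assms, of "x i"] by (simp only: fun_upd_triv)

lemma partial_const [simp]: "partial i (\<lambda>x. c) x = 0"
  by (simp add: partial_def)

lemma partial_diff:
  assumes "smooth_fun d f" "smooth_fun d g" "x \<in> pts d" "i \<in> {1..d}"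
  shows "partial i (\<lambda>x. f x - g x) x = partial i f x - partial i g x"
  by (intro partialI DERIV_diff smooth_fun_DERIV_at[OF assms(1,3,4)] smooth_fun_DERIV_at[OF assms(2,3,4)])

lemma partial_mult:
  assumes "smooth_fun d f" "smooth_fun d g" "x \<in> pts d" "i \<in> {1..d}"
  shows "partial i (\<lambda>x. f x * g x) x = partial i f x * g x + f x * partial i g x"
  using DERIV_mult[OF smooth_fun_DERIV_at[OF assms(1,3,4)] smooth_fun_DERIV_at[OF assms(2,3,4)]]
  by (intro partialI) (simp add: mult.commute del: fun_upd_apply)

lemma partial_sum:
  assumes "\<And>a. a \<in> A \<Longrightarrow> smooth_fun d (f a)" "x \<in> pts d" "i \<in> {1..d}"
  shows "partial i (\<lambda>x. \<Sum>a\<in>A. f a x) x = (\<Sum>a\<in>A. partial i (f a) x)"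
  by (intro partialI DERIV_sum smooth_fun_DERIV_at[OF assms(1) assms(2,3)])

lemma partial_compose:
  assumes "smooth_fun e f" "\<And>x. x \<in> pts d \<Longrightarrow> \<phi> x \<in> pts e"
    and "\<And>j. j \<in> {1..e} \<Longrightarrow> smooth_fun d (\<lambda>x. \<phi> x j)" and "x \<in> pts d" "k \<in> {1..d}"
  shows "partial k (\<lambda>x. f (\<phi> x)) x =
    (\<Sum>j\<in>{1..e}. partial j f (\<phi> x) * partial k (\<lambda>x. \<phi> x j) x)"
proof (rule partialI)
  have "((\<lambda>t. f (\<phi> (x(k := t)))) has_real_derivative
      (\<Sum>j\<in>{1..e}. partial j f (\<phi> (x(k := x k))) * partial k (\<lambda>x. \<phi> x j) (x(k := x k)))) (at (x k))"
    by (rule partial_comp[where N = 0]) (use assms in \<open>auto simp: smooth_fun_def simp del: cdiff.simps\<close>)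
  then show "((\<lambda>t. f (\<phi> (x(k := t)))) has_real_derivative
      (\<Sum>j\<in>{1..e}. partial j f (\<phi> x) * partial k (\<lambda>x. \<phi> x j) x)) (at (x k))"
    by (simp only: fun_upd_triv)
qed

lemma smooth_fun_chain_curve:
  assumes "smooth_fun d f" "\<And>t. t \<in> S \<Longrightarrow> c t \<in> pts d" "t0 \<in> S"
    and "\<And>i. i \<in> {1..d} \<Longrightarrow> ((\<lambda>t. c t i) has_real_derivative c' i) (at t0 within S)"
  shows "((\<lambda>t. f (c t)) has_real_derivative (\<Sum>i\<in>{1..d}. partial i f (c t0) * c' i))
    (at t0 within S)"
  using cdiff_chain_curve assms unfolding smooth_fun_def by blast

subsection \<open>Brackets of vector fields\<close>

definition lie_der :: "nat \<Rightarrow> vf \<Rightarrow> (pt \<Rightarrow> real) \<Rightarrow> pt \<Rightarrow> real" where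
  "lie_der d X f x = (\<Sum>k\<in>{1..d}. X x k * partial k f x)"

definition smooth_vf :: "nat \<Rightarrow> vf \<Rightarrow> bool" where
  "smooth_vf d X \<longleftrightarrow> (\<forall>k\<in>{1..d}. smooth_fun d (\<lambda>x. X x k))"

lemma vf_bracket_eq_lie_der:
  "vf_bracket d X Y x i = lie_der d X (\<lambda>y. Y y i) x - lie_der d Y (\<lambda>y. X y i) x"
  by (simp add: vf_bracket_def lie_der_def sum_subtractf)

lemma lie_der_cong:
  assumes "\<And>y. y \<in> pts d \<Longrightarrow> f y = g y" "X x = Y x" "x \<in> pts d"
  shows "lie_der d X f x = lie_der d Y g x"
  unfolding lie_der_def using partial_cong[OF assms(1,3)] assms(2) by simp

lemma vf_bracket_cong:
  assumes "\<And>y. y \<in> pts d \<Longrightarrow> X y = X' y" "\<And>y. y \<in> pts d \<Longrightarrow> Y y = Y' y" "x \<in> pts d"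
  shows "vf_bracket d X Y x = vf_bracket d X' Y' x"
proof
  fix i
  have "lie_der d X (\<lambda>y. Y y i) x = lie_der d X' (\<lambda>y. Y' y i) x"
    "lie_der d Y (\<lambda>y. X y i) x = lie_der d Y' (\<lambda>y. X' y i) x"
    using assms by (auto intro!: lie_der_cong)
  then show "vf_bracket d X Y x i = vf_bracket d X' Y' x i"
    unfolding vf_bracket_eq_lie_der by simp
qed

lemma smooth_fun_lie_der:
  assumes "smooth_vf d X" "smooth_fun d f"
  shows "smooth_fun d (lie_der d X f)"
  unfolding lie_der_def[abs_def]
  using assms by (intro smooth_fun_sum smooth_fun_mult smooth_fun_partial) (auto simp: smooth_vf_def)

lemma lie_der_diff:
  assumes "smooth_fun d f" "smooth_fun d g" "x \<in> pts d"
  shows "lie_der d X (\<lambda>y. f y - g y) x = lie_der d X f x - lie_der d X g x"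
  unfolding lie_der_def using partial_diff[OF assms]
  by (simp add: right_diff_distrib sum_subtractf)

lemma lie_der_mult:
  assumes "smooth_fun d f" "smooth_fun d g" "x \<in> pts d"
  shows "lie_der d X (\<lambda>y. f y * g y) x = lie_der d X f x * g x + f x * lie_der d X g x"
  unfolding lie_der_def using partial_mult[OF assms]
  by (simp add: distrib_left sum.distrib sum_distrib_left sum_distrib_right mult_ac)

lemma lie_der_sum:
  assumes "\<And>a. a \<in> A \<Longrightarrow> smooth_fun d (f a)" "x \<in> pts d"
  shows "lie_der d X (\<lambda>y. \<Sum>a\<in>A. f a y) x = (\<Sum>a\<in>A. lie_der d X (f a) x)"
proof -
  have "lie_der d X (\<lambda>y. \<Sum>a\<in>A. f a y) x = (\<Sum>k\<in>{1..d}. \<Sum>a\<in>A. X x k * partial k (f a) x)"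
    unfolding lie_der_def using partial_sum[of A d f x, OF assms]
    by (intro sum.cong refl) (simp add: sum_distrib_left)
  then show ?thesis
    unfolding lie_der_def by (simp add: sum.swap[of _ A])
qed

text \<open>The assumption \<open>rel\<close> says that the differential of \<phi> carries the
  vector \<open>X x\<close> to the value of X' at \<open>\<phi> x\<close>; a function pulled back by
  \<phi> can then be differentiated on the target.\<close>

lemma lie_der_chain:
  assumes "smooth_fun e f" "\<And>x. x \<in> pts d \<Longrightarrow> \<phi> x \<in> pts e"
    and "\<And>j. j \<in> {1..e} \<Longrightarrow> smooth_fun d (\<lambda>x. \<phi> x j)" and "x \<in> pts d"
    and rel: "\<And>j. j \<in> {1..e} \<Longrightarrow> lie_der d X (\<lambda>y. \<phi> y j) x = X' (\<phi> x) j"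
  shows "lie_der d X (\<lambda>y. f (\<phi> y)) x = lie_der e X' f (\<phi> x)"
proof -
  have "lie_der d X (\<lambda>y. f (\<phi> y)) x =
      (\<Sum>k\<in>{1..d}. \<Sum>j\<in>{1..e}. partial j f (\<phi> x) * (X x k * partial k (\<lambda>x. \<phi> x j) x))"
    unfolding lie_der_def using partial_compose[OF assms(1-4)]
    by (simp add: sum_distrib_left mult_ac)
  also have "\<dots> = (\<Sum>j\<in>{1..e}. partial j f (\<phi> x) * lie_der d X (\<lambda>y. \<phi> y j) x)"
    unfolding lie_der_def by (subst sum.swap) (simp add: sum_distrib_left)
  also have "\<dots> = lie_der e X' f (\<phi> x)"
    using rel by (simp add: lie_der_def mult.commute)
  finally show ?thesis .
qed

text \<open>Each iterated derivative splits into a first-order and a second-order part. The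
  second-order parts cancel by symmetry of second derivatives, and the first-order parts form the
  bracket.\<close>

lemma lie_der_vf_bracket:
  assumes X: "smooth_vf d X" and Y: "smooth_vf d Y" and f: "smooth_fun d f" and x: "x \<in> pts d"
  shows "lie_der d (vf_bracket d X Y) f x =
    lie_der d X (lie_der d Y f) x - lie_der d Y (lie_der d X f) x"
proof -
  have second: "lie_der d U (lie_der d W f) x =
      (\<Sum>k\<in>{1..d}. lie_der d U (\<lambda>y. W y k) x * partial k f x) +
      (\<Sum>k\<in>{1..d}. \<Sum>l\<in>{1..d}. W x k * U x l * partial l (partial k f) x)"
    if W: "smooth_vf d W" for U W
  proof -
    have "lie_der d U (lie_der d W f) x = (\<Sum>k\<in>{1..d}. lie_der d U (\<lambda>y. W y k * partial k f y) x)"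
      unfolding lie_der_def[of d W, abs_def]
      by (rule lie_der_sum[OF _ x])
        (use W f in \<open>auto intro!: smooth_fun_mult smooth_fun_partial simp: smooth_vf_def\<close>)
    also have "\<dots> = (\<Sum>k\<in>{1..d}. lie_der d U (\<lambda>y. W y k) x * partial k f x
        + W x k * lie_der d U (partial k f) x)"
      by (intro sum.cong refl lie_der_mult smooth_fun_partial f x) (use W in \<open>auto simp: smooth_vf_def\<close>)
    finally show ?thesis
      by (simp add: sum.distrib lie_der_def sum_distrib_left mult_ac)
  qed
  have "(\<Sum>k\<in>{1..d}. \<Sum>l\<in>{1..d}. Y x k * X x l * partial l (partial k f) x) =
      (\<Sum>l\<in>{1..d}. \<Sum>k\<in>{1..d}. Y x k * X x l * partial l (partial k f) x)"
    by (rule sum.swap)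
  also have "\<dots> = (\<Sum>k\<in>{1..d}. \<Sum>l\<in>{1..d}. X x k * Y x l * partial l (partial k f) x)"
    using partial_commute[OF f x] by (intro sum.cong refl) (simp add: mult_ac)
  finally show ?thesis
    unfolding second[OF X] second[OF Y]
    by (simp add: lie_der_def[of d "vf_bracket d X Y"] vf_bracket_eq_lie_der left_diff_distrib sum_subtractf)
qed

text \<open>Brackets of \<phi>-related fields are \<phi>-related, since both are commutators of
  derivations and each derivation passes through \<phi>. With \<phi> a left translation this gives
  left invariance of brackets; with \<phi> = \<pi> it makes the differential a Lie algebra
  homomorphism.\<close>

lemma vf_bracket_related:
  assumes maps: "\<And>x. x \<in> pts d \<Longrightarrow> \<phi> x \<in> pts e"
    and \<phi>: "\<And>j. j \<in> {1..e} \<Longrightarrow> smooth_fun d (\<lambda>x. \<phi> x j)"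
    and X: "smooth_vf d X" and Y: "smooth_vf d Y" and X': "smooth_vf e X'" and Y': "smooth_vf e Y'"
    and relX: "\<And>x j. x \<in> pts d \<Longrightarrow> j \<in> {1..e} \<Longrightarrow> lie_der d X (\<lambda>y. \<phi> y j) x = X' (\<phi> x) j"
    and relY: "\<And>x j. x \<in> pts d \<Longrightarrow> j \<in> {1..e} \<Longrightarrow> lie_der d Y (\<lambda>y. \<phi> y j) x = Y' (\<phi> x) j"
    and x: "x \<in> pts d" and j: "j \<in> {1..e}"
  shows "lie_der d (vf_bracket d X Y) (\<lambda>y. \<phi> y j) x = vf_bracket e X' Y' (\<phi> x) j"
proof -
  have "lie_der d U (lie_der d W (\<lambda>y. \<phi> y j)) x = lie_der e U' (\<lambda>y. W' y j) (\<phi> x)"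
    if "smooth_vf e W'"
      "\<And>x j. x \<in> pts d \<Longrightarrow> j \<in> {1..e} \<Longrightarrow> lie_der d U (\<lambda>y. \<phi> y j) x = U' (\<phi> x) j"
      "\<And>x j. x \<in> pts d \<Longrightarrow> j \<in> {1..e} \<Longrightarrow> lie_der d W (\<lambda>y. \<phi> y j) x = W' (\<phi> x) j" for U W U' W'
  proof -
    have "lie_der d U (lie_der d W (\<lambda>y. \<phi> y j)) x = lie_der d U (\<lambda>y. W' (\<phi> y) j) x"
      by (rule lie_der_cong) (use that(3) j x in auto)
    also have "\<dots> = lie_der e U' (\<lambda>y. W' y j) (\<phi> x)"
      by (rule lie_der_chain[OF _ maps \<phi> x])
        (use that j x in \<open>auto simp: smooth_vf_def\<close>)
    finally show ?thesis .
  qed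
  then show ?thesis
    unfolding lie_der_vf_bracket[OF X Y \<phi>[OF j] x] vf_bracket_eq_lie_der
    using X' Y' relX relY by simp
qed

text \<open>Everything reduces to iterated derivatives of the i-th components of the three fields,
  which cancel in pairs.\<close>

lemma vf_bracket_jacobi:
  assumes X: "smooth_vf d X" and Y: "smooth_vf d Y" and Z: "smooth_vf d Z"
    and x: "x \<in> pts d" and i: "i \<in> {1..d}"
  shows "vf_bracket d X (vf_bracket d Y Z) x i =
    vf_bracket d (vf_bracket d X Y) Z x i + vf_bracket d Y (vf_bracket d X Z) x i"
proof -
  have c: "smooth_fun d (\<lambda>y. X y i)" "smooth_fun d (\<lambda>y. Y y i)" "smooth_fun d (\<lambda>y. Z y i)"
    using X Y Z i by (auto simp: smooth_vf_def)
  have D: "lie_der d U (\<lambda>y. lie_der d V f y - lie_der d W g y) x =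
      lie_der d U (lie_der d V f) x - lie_der d U (lie_der d W g) x"
    if "smooth_vf d V" "smooth_vf d W" "smooth_fun d f" "smooth_fun d g" for U V W f g
    using lie_der_diff[OF smooth_fun_lie_der smooth_fun_lie_der x] that by simp
  show ?thesis
    unfolding vf_bracket_eq_lie_der[of d X "vf_bracket d Y Z"]
      vf_bracket_eq_lie_der[of d "vf_bracket d X Y" Z] vf_bracket_eq_lie_der[of d Y "vf_bracket d X Z"]
      lie_der_vf_bracket[OF Y Z c(1) x] lie_der_vf_bracket[OF X Y c(3) x]
      lie_der_vf_bracket[OF X Z c(2) x]
    using X Y Z c by (simp add: D vf_bracket_eq_lie_der)
qed

lemma partial_coord: "partial i (\<lambda>x. x k) x = (if i = k then 1 else 0)"
  by (rule partialI) (cases "i = k"; auto)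

lemma partial_zero_on_pts:
  assumes "\<And>y. y \<in> pts d \<Longrightarrow> f y = 0" "x \<in> pts d" "i \<in> {1..d}"
  shows "partial i f x = 0"
  using partial_cong[of d f "\<lambda>y. 0", OF assms] by simp

lemma lie_der_zero_on_pts:
  assumes "\<And>y. y \<in> pts d \<Longrightarrow> f y = 0" "x \<in> pts d"
  shows "lie_der d X f x = 0"
  unfolding lie_der_def using partial_zero_on_pts[OF assms] by simp

lemma pts_outside: "x \<in> pts d \<Longrightarrow> k \<notin> {1..d} \<Longrightarrow> x k = 0"
  unfolding pts_def by blast

lemma lie_der_coord: "X x \<in> pts d \<Longrightarrow> lie_der d X (\<lambda>y. y j) x = X x j"
  unfolding lie_der_def partial_coord
  by (cases "j \<in> {1..d}") (auto simp: if_distrib[of "\<lambda>z. _ * z"] pts_outside cong: if_cong)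

lemma lincomb_pts:
  "u \<in> pts d \<Longrightarrow> v \<in> pts d \<Longrightarrow> (\<lambda>i. a * u i + b * v i) \<in> pts d"
  by (simp add: pts_def)

lemma add_pts: "u \<in> pts d \<Longrightarrow> v \<in> pts d \<Longrightarrow> (\<lambda>i. u i + v i) \<in> pts d"
  by (simp add: pts_def)

subsection \<open>Lie groups in global coordinates\<close>

text \<open>Smoothness of the group law is given on \<open>pts (2 * d)\<close>; this is the inverse
  of splitting such a point by \<open>fst_part\<close> and \<open>snd_part\<close>.\<close>

definition join :: "nat \<Rightarrow> pt \<Rightarrow> pt \<Rightarrow> pt" where
  "join d x y = (\<lambda>k. if k \<in> {1..d} then x k else if k \<in> {d + 1..2 * d} then y (k - d) else 0)"

lemma join_pts: "join d x y \<in> pts (2 * d)"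
  by (auto simp: join_def pts_def)

lemma parts_join:
  assumes "x \<in> pts d" "y \<in> pts d"
  shows "fst_part d (join d x y) = x" "snd_part d (join d x y) = y"
  using assms by (auto simp: fst_part_def snd_part_def join_def pts_def fun_eq_iff)

lemma partial_join_left:
  assumes "k \<in> {1..d}"
  shows "partial k (\<lambda>x. f (join d x y)) x = partial k f (join d x y)"
proof -
  have "join d (x(k := t)) y = (join d x y)(k := t)" "join d x y k = x k" for t
    using assms by (auto simp: join_def fun_eq_iff)
  then show ?thesis by (simp add: partial_def)
qed

lemma partial_join_right:
  assumes "k \<in> {1..d}"
  shows "partial k (\<lambda>y. f (join d x y)) y = partial (d + k) f (join d x y)"
proof -
  have "join d x (y(k := t)) = (join d x y)(d + k := t)" "join d x y (d + k) = y k" for t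
    using assms by (auto simp: join_def fun_eq_iff)
  then show ?thesis by (simp add: partial_def)
qed

lemma smooth_fun_join:
  assumes f: "smooth_fun (2 * d) f"
    and "\<And>j. j \<in> {1..d} \<Longrightarrow> smooth_fun e (\<lambda>x. \<phi> x j)" "\<And>j. j \<in> {1..d} \<Longrightarrow> smooth_fun e (\<lambda>x. \<psi> x j)"
  shows "smooth_fun e (\<lambda>x. f (join d (\<phi> x) (\<psi> x)))"
proof (rule smooth_fun_comp[OF f join_pts])
  fix k assume "k \<in> {1..2 * d}"
  then consider "k \<in> {1..d}" | "k \<notin> {1..d}" "k \<in> {d + 1..2 * d}" "k - d \<in> {1..d}" by force
  then show "smooth_fun e (\<lambda>x. join d (\<phi> x) (\<psi> x) k)"
    by cases (use assms in \<open>simp_all add: join_def\<close>)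
qed

locale smooth_group =
  fixes d :: nat and mul :: "pt \<Rightarrow> pt \<Rightarrow> pt"
  assumes lie_group: "lie_group d mul"
begin

abbreviation linv :: "pt \<Rightarrow> vf" where "linv \<equiv> linv_ext d mul"
abbreviation br :: "pt \<Rightarrow> pt \<Rightarrow> pt" where "br \<equiv> lie_br d mul"

text \<open>The right-invariant field with value w at the identity, an auxiliary device for
  differentiating Ad: it commutes with every \<open>linv u\<close>.\<close>

definition rinv :: "pt \<Rightarrow> vf" where "rinv w = (\<lambda>p. dmap d (\<lambda>x. mul x p) origin w)"

definition gi :: "pt \<Rightarrow> pt" where
  "gi = (SOME inv. smooth_map d d inv \<and> (\<forall>x\<in>pts d. mul x (inv x) = origin \<and> mul (inv x) x = origin))"

text \<open>This is Ad p u, computed by transporting the vector linv u p at p back to the identity with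
  a right translation.\<close>

definition ad :: "pt \<Rightarrow> pt \<Rightarrow> pt" where
  "ad u p = (\<lambda>j. lie_der d (linv u) (\<lambda>y. mul y (gi p) j) p)"

lemma mul_pts [simp]: "x \<in> pts d \<Longrightarrow> y \<in> pts d \<Longrightarrow> mul x y \<in> pts d"
  and mul_assoc: "x \<in> pts d \<Longrightarrow> y \<in> pts d \<Longrightarrow> z \<in> pts d \<Longrightarrow> mul (mul x y) z = mul x (mul y z)"
  and mul_origin [simp]: "x \<in> pts d \<Longrightarrow> mul origin x = x" "x \<in> pts d \<Longrightarrow> mul x origin = x"
  using lie_group unfolding lie_group_def by blast+

lemma gi_props: "smooth_map d d gi \<and> (\<forall>x\<in>pts d. mul x (gi x) = origin \<and> mul (gi x) x = origin)"
proof -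
  have "\<exists>inv. smooth_map d d inv \<and> (\<forall>x\<in>pts d. mul x (inv x) = origin \<and> mul (inv x) x = origin)"
    using lie_group unfolding lie_group_def by blast
  then show ?thesis unfolding gi_def by (rule someI_ex)
qed

lemma gi_pts [simp]: "x \<in> pts d \<Longrightarrow> gi x \<in> pts d"
  and smooth_gi: "j \<in> {1..d} \<Longrightarrow> smooth_fun d (\<lambda>x. gi x j)"
  and mul_gi [simp]: "x \<in> pts d \<Longrightarrow> mul x (gi x) = origin" "x \<in> pts d \<Longrightarrow> mul (gi x) x = origin"
  using gi_props unfolding smooth_map_def by blast+

text \<open>One coordinate of the product as a function of a single point of
  \<open>pts (2 * d)\<close>. Derivatives in the left and in the right factor become partial
  derivatives of the same smooth function and can be interchanged.\<close>

definition mulj :: "nat \<Rightarrow> pt \<Rightarrow> real" where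
  "mulj j z = mul (fst_part d z) (snd_part d z) j"

lemma smooth_mulj: "j \<in> {1..d} \<Longrightarrow> smooth_fun (2 * d) (mulj j)"
  using lie_group unfolding lie_group_def smooth_map_def mulj_def[abs_def] by blast

lemma mulj_join: "x \<in> pts d \<Longrightarrow> y \<in> pts d \<Longrightarrow> mulj j (join d x y) = mul x y j"
  by (simp add: mulj_def parts_join)

lemma partial_mul_right:
  assumes "x \<in> pts d" "y \<in> pts d" "k \<in> {1..d}"
  shows "partial k (\<lambda>y. mul x y j) y = partial (d + k) (mulj j) (join d x y)"
  unfolding partial_join_right[OF assms(3), symmetric]
  by (rule partial_cong) (use assms mulj_join in auto)

lemma partial_mul_left:
  assumes "x \<in> pts d" "y \<in> pts d" "k \<in> {1..d}"
  shows "partial k (\<lambda>x. mul x y j) x = partial k (mulj j) (join d x y)"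
  unfolding partial_join_left[OF assms(3), symmetric]
  by (rule partial_cong) (use assms mulj_join in auto)

lemma smooth_mul:
  assumes "j \<in> {1..d}" "\<And>x. x \<in> pts e \<Longrightarrow> \<phi> x \<in> pts d" "\<And>x. x \<in> pts e \<Longrightarrow> \<psi> x \<in> pts d"
    and "\<And>j. j \<in> {1..d} \<Longrightarrow> smooth_fun e (\<lambda>x. \<phi> x j)" "\<And>j. j \<in> {1..d} \<Longrightarrow> smooth_fun e (\<lambda>x. \<psi> x j)"
  shows "smooth_fun e (\<lambda>x. mul (\<phi> x) (\<psi> x) j)"
proof (rule smooth_fun_cong)
  show "smooth_fun e (\<lambda>x. mulj j (join d (\<phi> x) (\<psi> x)))"
    using assms by (intro smooth_fun_join smooth_mulj) auto
qed (simp add: mulj_join assms)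

lemma smooth_partial_mul_right:
  assumes "j \<in> {1..d}" "k \<in> {1..d}"
    and "\<And>x. x \<in> pts e \<Longrightarrow> \<phi> x \<in> pts d" "\<And>x. x \<in> pts e \<Longrightarrow> \<psi> x \<in> pts d"
    and "\<And>j. j \<in> {1..d} \<Longrightarrow> smooth_fun e (\<lambda>x. \<phi> x j)" "\<And>j. j \<in> {1..d} \<Longrightarrow> smooth_fun e (\<lambda>x. \<psi> x j)"
  shows "smooth_fun e (\<lambda>x. partial k (\<lambda>y. mul (\<phi> x) y j) (\<psi> x))"
proof (rule smooth_fun_cong)
  show "smooth_fun e (\<lambda>x. partial (d + k) (mulj j) (join d (\<phi> x) (\<psi> x)))"
    using assms by (intro smooth_fun_join smooth_fun_partial smooth_mulj) auto
qed (use assms partial_mul_right in auto)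

lemma smooth_partial_mul_left:
  assumes "j \<in> {1..d}" "k \<in> {1..d}"
    and "\<And>x. x \<in> pts e \<Longrightarrow> \<phi> x \<in> pts d" "\<And>x. x \<in> pts e \<Longrightarrow> \<psi> x \<in> pts d"
    and "\<And>j. j \<in> {1..d} \<Longrightarrow> smooth_fun e (\<lambda>x. \<phi> x j)" "\<And>j. j \<in> {1..d} \<Longrightarrow> smooth_fun e (\<lambda>x. \<psi> x j)"
  shows "smooth_fun e (\<lambda>x. partial k (\<lambda>z. mul z (\<psi> x) j) (\<phi> x))"
proof (rule smooth_fun_cong)
  show "smooth_fun e (\<lambda>x. partial k (mulj j) (join d (\<phi> x) (\<psi> x)))"
    using assms by (intro smooth_fun_join smooth_fun_partial smooth_mulj) auto
qed (use assms partial_mul_left in auto)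

lemma smooth_translations:
  assumes "p \<in> pts d" "j \<in> {1..d}"
  shows "smooth_fun d (\<lambda>y. mul p y j)" "smooth_fun d (\<lambda>y. mul y p j)"
  using assms by (auto intro!: smooth_mul smooth_fun_const smooth_fun_coord)

lemma linv_eq: "linv u p j = (\<Sum>k\<in>{1..d}. u k * partial k (\<lambda>y. mul p y j) origin)"
  by (simp add: linv_ext_def dmap_def)

lemma rinv_eq: "rinv w p j = (\<Sum>k\<in>{1..d}. w k * partial k (\<lambda>x. mul x p j) origin)"
  by (simp add: rinv_def dmap_def)

lemma smooth_linv: "smooth_vf d (linv u)"
  unfolding smooth_vf_def linv_eq
  by (auto intro!: smooth_fun_sum smooth_fun_mult smooth_fun_const smooth_partial_mul_right smooth_fun_coord)

lemma smooth_linv_comp: "j \<in> {1..d} \<Longrightarrow> smooth_fun d (\<lambda>p. linv u p j)"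
  using smooth_linv by (simp add: smooth_vf_def)

lemma linv_pts [simp]:
  assumes "p \<in> pts d"
  shows "linv u p \<in> pts d"
proof -
  have "linv u p j = 0" if j: "j \<notin> {1..d}" for j
  proof -
    have "partial k (\<lambda>y. mul p y j) origin = 0" if "k \<in> {1..d}" for k
      by (rule partial_zero_on_pts[OF _ origin_pts that]) (use assms j pts_outside[OF mul_pts] in blast)
    then show ?thesis by (simp add: linv_eq)
  qed
  then show ?thesis by (simp add: pts_def)
qed

lemma rinv_pts [simp]:
  assumes "p \<in> pts d"
  shows "rinv u p \<in> pts d"
proof -
  have "rinv u p j = 0" if j: "j \<notin> {1..d}" for j
  proof -
    have "partial k (\<lambda>x. mul x p j) origin = 0" if "k \<in> {1..d}" for k
      by (rule partial_zero_on_pts[OF _ origin_pts that]) (use assms j pts_outside[OF mul_pts] in blast)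
    then show ?thesis by (simp add: rinv_eq)
  qed
  then show ?thesis by (simp add: pts_def)
qed

lemma sum_partial_coord:
  "u \<in> pts d \<Longrightarrow> (\<Sum>k\<in>{1..d}. u k * partial k (\<lambda>y. y j) x) = u j"
  using lie_der_coord[of "\<lambda>x. u" x d j] by (simp add: lie_der_def)

lemma linv_origin [simp]:
  assumes "u \<in> pts d"
  shows "linv u origin = u"
proof
  fix j
  have "linv u origin j = (\<Sum>k\<in>{1..d}. u k * partial k (\<lambda>y. y j) origin)"
    unfolding linv_eq
    by (intro sum.cong refl arg_cong2[of _ _ _ _ "(*)"] partial_cong[of d]) auto
  then show "linv u origin j = u j"
    using sum_partial_coord[OF assms] by (rule trans)
qed

lemma rinv_origin [simp]:
  assumes "u \<in> pts d"
  shows "rinv u origin = u"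
proof
  fix j
  have "rinv u origin j = (\<Sum>k\<in>{1..d}. u k * partial k (\<lambda>y. y j) origin)"
    unfolding rinv_eq
    by (intro sum.cong refl arg_cong2[of _ _ _ _ "(*)"] partial_cong[of d]) auto
  then show "rinv u origin j = u j"
    using sum_partial_coord[OF assms] by (rule trans)
qed

text \<open>The factorisation of \<omega> is required on \<open>pts d\<close> only, because
  associativity and inverses, from which it is obtained, hold there.\<close>

lemma partial_translation_compose:
  assumes "\<And>j. j \<in> {1..d} \<Longrightarrow> smooth_fun d (\<lambda>y. \<phi> y j)" "\<And>y. y \<in> pts d \<Longrightarrow> \<phi> y \<in> pts d"
    and "\<And>j. j \<in> {1..d} \<Longrightarrow> smooth_fun d (\<lambda>y. \<psi> y j)"
    and "\<And>y. y \<in> pts d \<Longrightarrow> \<omega> y = \<psi> (\<phi> y)" "x \<in> pts d" "k \<in> {1..d}" "j \<in> {1..d}"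
  shows "partial k (\<lambda>y. \<omega> y j) x =
    (\<Sum>i\<in>{1..d}. partial i (\<lambda>y. \<psi> y j) (\<phi> x) * partial k (\<lambda>y. \<phi> y i) x)"
proof -
  have "partial k (\<lambda>y. \<omega> y j) x = partial k (\<lambda>y. \<psi> (\<phi> y) j) x"
    by (rule partial_cong) (use assms in auto)
  also have "\<dots> = (\<Sum>i\<in>{1..d}. partial i (\<lambda>y. \<psi> y j) (\<phi> x) * partial k (\<lambda>y. \<phi> y i) x)"
    by (rule partial_compose) (use assms in auto)
  finally show ?thesis .
qed

text \<open>Left invariance, obtained by differentiating
  \<open>mul (mul p x) y = mul p (mul x y)\<close> in y at the identity.\<close>

lemma linv_translate:
  assumes p: "p \<in> pts d" and x: "x \<in> pts d" and j: "j \<in> {1..d}"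
  shows "lie_der d (linv u) (\<lambda>y. mul p y j) x = linv u (mul p x) j"
proof -
  have "linv u (mul p x) j = (\<Sum>k\<in>{1..d}. \<Sum>i\<in>{1..d}. u k *
      (partial i (\<lambda>y. mul p y j) x * partial k (\<lambda>y. mul x y i) origin))"
    unfolding linv_eq sum_distrib_left[symmetric]
  proof (intro sum.cong refl arg_cong2[of _ _ _ _ "(*)"])
    fix k assume k: "k \<in> {1..d}"
    show "partial k (\<lambda>y. mul (mul p x) y j) origin =
        (\<Sum>i\<in>{1..d}. partial i (\<lambda>y. mul p y j) x * partial k (\<lambda>y. mul x y i) origin)"
      using partial_translation_compose[of "\<lambda>y. mul x y" "\<lambda>y. mul p y" "\<lambda>y. mul (mul p x) y" origin k j]
        p x j k by (simp add: smooth_translations mul_assoc)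
  qed
  also have "\<dots> = (\<Sum>i\<in>{1..d}. linv u x i * partial i (\<lambda>y. mul p y j) x)"
    unfolding linv_eq sum_distrib_right by (subst sum.swap) (simp add: mult_ac)
  finally show ?thesis by (simp add: lie_der_def)
qed

text \<open>Translation by p relates each left-invariant field to itself, hence also their bracket;
  evaluated at the identity, this says that the bracket is the left-invariant extension of its value
  there.\<close>

lemma vf_bracket_linv:
  assumes p: "p \<in> pts d"
  shows "vf_bracket d (linv u) (linv w) p = linv (br u w) p"
proof
  fix j
  show "vf_bracket d (linv u) (linv w) p j = linv (br u w) p j"
  proof (cases "j \<in> {1..d}")
    case True
    have "lie_der d (vf_bracket d (linv u) (linv w)) (\<lambda>y. mul p y j) origin
        = vf_bracket d (linv u) (linv w) (mul p origin) j"
      by (rule vf_bracket_related[where e = d and \<phi> = "mul p"])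
        (use p True linv_translate smooth_linv smooth_translations in auto)
    moreover have "linv (br u w) p j
        = lie_der d (vf_bracket d (linv u) (linv w)) (\<lambda>y. mul p y j) origin"
      unfolding linv_eq[of "br u w"] lie_der_def by (simp only: lie_br_def)
    ultimately show ?thesis
      using p by simp
  next
    case False
    have z: "linv v y j = 0" if "y \<in> pts d" for v y
      using pts_outside[OF linv_pts[OF that] False] .
    then show ?thesis
      unfolding vf_bracket_eq_lie_der using p by (simp add: lie_der_zero_on_pts)
  qed
qed

lemma br_pts [simp]: "br u w \<in> pts d"
proof -
  have "br u w j = 0" if "j \<notin> {1..d}" for j
  proof -
    have z: "linv v y j = 0" if "y \<in> pts d" for v y
      using pts_outside[OF linv_pts[OF that] \<open>j \<notin> {1..d}\<close>] .
    then show ?thesis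
      unfolding lie_br_def vf_bracket_eq_lie_der by (simp add: lie_der_zero_on_pts)
  qed
  then show ?thesis by (simp add: pts_def)
qed

lemma linv_scale: "linv (\<lambda>i. c * u i) p j = c * linv u p j"
  by (simp add: linv_eq sum_distrib_left mult.assoc)

text \<open>In coordinates the bracket is an antisymmetrised bilinear form whose coefficients are
  mixed second derivatives of the product at the identity; linearity in each argument is read off
  from this.\<close>

lemma br_eq:
  assumes u: "u \<in> pts d" and w: "w \<in> pts d" and i: "i \<in> {1..d}"
  shows "br u w i = (\<Sum>k\<in>{1..d}. \<Sum>l\<in>{1..d}. (u k * w l - w k * u l) *
    partial k (\<lambda>p. partial l (\<lambda>y. mul p y i) origin) origin)"
proof -
  have "partial k (\<lambda>p. linv v p i) origin =
      (\<Sum>l\<in>{1..d}. v l * partial k (\<lambda>p. partial l (\<lambda>y. mul p y i) origin) origin)"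
    if k: "k \<in> {1..d}" for v k
  proof -
    have sm: "smooth_fun d (\<lambda>p. partial l (\<lambda>y. mul p y i) origin)" if "l \<in> {1..d}" for l
      using i that by (auto intro!: smooth_partial_mul_right smooth_fun_const smooth_fun_coord)
    have "partial k (\<lambda>p. linv v p i) origin =
        (\<Sum>l\<in>{1..d}. partial k (\<lambda>p. v l * partial l (\<lambda>y. mul p y i) origin) origin)"
      unfolding linv_eq
      by (rule partial_sum[OF _ origin_pts k]) (intro smooth_fun_mult smooth_fun_const sm)
    also have "\<dots> = (\<Sum>l\<in>{1..d}. v l * partial k (\<lambda>p. partial l (\<lambda>y. mul p y i) origin) origin)"
      by (intro sum.cong refl) (use partial_mult[OF smooth_fun_const sm origin_pts k] in simp)
    finally show ?thesis .
  qed
  then show ?thesis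
    unfolding lie_br_def vf_bracket_def using u w
    by (simp add: sum_distrib_left left_diff_distrib sum_subtractf mult_ac)
qed

lemma br_add_left:
  assumes "u \<in> pts d" "v \<in> pts d" "w \<in> pts d"
  shows "br (\<lambda>i. a * u i + b * v i) w = (\<lambda>i. a * br u w i + b * br v w i)"
proof (rule pts_eqI[OF br_pts lincomb_pts[OF br_pts br_pts]])
  fix i assume i: "i \<in> {1..d}"
  show "br (\<lambda>i. a * u i + b * v i) w i = a * br u w i + b * br v w i"
    using lincomb_pts[OF assms(1,2)] assms by (simp only: br_eq[OF _ _ i])
      (simp add: sum_distrib_left sum.distrib[symmetric] algebra_simps)
qed

lemma br_antisym:
  assumes "u \<in> pts d" "w \<in> pts d"
  shows "br u w = (\<lambda>i. - br w u i)"
  unfolding lie_br_def vf_bracket_eq_lie_der by simp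

lemma br_add_right:
  assumes "u \<in> pts d" "v \<in> pts d" "w \<in> pts d"
  shows "br w (\<lambda>i. a * u i + b * v i) = (\<lambda>i. a * br w u i + b * br w v i)"
proof -
  have "br w (\<lambda>i. a * u i + b * v i) = (\<lambda>i. - br (\<lambda>i. a * u i + b * v i) w i)"
    using br_antisym[OF assms(3) lincomb_pts[OF assms(1,2)]] .
  then show ?thesis
    using assms br_add_left[OF assms] br_antisym[of w] by (simp add: fun_eq_iff)
qed

text \<open>Inner brackets of vectors may be replaced by brackets of fields, because
  \<open>vf_bracket\<close> at the identity only looks at values on \<open>pts d\<close>, where the
  two left-invariant fields agree.\<close>

lemma br_jacobi:
  assumes "u \<in> pts d" "v \<in> pts d" "w \<in> pts d"
  shows "br u (br v w) = (\<lambda>i. br (br u v) w i + br v (br u w) i)"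
proof (rule pts_eqI[OF br_pts add_pts[OF br_pts br_pts]])
  fix i assume i: "i \<in> {1..d}"
  have 1: "br a (br b c) = vf_bracket d (linv a) (vf_bracket d (linv b) (linv c)) origin" for a b c
    unfolding lie_br_def[of d mul a] by (rule vf_bracket_cong) (use vf_bracket_linv in auto)
  have 2: "br (br a b) c = vf_bracket d (vf_bracket d (linv a) (linv b)) (linv c) origin" for a b c
    unfolding lie_br_def[of d mul _ c] by (rule vf_bracket_cong) (use vf_bracket_linv in auto)
  show "br u (br v w) i = br (br u v) w i + br v (br u w) i"
    unfolding 1 2 by (rule vf_bracket_jacobi[OF smooth_linv smooth_linv smooth_linv origin_pts i])
qed

text \<open>The fields commute because left and right translations do. Left invariance of
  \<open>linv u\<close>, differentiated in the translating point, rewrites the left side, and an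
  exchange of mixed derivatives of the product turns it into the right side.\<close>

lemma linv_rinv_commute:
  assumes x: "x \<in> pts d" and j: "j \<in> {1..d}"
  shows "lie_der d (rinv w) (\<lambda>x. linv u x j) x = lie_der d (linv u) (\<lambda>x. rinv w x j) x"
proof -
  \<comment> \<open>Both sides are second derivatives of the product at the pair (origin, x), once
    in direction l of the left factor and once in direction k of the right factor.\<close>
  have cross: "partial l (\<lambda>p. partial k (\<lambda>y. mul p y j) x) origin =
      partial k (\<lambda>y. partial l (\<lambda>p. mul p y j) origin) x"
    if k: "k \<in> {1..d}" and l: "l \<in> {1..d}" for k l
  proof -
    have "partial l (\<lambda>p. partial k (\<lambda>y. mul p y j) x) origin
        = partial l (\<lambda>p. partial (d + k) (mulj j) (join d p x)) origin"
      by (rule partial_cong[OF _ origin_pts l]) (rule partial_mul_right[OF _ x k])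
    also have "\<dots> = partial l (partial (d + k) (mulj j)) (join d origin x)"
      by (rule partial_join_left[OF l])
    also have "\<dots> = partial (d + k) (partial l (mulj j)) (join d origin x)"
      by (rule partial_commute[OF smooth_mulj[OF j] join_pts]) (use k l in auto)
    also have "\<dots> = partial k (\<lambda>y. partial l (mulj j) (join d origin y)) x"
      by (rule partial_join_right[OF k, symmetric])
    also have "\<dots> = partial k (\<lambda>y. partial l (\<lambda>p. mul p y j) origin) x"
      by (rule partial_cong[OF _ x k]) (rule partial_mul_left[OF origin_pts _ l, symmetric])
    finally show ?thesis .
  qed
  have smr: "smooth_fun d (\<lambda>p. partial k (\<lambda>y. mul p y j) x)" if "k \<in> {1..d}" for k
    using x j that by (auto intro!: smooth_partial_mul_right smooth_fun_const smooth_fun_coord)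
  have sml: "smooth_fun d (\<lambda>y. partial l (\<lambda>p. mul p y j) origin)" if "l \<in> {1..d}" for l
    using x j that by (auto intro!: smooth_partial_mul_left smooth_fun_const smooth_fun_coord)
  \<comment> \<open>This is \<open>linv_translate\<close> differentiated in p at the
    identity.\<close>
  have diff_p: "(\<Sum>k\<in>{1..d}. linv u x k * partial l (\<lambda>p. partial k (\<lambda>y. mul p y j) x) origin) =
      (\<Sum>i\<in>{1..d}. partial i (\<lambda>x. linv u x j) x * partial l (\<lambda>p. mul p x i) origin)"
    if l: "l \<in> {1..d}" for l
  proof -
    have "partial l (\<lambda>p. lie_der d (linv u) (\<lambda>y. mul p y j) x) origin
        = partial l (\<lambda>p. linv u (mul p x) j) origin"
      by (rule partial_cong[OF _ origin_pts l]) (rule linv_translate[OF _ x j])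
    also have "\<dots> = (\<Sum>i\<in>{1..d}. partial i (\<lambda>x. linv u x j) x * partial l (\<lambda>p. mul p x i) origin)"
      using partial_compose[of d "\<lambda>x. linv u x j" d "\<lambda>p. mul p x" origin l] x l j
        smooth_linv_comp smooth_translations by simp
    also have "partial l (\<lambda>p. lie_der d (linv u) (\<lambda>y. mul p y j) x) origin
        = (\<Sum>k\<in>{1..d}. partial l (\<lambda>p. linv u x k * partial k (\<lambda>y. mul p y j) x) origin)"
      unfolding lie_der_def
      by (rule partial_sum[OF _ origin_pts l]) (intro smooth_fun_mult smooth_fun_const smr)
    also have "\<dots> = (\<Sum>k\<in>{1..d}. linv u x k * partial l (\<lambda>p. partial k (\<lambda>y. mul p y j) x) origin)"
      by (intro sum.cong refl) (use partial_mult[OF smooth_fun_const smr origin_pts l] in simp)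
    finally show ?thesis .
  qed
  have "lie_der d (rinv w) (\<lambda>x. linv u x j) x = (\<Sum>l\<in>{1..d}. w l *
      (\<Sum>i\<in>{1..d}. partial i (\<lambda>x. linv u x j) x * partial l (\<lambda>p. mul p x i) origin))"
    unfolding lie_der_def rinv_eq sum_distrib_left sum_distrib_right
    by (subst sum.swap) (simp add: mult_ac)
  also have "\<dots> = (\<Sum>l\<in>{1..d}. w l *
      (\<Sum>k\<in>{1..d}. linv u x k * partial k (\<lambda>y. partial l (\<lambda>p. mul p y j) origin) x))"
  proof (rule sum.cong[OF refl])
    fix l assume l: "l \<in> {1..d}"
    have "(\<Sum>i\<in>{1..d}. partial i (\<lambda>x. linv u x j) x * partial l (\<lambda>p. mul p x i) origin) =
        (\<Sum>k\<in>{1..d}. linv u x k * partial k (\<lambda>y. partial l (\<lambda>p. mul p y j) origin) x)"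
      unfolding diff_p[OF l, symmetric] using cross[OF _ l] by (intro sum.cong refl) simp
    then show "w l *
        (\<Sum>i\<in>{1..d}. partial i (\<lambda>x. linv u x j) x * partial l (\<lambda>p. mul p x i) origin) =
      w l * (\<Sum>k\<in>{1..d}. linv u x k * partial k (\<lambda>y. partial l (\<lambda>p. mul p y j) origin) x)"
      by simp
  qed
  also have "\<dots> = (\<Sum>k\<in>{1..d}. linv u x k *
      (\<Sum>l\<in>{1..d}. w l * partial k (\<lambda>y. partial l (\<lambda>p. mul p y j) origin) x))"
    unfolding sum_distrib_left by (subst sum.swap) (simp add: mult_ac)
  also have "\<dots> = lie_der d (linv u) (\<lambda>x. rinv w x j) x"
    unfolding lie_der_def
  proof (intro sum.cong refl arg_cong2[of _ _ _ _ "(*)"])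
    fix k assume k: "k \<in> {1..d}"
    have "partial k (\<lambda>x. rinv w x j) x =
        (\<Sum>l\<in>{1..d}. partial k (\<lambda>y. w l * partial l (\<lambda>p. mul p y j) origin) x)"
      unfolding rinv_eq
      by (rule partial_sum[OF _ x k]) (intro smooth_fun_mult smooth_fun_const sml)
    also have "\<dots> = (\<Sum>l\<in>{1..d}. w l * partial k (\<lambda>y. partial l (\<lambda>p. mul p y j) origin) x)"
      by (intro sum.cong refl) (use partial_mult[OF smooth_fun_const sml x k] in simp)
    finally show "(\<Sum>l\<in>{1..d}. w l * partial k (\<lambda>y. partial l (\<lambda>p. mul p y j) origin) x) =
        partial k (\<lambda>x. rinv w x j) x" by simp
  qed
  finally show ?thesis .
qed

section \<open>The adjoint action and its derivative along left-invariant fields\<close>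

lemma ad_eq: "ad u p j = (\<Sum>i\<in>{1..d}. linv u p i * partial i (\<lambda>y. mul y (gi p) j) p)"
  by (simp add: ad_def lie_der_def)

lemma ad_pts [simp]: "p \<in> pts d \<Longrightarrow> ad u p \<in> pts d"
proof -
  assume p: "p \<in> pts d"
  have "ad u p j = 0" if "j \<notin> {1..d}" for j
    unfolding ad_def by (rule lie_der_zero_on_pts[OF pts_outside[OF mul_pts[OF _ gi_pts[OF p]] that] p])
  then show ?thesis unfolding pts_def by blast
qed

lemma smooth_ad: "j \<in> {1..d} \<Longrightarrow> smooth_fun d (\<lambda>p. ad u p j)"
  unfolding ad_eq
  by (auto intro!: smooth_fun_sum smooth_fun_mult smooth_linv_comp smooth_partial_mul_left
      smooth_fun_coord smooth_gi)

lemma ad_scale: "ad (\<lambda>i. c * u i) p j = c * ad u p j"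
  by (simp add: ad_eq linv_scale sum_distrib_left mult.assoc)

text \<open>Right translation by \<open>gi p\<close> followed by right translation by p is the
  identity, and its differential at p gives the relation.\<close>

lemma rinv_ad:
  assumes p: "p \<in> pts d"
  shows "rinv (ad u p) p = linv u p"
proof (rule pts_eqI[of _ d])
  fix j assume j: "j \<in> {1..d}"
  have id: "partial i (\<lambda>y. y j) p = (\<Sum>k\<in>{1..d}. partial k (\<lambda>x. mul x p j) origin *
      partial i (\<lambda>y. mul y (gi p) k) p)" if i: "i \<in> {1..d}" for i
    using partial_translation_compose[of "\<lambda>y. mul y (gi p)" "\<lambda>y. mul y p" "\<lambda>y. y" p i j] p i j
    by (simp add: smooth_translations mul_assoc)
  have "rinv (ad u p) p j = (\<Sum>i\<in>{1..d}. linv u p i * partial i (\<lambda>y. y j) p)"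
    unfolding rinv_eq ad_eq sum_distrib_right
    by (subst sum.swap) (simp add: id sum_distrib_left mult_ac)
  then show "rinv (ad u p) p j = linv u p j"
    using sum_partial_coord[OF linv_pts[OF p]] by (rule trans)
qed (use p in auto)

text \<open>The differential at p of right translation by \<open>gi p\<close> is a left inverse of
  the map sending w to \<open>rinv w p\<close>, by the same cancellation in the opposite
  order.\<close>

lemma rinv_inj:
  assumes p: "p \<in> pts d" and w: "w \<in> pts d" "w' \<in> pts d" and eq: "rinv w p = rinv w' p"
  shows "w = w'"
proof -
  have "(\<Sum>j\<in>{1..d}. rinv v p j * partial j (\<lambda>y. mul y (gi p) i) p) = v i"
    if v: "v \<in> pts d" and i: "i \<in> {1..d}" for v i
  proof -
    have id: "partial k (\<lambda>y. y i) origin = (\<Sum>j\<in>{1..d}. partial j (\<lambda>y. mul y (gi p) i) p *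
        partial k (\<lambda>x. mul x p j) origin)" if k: "k \<in> {1..d}" for k
      using partial_translation_compose[of "\<lambda>y. mul y p" "\<lambda>y. mul y (gi p)" "\<lambda>y. y" origin k i] p i k
      by (simp add: smooth_translations mul_assoc)
    have "(\<Sum>j\<in>{1..d}. rinv v p j * partial j (\<lambda>y. mul y (gi p) i) p)
        = (\<Sum>k\<in>{1..d}. v k * partial k (\<lambda>y. y i) origin)"
      unfolding rinv_eq sum_distrib_right
      by (subst sum.swap) (simp add: id sum_distrib_left mult_ac)
    then show ?thesis using sum_partial_coord[OF v] by (rule trans)
  qed
  from this[OF w(1)] this[OF w(2)] show ?thesis
    unfolding eq by (intro pts_eqI[OF w]) metis
qed

lemma ad_origin [simp]: "u \<in> pts d \<Longrightarrow> ad u origin = u"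
  using rinv_ad[OF origin_pts, of u] by simp

lemma lie_der_ad:
  assumes p: "p \<in> pts d" and j: "j \<in> {1..d}"
  shows "lie_der d (linv y) (\<lambda>p. ad u p j) p = ad (br y u) p j"
proof -
  define w where "w = (\<lambda>j. lie_der d (linv y) (\<lambda>p. ad u p j) p)"
  define W where "W = ad u p"
  have w: "w \<in> pts d"
    unfolding pts_def w_def using p pts_outside[OF ad_pts] by (auto intro!: lie_der_zero_on_pts)
  have "rinv w p j = rinv (ad (br y u) p) p j" if j: "j \<in> {1..d}" for j
  proof -
    define r where "r k p = partial k (\<lambda>x. mul x p j) origin" for k p
    have r: "smooth_fun d (r k)" if "k \<in> {1..d}" for k
      unfolding r_def[abs_def] using j that
      by (auto intro!: smooth_partial_mul_left smooth_fun_const smooth_fun_coord)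
    have rj: "rinv v q j = (\<Sum>k\<in>{1..d}. v k * r k q)" for v q
      by (simp add: rinv_eq r_def)
    have "lie_der d (linv y) (\<lambda>q. linv u q j) p = lie_der d (linv y) (\<lambda>q. \<Sum>k\<in>{1..d}. ad u q k * r k q) p"
      by (rule lie_der_cong[OF _ refl p]) (use rinv_ad rj in metis)
    also have "\<dots> = (\<Sum>k\<in>{1..d}. lie_der d (linv y) (\<lambda>q. ad u q k * r k q) p)"
      by (rule lie_der_sum[OF _ p]) (intro smooth_fun_mult smooth_ad r)
    also have "\<dots> = (\<Sum>k\<in>{1..d}. w k * r k p + W k * lie_der d (linv y) (r k) p)"
      unfolding w_def W_def by (intro sum.cong refl lie_der_mult smooth_ad r p)
    also have "\<dots> = rinv w p j + (\<Sum>k\<in>{1..d}. W k * lie_der d (linv y) (r k) p)"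
      by (simp add: sum.distrib rj)
    also have "(\<Sum>k\<in>{1..d}. W k * lie_der d (linv y) (r k) p) = lie_der d (linv y) (\<lambda>q. rinv W q j) p"
    proof -
      have "lie_der d (linv y) (\<lambda>q. rinv W q j) p = (\<Sum>k\<in>{1..d}. lie_der d (linv y) (\<lambda>q. W k * r k q) p)"
        unfolding rj by (rule lie_der_sum[OF _ p]) (intro smooth_fun_mult smooth_fun_const r)
      also have "\<dots> = (\<Sum>k\<in>{1..d}. W k * lie_der d (linv y) (r k) p)"
        by (intro sum.cong refl)
          (use lie_der_mult[OF smooth_fun_const r p] in \<open>simp add: lie_der_def[of _ _ "\<lambda>x. W _"]\<close>)
      finally show ?thesis by simp
    qed
    also have "\<dots> = lie_der d (rinv W) (\<lambda>q. linv y q j) p"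
      by (rule linv_rinv_commute[OF p j, symmetric])
    \<comment> \<open>\<open>lie_der\<close> sees the differentiating field only at p, where
      \<open>rinv W\<close> and \<open>linv u\<close> agree by the choice of W.\<close>
    also have "\<dots> = lie_der d (linv u) (\<lambda>q. linv y q j) p"
      by (rule lie_der_cong) (use rinv_ad[OF p] p in \<open>auto simp: W_def\<close>)
    finally have "rinv w p j = vf_bracket d (linv y) (linv u) p j"
      by (simp add: vf_bracket_eq_lie_der)
    then show ?thesis
      using p by (simp add: vf_bracket_linv rinv_ad)
  qed
  then have "rinv w p = rinv (ad (br y u) p) p"
    using p by (intro pts_eqI[of _ d]) auto
  then have "w = ad (br y u) p"
    using rinv_inj[OF p w] p by simp
  then show ?thesis by (simp add: w_def fun_eq_iff)
qed

end

subsection \<open>Hall bases and the Hall--Grayson--Grossman fields\<close>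

locale hall =
  fixes r s n :: nat and L :: "nat \<Rightarrow> nat \<times> nat"
  assumes hall: "hall_basis r s n L"
begin

abbreviation str :: "nat \<Rightarrow> nat list" where "str \<equiv> hstr r L"
abbreviation Y :: "nat \<Rightarrow> vf" where "Y \<equiv> hgg n r L"

section \<open>Strings and parents in a Hall basis\<close>

lemma rank_le: "1 \<le> r" "r \<le> n"
  using hall unfolding hall_basis_def by auto

lemma parents:
  assumes "l \<in> {r<..n}"
  shows "fst (L l) < l" "snd (L l) < fst (L l)" "1 \<le> snd (L l)"
    "r < fst (L l) \<Longrightarrow> snd (L (fst (L l))) \<le> snd (L l)"
    "fst (L l) \<in> {1..n}" "snd (L l) \<in> {1..n}"
proof -
  show 1: "fst (L l) < l" "snd (L l) < fst (L l)" "1 \<le> snd (L l)"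
    "r < fst (L l) \<Longrightarrow> snd (L (fst (L l))) \<le> snd (L l)"
    using hall assms unfolding hall_basis_def by blast+
  show "fst (L l) \<in> {1..n}" "snd (L l) \<in> {1..n}"
    using 1(1-3) assms by auto
qed

lemma parents_inj: "l \<in> {r<..n} \<Longrightarrow> l' \<in> {r<..n} \<Longrightarrow> L l = L l' \<Longrightarrow> l = l'"
  using hall unfolding hall_basis_def inj_on_def by blast

text \<open>The counter only bounds the recursion depth: parents have smaller indices, so starting
  at l a counter of at least l never runs out.\<close>

lemma hstr_f_fuel:
  assumes "l \<in> {1..n}" "l \<le> k"
  shows "hstr_f k r L l = str l"
  using assms
proof (induction l arbitrary: k rule: less_induct)
  case (less l)
  obtain k' l' where k: "k = Suc k'" "l = Suc l'"
    using less.prems by (metis Suc_le_D atLeastAtMost_iff One_nat_def)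
  show ?case
  proof (cases "l \<le> r")
    case False
    then have l: "l \<in> {r<..n}" using less.prems by auto
    have "hstr_f k' r L (fst (L l)) = str (fst (L l))" "hstr_f l' r L (fst (L l)) = str (fst (L l))"
      using less.IH[OF parents(1)[OF l] parents(5)[OF l]] parents(1)[OF l] less.prems k by auto
    then show ?thesis
      using False k by (simp add: hstr_def)
  qed (use k in \<open>simp add: hstr_def\<close>)
qed

lemma str_gen: "l \<le> r \<Longrightarrow> str l = [l]"
  by (cases l) (simp_all add: hstr_def)

lemma str_parents:
  assumes "l \<in> {r<..n}"
  shows "str l = str (fst (L l)) @ [snd (L l)]"
proof (cases l)
  case (Suc l')
  have "hstr_f l' r L (fst (L l)) = str (fst (L l))"
    using hstr_f_fuel parents[OF assms] Suc by auto
  then show ?thesis using assms Suc by (simp add: hstr_def)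
qed (use assms in simp)

lemma hgg_f_fuel:
  assumes "l \<in> {1..n}" "l \<le> k"
  shows "hgg_f k n r L l = Y l"
  using assms
proof (induction l arbitrary: k rule: less_induct)
  case (less l)
  obtain k' l' where k: "k = Suc k'" "l = Suc l'"
    using less.prems by (metis Suc_le_D atLeastAtMost_iff One_nat_def)
  show ?case
  proof (cases "l \<le> r")
    case False
    then have l: "l \<in> {r<..n}" using less.prems by auto
    note p = parents[OF l]
    have "hgg_f k' n r L (fst (L l)) = Y (fst (L l))" "hgg_f l' n r L (fst (L l)) = Y (fst (L l))"
      "hgg_f k' n r L (snd (L l)) = Y (snd (L l))" "hgg_f l' n r L (snd (L l)) = Y (snd (L l))"
      using less.IH[OF p(1) p(5)] less.IH[OF less_trans[OF p(2) p(1)] p(6)] p(1,2) less.prems k by auto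
    then show ?thesis
      using False k by (simp add: hgg_def)
  qed (use k in \<open>simp add: hgg_def\<close>)
qed

lemma hgg_gen: "l \<le> r \<Longrightarrow> Y l = Ygen n r L l"
  by (cases l) (simp_all add: hgg_def)

lemma hgg_parents:
  assumes "l \<in> {r<..n}"
  shows "Y l = vf_bracket n (Y (fst (L l))) (Y (snd (L l)))"
proof (cases l)
  case (Suc l')
  have "hgg_f l' n r L (fst (L l)) = Y (fst (L l))" "hgg_f l' n r L (snd (L l)) = Y (snd (L l))"
    using hgg_f_fuel parents[OF assms] Suc by auto
  then show ?thesis using assms Suc by (simp add: hgg_def)
qed (use assms in simp)

text \<open>Generators have no right parent; the value 0 makes the vanishing conditions attached to
  \<open>rchild l\<close> empty for them and lets \<open>rchild_parent\<close> hold without a case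
  distinction.\<close>

definition rchild :: "nat \<Rightarrow> nat" where "rchild l = (if l \<le> r then 0 else snd (L l))"

lemma rchild_less: "l \<in> {1..n} \<Longrightarrow> rchild l < l"
  using parents(1,2)[of l] by (cases "l \<le> r") (auto simp: rchild_def)

lemma rchild_parent: "l \<in> {r<..n} \<Longrightarrow> rchild (fst (L l)) \<le> snd (L l)"
  using parents(4)[of l] by (auto simp: rchild_def)

text \<open>The Hall condition makes right parents nondecreasing along successive brackets, so the
  letters after the first are sorted and bounded by the last one, which is the right parent of
  l.\<close>

lemma str_props:
  assumes "l \<in> {1..n}"
  shows "str l \<noteq> [] \<and> set (tl (str l)) \<subseteq> {1..n} \<and> sorted (tl (str l)) \<and>
    (\<forall>y\<in>set (tl (str l)). y \<le> rchild l)"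
  using assms
proof (induction l rule: less_induct)
  case (less l)
  show ?case
  proof (cases "l \<le> r")
    case False
    then have l: "l \<in> {r<..n}" using less.prems by auto
    note p = parents[OF l]
    note IH = less.IH[OF p(1) p(5)]
    have tl: "tl (str l) = tl (str (fst (L l))) @ [snd (L l)]"
      using str_parents[OF l] IH by (simp add: tl_append2)
    have "y \<le> snd (L l)" if "y \<in> set (tl (str (fst (L l))))" for y
      using IH that rchild_parent[OF l] by fastforce
    then show ?thesis
      using IH p(6) str_parents[OF l] False by (auto simp: tl sorted_append rchild_def)
  qed (simp add: str_gen)
qed

lemma length_str: "l \<in> {r<..n} \<Longrightarrow> 2 \<le> length (str l)"
  using str_parents[of l] str_props[OF parents(5)[of l]] by (cases "str (fst (L l))") auto

text \<open>The last letter of a string of length at least 2 is the right parent and the rest is the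
  string of the left parent; as \<open>L\<close> is injective, induction recovers the
  element.\<close>

lemma str_inj: "a \<in> {1..n} \<Longrightarrow> b \<in> {1..n} \<Longrightarrow> str a = str b \<Longrightarrow> a = b"
proof (induction a arbitrary: b rule: less_induct)
  case (less a)
  have gen: "k \<le> r \<longleftrightarrow> length (str k) = 1" if "k \<in> {1..n}" for k
    using length_str[of k] str_gen[of k] that by (cases "k \<le> r") auto
  show ?case
  proof (cases "a \<le> r")
    case True
    then have "b \<le> r" using gen[OF less.prems(1)] gen[OF less.prems(2)] less.prems(3) by simp
    then show ?thesis using True less.prems by (simp add: str_gen)
  next
    case False
    then have "\<not> b \<le> r" using gen[OF less.prems(1)] gen[OF less.prems(2)] less.prems(3) by simp
    then have ab: "a \<in> {r<..n}" "b \<in> {r<..n}" using False less.prems by auto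
    have eq: "str (fst (L a)) = str (fst (L b))" "snd (L a) = snd (L b)"
      using less.prems(3) str_parents[OF ab(1)] str_parents[OF ab(2)] by auto
    have "fst (L a) = fst (L b)"
      by (rule less.IH[OF parents(1)[OF ab(1)] parents(5)[OF ab(1)] parents(5)[OF ab(2)] eq(1)])
    then show ?thesis using eq(2) parents_inj[OF ab] by (simp add: prod_eq_iff)
  qed
qed

text \<open>Deleting the last letter passes to the left parent, whose index is smaller.\<close>

lemma str_prefix_le:
  "k \<in> {1..n} \<Longrightarrow> a \<in> {1..n} \<Longrightarrow> str k = str a @ \<tau> \<Longrightarrow> a \<le> k"
proof (induction k arbitrary: \<tau> rule: less_induct)
  case (less k)
  show ?case
  proof (cases \<tau> rule: rev_cases)
    case Nil
    then show ?thesis using str_inj[OF less.prems(1,2)] less.prems(3) by simp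
  next
    case (snoc \<tau>' c)
    have "str a \<noteq> []" using str_props less.prems by blast
    then have "\<not> k \<le> r" using less.prems(3) snoc str_gen[of k] by (auto simp: Cons_eq_append_conv)
    then have k: "k \<in> {r<..n}" using less.prems by auto
    have "str (fst (L k)) = str a @ \<tau>'" using less.prems(3) snoc str_parents[OF k] by simp
    then show ?thesis
      using less.IH[OF parents(1)[OF k] parents(5)[OF k] less.prems(2)] parents(1)[OF k] by simp
  qed
qed

text \<open>Passing to left parents until a itself is the left parent, the letter c appears as the
  matching right parent, which a Hall basis requires to be smaller.\<close>

lemma str_next_letter:
  "k \<in> {1..n} \<Longrightarrow> a \<in> {1..n} \<Longrightarrow> str k = str a @ c # \<tau> \<Longrightarrow> c < a"
proof (induction k arbitrary: \<tau> rule: less_induct)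
  case (less k)
  have "str a \<noteq> []" using str_props less.prems by blast
  then have "\<not> k \<le> r" using less.prems(3) str_gen[of k] by (cases "str a") auto
  then have k: "k \<in> {r<..n}" using less.prems by auto
  note p = parents[OF k]
  show ?case
  proof (cases \<tau> rule: rev_cases)
    case Nil
    then have "str (fst (L k)) = str a" "snd (L k) = c"
      using less.prems(3) str_parents[OF k] by auto
    then show ?thesis using str_inj[OF p(5) less.prems(2)] p(2) by simp
  next
    case (snoc \<tau>' e)
    then have "str (fst (L k)) = str a @ c # \<tau>'" using less.prems(3) str_parents[OF k] by simp
    then show ?thesis using less.IH[OF p(1) p(5) less.prems(2)] by blast
  qed
qed

section \<open>Coefficients of the Hall--Grayson--Grossman fields\<close>

lemma hprec_iff: "hprec r L l i \<longleftrightarrow> (\<exists>\<tau>. str i = str l @ \<tau>)"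
  unfolding hprec_def by (metis append_eq_conv_conj append_take_drop_id)

text \<open>A divided power in the variables -x j, indexed by a word of which only the letter counts
  matter. With this normalisation, minus the derivative in direction b deletes one letter b and
  produces no further constant.\<close>

definition mon :: "nat list \<Rightarrow> pt \<Rightarrow> real" where
  "mon \<tau> x = (\<Prod>j\<in>{1..n}. (- x j) ^ count_list \<tau> j / fact (count_list \<tau> j))"

lemma mon_Nil [simp]: "mon [] x = 1"
  by (simp add: mon_def)

lemma mon_eq_0: "c \<in> set \<tau> \<Longrightarrow> c \<in> {1..n} \<Longrightarrow> x c = 0 \<Longrightarrow> mon \<tau> x = 0"
proof -
  assume c: "c \<in> set \<tau>" "c \<in> {1..n}" "x c = 0"
  then have "count_list \<tau> c \<noteq> 0" by (simp add: count_list_0_iff)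
  then show ?thesis
    unfolding mon_def using c(2,3) by (intro prod_zero bexI[of _ c]) auto
qed

lemma Ygen_eq_mon:
  "Ygen n r L l x i = (if i \<in> {1..n} \<and> hprec r L l i then mon (tl (str i)) x else 0)"
proof -
  have "(-1) ^ (\<Sum>j\<in>{1..n}. hI r L i j) / (\<Prod>j\<in>{1..n}. fact (hI r L i j))
        * (\<Prod>j\<in>{1..n}. x j ^ hI r L i j) = mon (tl (str i)) x"
    unfolding mon_def hI_def power_sum prod_dividef[symmetric] prod.distrib[symmetric]
    by (rule prod.cong[OF refl]) (simp add: power_minus[of "x _"])
  then show ?thesis by (simp add: Ygen_def)
qed

lemma partial_mon:
  assumes b: "b \<in> {1..n}"
  shows "partial b (mon (ys @ b # zs)) x = - mon (ys @ zs) x"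
    and "b \<notin> set \<tau> \<Longrightarrow> partial b (mon \<tau>) x = 0"
proof -
  let ?A = "{1..n} - {b}"
  let ?q = "count_list (ys @ zs) b"
  have split: "mon \<tau> (x(b := t)) = (- t) ^ count_list \<tau> b / fact (count_list \<tau> b) *
      (\<Prod>j\<in>?A. (- x j) ^ count_list \<tau> j / fact (count_list \<tau> j))" for \<tau> t
    unfolding mon_def by (subst prod.remove[OF _ b]) (auto intro!: prod.cong)
  have "((\<lambda>t. (- t) ^ Suc ?q / fact (Suc ?q) *
      (\<Prod>j\<in>?A. (- x j) ^ count_list (ys @ b # zs) j / fact (count_list (ys @ b # zs) j)))
      has_real_derivative - ((- x b) ^ ?q / fact ?q *
      (\<Prod>j\<in>?A. (- x j) ^ count_list (ys @ b # zs) j / fact (count_list (ys @ b # zs) j)))) (at (x b))"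
    by (rule derivative_eq_intros refl | simp add: divide_simps del: power_Suc)+
  moreover have "(\<Prod>j\<in>?A. (- x j) ^ count_list (ys @ b # zs) j / fact (count_list (ys @ b # zs) j))
      = (\<Prod>j\<in>?A. (- x j) ^ count_list (ys @ zs) j / fact (count_list (ys @ zs) j))"
    by (intro prod.cong) auto
  moreover have "mon (ys @ zs) x = (- x b) ^ ?q / fact ?q *
      (\<Prod>j\<in>?A. (- x j) ^ count_list (ys @ zs) j / fact (count_list (ys @ zs) j))"
    using split[of "ys @ zs" "x b"] by simp
  moreover have "count_list (ys @ b # zs) b = Suc ?q" by simp
  ultimately show "partial b (mon (ys @ b # zs)) x = - mon (ys @ zs) x"
    by (intro partialI) (simp only: split)
  assume "b \<notin> set \<tau>"
  then have "mon \<tau> (x(b := t)) = mon \<tau> x" for t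
    using split[of \<tau> t] split[of \<tau> "x b"] by (simp add: count_list_0_iff)
  then show "partial b (mon \<tau>) x = 0"
    by (simp add: partial_def)
qed

text \<open>Coordinate b itself is left free: directions k \<ge> b stay inside, so derivatives in
  these directions can be computed from formulas known on this set only.\<close>

definition flag :: "nat \<Rightarrow> pt set" where
  "flag b = {x \<in> pts n. \<forall>k<b. x k = 0}"

lemma flag_upd: "x \<in> flag b \<Longrightarrow> k \<in> {1..n} \<Longrightarrow> b \<le> k \<Longrightarrow> x(k := t) \<in> flag b"
  using pts_upd by (auto simp: flag_def)

lemma flag_mono: "b \<le> c \<Longrightarrow> flag c \<subseteq> flag b"
  by (auto simp: flag_def)

lemma partial_cong_flag:
  assumes "\<And>y. y \<in> flag b \<Longrightarrow> f y = g y" "x \<in> flag b" "k \<in> {1..n}" "b \<le> k"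
  shows "partial k f x = partial k g x"
  unfolding partial_def using assms(1)[OF flag_upd[OF assms(2-4)]] by simp

text \<open>The formula defining the generators, with \<open>str l\<close> in place of a single
  letter. Beyond the generators it is asserted only where the coordinates below the right parent
  vanish; for generators the restriction is void.\<close>

definition monomial_form :: "nat \<Rightarrow> bool" where
  "monomial_form l \<longleftrightarrow> (\<forall>x\<in>flag (rchild l).
     (\<forall>i\<in>{1..n}. \<forall>\<tau>. str i = str l @ \<tau> \<longrightarrow> Y l x i = mon \<tau> x) \<and>
     (\<forall>i. \<not> (i \<in> {1..n} \<and> hprec r L l i) \<longrightarrow> Y l x i = 0))"

text \<open>A string properly extending \<open>str l\<close> continues with a letter c < l, whose
  coordinate vanishes on \<open>flag l\<close>; only the coefficient of the empty continuation
  survives.\<close>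

lemma monomial_form_unit:
  assumes l: "l \<in> {1..n}" and form: "monomial_form l" and x: "x \<in> flag l"
  shows "Y l x i = (if i = l then 1 else 0)"
proof -
  have x': "x \<in> flag (rchild l)"
    using x flag_mono rchild_less[OF l] by (meson less_imp_le subsetD)
  show ?thesis
  proof (cases "i \<in> {1..n} \<and> hprec r L l i")
    case False
    then have "i \<noteq> l" using l by (auto simp: hprec_iff)
    then show ?thesis using form x' False unfolding monomial_form_def by simp
  next
    case True
    then obtain \<tau> where \<tau>: "str i = str l @ \<tau>" by (auto simp: hprec_iff)
    then have eq: "Y l x i = mon \<tau> x" using form x' True unfolding monomial_form_def by blast
    show ?thesis
    proof (cases \<tau>)
      case Nil
      then show ?thesis using eq \<tau> str_inj[of i l] True l by simp
    next
      case (Cons c \<tau>')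
      have "c < l" using str_next_letter[of i l c \<tau>'] True l \<tau> Cons by blast
      moreover have "str l \<noteq> []" using str_props[OF l] by blast
      then have "set \<tau> \<subseteq> set (tl (str i))" using \<tau> by (simp add: tl_append2)
      then have "c \<in> {1..n}" using str_props[of i] True Cons by auto
      ultimately have "mon \<tau> x = 0"
        using x Cons by (intro mon_eq_0[of c]) (auto simp: flag_def)
      moreover have "i \<noteq> l" using \<tau> Cons by auto
      ultimately show ?thesis using eq by simp
    qed
  qed
qed

lemma monomial_form_gen: "l \<in> {1..n} \<Longrightarrow> l \<le> r \<Longrightarrow> monomial_form l"
  unfolding monomial_form_def by (auto simp: hgg_gen Ygen_eq_mon str_gen hprec_iff)

text \<open>With b the right child of l, on the subspace where the first b - 1 coordinates vanish
  the field of index b is the b-th coordinate field. The bracket defining the field of index l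
  therefore reduces there to a single partial derivative in direction b.\<close>

lemma monomial_form_step:
  assumes l: "l \<in> {r<..n}"
    and fa: "monomial_form (fst (L l))" and fb: "monomial_form (snd (L l))"
  shows "monomial_form l"
proof -
  define a b where "a = fst (L l)" and "b = snd (L l)"
  note p = parents[OF l, folded a_def b_def]
  have fa: "monomial_form a" and fb: "monomial_form b" using fa fb by (simp_all add: a_def b_def)
  have b: "rchild l = b" using l by (simp add: rchild_def b_def)
  have sl: "str l = str a @ [b]" using str_parents[OF l] by (simp add: a_def b_def)
  have subset: "flag b \<subseteq> flag (rchild a)"
    using flag_mono rchild_parent[OF l] by (simp add: a_def b_def)
  have Ya: "Y a y i = mon \<tau> y" if "y \<in> flag b" "i \<in> {1..n}" "str i = str a @ \<tau>" for y i \<tau>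
    using fa that subset unfolding monomial_form_def by blast
  have Ya0: "Y a y i = 0" if "y \<in> flag b" "\<not> (i \<in> {1..n} \<and> hprec r L a i)" for y i
    using fa that subset unfolding monomial_form_def by blast
  have Yl: "Y l x i = - partial b (\<lambda>y. Y a y i) x" if x: "x \<in> flag b" for x i
  proof -
    have "Y a x k * partial k (\<lambda>y. Y b y i) x - Y b x k * partial k (\<lambda>y. Y a y i) x =
        (if k = b then - partial b (\<lambda>y. Y a y i) x else 0)" if k: "k \<in> {1..n}" for k
    proof -
      \<comment> \<open>For k < b the string of a is not an initial segment of that of k, as this
        would give k \<ge> a > b. For k \<ge> b the direction stays in \<open>flag b\<close>, where
        the components of \<open>Y b\<close> are constant.\<close>
      have "Y a x k * partial k (\<lambda>y. Y b y i) x = 0"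
      proof (cases "k < b")
        case True
        then have "\<not> hprec r L a k"
          using str_prefix_le[OF k p(5)] p(2) by (auto simp: hprec_iff)
        then show ?thesis using Ya0[OF x] by simp
      next
        case False
        then have "partial k (\<lambda>y. Y b y i) x = partial k (\<lambda>y. if i = b then 1 else 0) x"
          by (intro partial_cong_flag[OF monomial_form_unit[OF p(6) fb] x k]) auto
        then show ?thesis by simp
      qed
      then show ?thesis using monomial_form_unit[OF p(6) fb x] by (cases "k = b") auto
    qed
    then have "Y l x i = (\<Sum>k\<in>{1..n}. if k = b then - partial b (\<lambda>y. Y a y i) x else 0)"
      unfolding hgg_parents[OF l] vf_bracket_def by (simp add: a_def b_def)
    then show ?thesis using p(6) by simp
  qed
  show ?thesis
    unfolding monomial_form_def b
  proof (intro ballI conjI allI impI)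
    fix x i \<tau> assume x: "x \<in> flag b" and i: "i \<in> {1..n}" and \<tau>: "str i = str l @ \<tau>"
    then have "str i = str a @ ([] @ b # \<tau>)" by (simp add: sl)
    then have "partial b (\<lambda>y. Y a y i) x = partial b (mon ([] @ b # \<tau>)) x"
      by (intro partial_cong_flag[OF Ya[OF _ i] x p(6)]) auto
    then show "Y l x i = mon \<tau> x" using Yl[OF x] partial_mon(1)[OF p(6), of "[]"] by simp
  next
    fix x i assume x: "x \<in> flag b" and ni: "\<not> (i \<in> {1..n} \<and> hprec r L l i)"
    have "partial b (\<lambda>y. Y a y i) x = 0"
    proof (cases "i \<in> {1..n} \<and> hprec r L a i")
      case False
      then have "partial b (\<lambda>y. Y a y i) x = partial b (\<lambda>y. 0) x"
        by (intro partial_cong_flag[OF Ya0 x p(6)]) auto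
      then show ?thesis by simp
    next
      case True
      then obtain \<tau> where \<tau>: "str i = str a @ \<tau>" by (auto simp: hprec_iff)
      have eq: "partial b (\<lambda>y. Y a y i) x = partial b (mon \<tau>) x"
        by (intro partial_cong_flag[OF Ya x p(6)]) (use True \<tau> in auto)
      show ?thesis
      proof (cases "b \<in> set \<tau>")
        case False
        then show ?thesis using eq partial_mon(2)[OF p(6)] by simp
      next
        case b\<tau>: True
        obtain ys zs where split: "\<tau> = ys @ b # zs" "b \<notin> set ys"
          using split_list_first[OF b\<tau>] by blast
        \<comment> \<open>If b were the first letter of \<tau>, the string of i would extend that of
          l, which is excluded. A letter c before b is smaller by sortedness, it survives the
          deletion of b, and its coordinate vanishes on \<open>flag b\<close>.\<close>
        have "ys \<noteq> []"
          using ni True \<tau> split(1) by (auto simp: hprec_iff sl)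
        then obtain c ys' where ys: "ys = c # ys'" by (cases ys) auto
        have "str a \<noteq> []" using str_props[OF p(5)] by blast
        then have tl: "tl (str i) = tl (str a) @ \<tau>" using \<tau> by (simp add: tl_append2)
        have "sorted (tl (str i))" "set (tl (str i)) \<subseteq> {1..n}"
          using str_props True by blast+
        then have "sorted \<tau>" "set \<tau> \<subseteq> {1..n}"
          unfolding tl by (simp_all add: sorted_append)
        then have "c < b" "c \<in> {1..n}" using split ys by (auto simp: order_less_le)
        then have "mon (ys @ zs) x = 0"
          using x ys by (intro mon_eq_0[of c]) (auto simp: flag_def)
        then show ?thesis using eq split partial_mon(1)[OF p(6)] by simp
      qed
    qed
    then show "Y l x i = 0" using Yl[OF x] by simp
  qed
qed

lemma monomial_form: "l \<in> {1..n} \<Longrightarrow> monomial_form l"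
proof (induction l rule: less_induct)
  case (less l)
  show ?case
  proof (cases "l \<le> r")
    case False
    then have l: "l \<in> {r<..n}" using less.prems by auto
    show ?thesis
      using monomial_form_step[OF l] less.IH parents[OF l] by (meson less_trans)
  qed (use monomial_form_gen less.prems in blast)
qed

definition unit :: "nat \<Rightarrow> pt" where "unit l = (\<lambda>i. if i = l then 1 else 0)"

lemma unit_pts [simp]: "l \<in> {1..n} \<Longrightarrow> unit l \<in> pts n"
  by (auto simp: unit_def pts_def)

lemma hgg_flag: "l \<in> {1..n} \<Longrightarrow> x \<in> flag l \<Longrightarrow> Y l x = unit l"
  using monomial_form_unit[OF _ monomial_form] unfolding unit_def by blast

lemma hgg_origin: "l \<in> {1..n} \<Longrightarrow> Y l origin = unit l"
  by (rule hgg_flag) (auto simp: flag_def origin_def pts_def)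

end

subsection \<open>Homomorphisms and the coadjoint action\<close>

locale smooth_group_hom = F: smooth_group n multF + G: smooth_group m multG
  for n multF m multG +
  fixes \<pi> :: "pt \<Rightarrow> pt"
  assumes hom: "lie_hom_onto n m multF multG \<pi>"
begin

lemma \<pi>_pts [simp]: "x \<in> pts n \<Longrightarrow> \<pi> x \<in> pts m"
  and \<pi>_mul: "x \<in> pts n \<Longrightarrow> y \<in> pts n \<Longrightarrow> \<pi> (multF x y) = multG (\<pi> x) (\<pi> y)"
  and smooth_\<pi>: "j \<in> {1..m} \<Longrightarrow> smooth_fun n (\<lambda>x. \<pi> x j)"
  using hom unfolding lie_hom_onto_def smooth_map_def by blast+

lemma \<pi>_origin [simp]: "\<pi> origin = origin"
proof -
  let ?e = "\<pi> origin"
  have e: "?e \<in> pts m" by simp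
  have "?e = multG ?e (multG ?e (G.gi ?e))" using e by simp
  also have "\<dots> = multG (multG ?e ?e) (G.gi ?e)" by (rule G.mul_assoc[OF e e G.gi_pts[OF e], symmetric])
  also have "multG ?e ?e = ?e" using \<pi>_mul[of origin origin] by simp
  finally show ?thesis using e by simp
qed

definition push :: "pt \<Rightarrow> pt" where "push u = dmap n \<pi> origin u"

lemma push_eq: "push u j = (\<Sum>k\<in>{1..n}. u k * partial k (\<lambda>y. \<pi> y j) origin)"
  by (simp add: push_def dmap_def)

lemma push_pts [simp]: "push u \<in> pts m"
proof -
  have "push u j = 0" if "j \<notin> {1..m}" for j
  proof -
    have "partial k (\<lambda>y. \<pi> y j) origin = 0" if "k \<in> {1..n}" for k
      by (rule partial_zero_on_pts[OF pts_outside[OF \<pi>_pts \<open>j \<notin> {1..m}\<close>] origin_pts that])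
    then show ?thesis by (simp add: push_eq)
  qed
  then show ?thesis unfolding pts_def by blast
qed

text \<open>The identity \<open>\<pi> (multF x y) = multG (\<pi> x) (\<pi> y)\<close> is
  differentiated in y at the identity, with the chain rule applied to either expression.\<close>

lemma linv_related:
  assumes x: "x \<in> pts n" and j: "j \<in> {1..m}"
  shows "lie_der n (F.linv u) (\<lambda>y. \<pi> y j) x = G.linv (push u) (\<pi> x) j"
proof -
  have 1: "partial k (\<lambda>y. \<pi> (multF x y) j) origin =
      (\<Sum>i\<in>{1..n}. partial i (\<lambda>y. \<pi> y j) x * partial k (\<lambda>y. multF x y i) origin)"
    if k: "k \<in> {1..n}" for k
    using partial_compose[of n "\<lambda>y. \<pi> y j" n "multF x" origin k] smooth_\<pi>[OF j] x k
      F.smooth_translations(1)[OF x] by simp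
  have 2: "partial k (\<lambda>y. \<pi> (multF x y) j) origin =
      (\<Sum>i\<in>{1..m}. partial i (\<lambda>y. multG (\<pi> x) y j) origin * partial k (\<lambda>y. \<pi> y i) origin)"
    if k: "k \<in> {1..n}" for k
  proof -
    have "partial k (\<lambda>y. \<pi> (multF x y) j) origin = partial k (\<lambda>y. multG (\<pi> x) (\<pi> y) j) origin"
      by (rule partial_cong[OF _ origin_pts k]) (simp add: \<pi>_mul x)
    also have "\<dots> = (\<Sum>i\<in>{1..m}. partial i (\<lambda>y. multG (\<pi> x) y j) (\<pi> origin) *
        partial k (\<lambda>y. \<pi> y i) origin)"
      by (rule partial_compose[OF G.smooth_translations(1)[OF \<pi>_pts[OF x] j] \<pi>_pts smooth_\<pi> origin_pts k])
    finally show ?thesis by simp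
  qed
  have "lie_der n (F.linv u) (\<lambda>y. \<pi> y j) x =
      (\<Sum>k\<in>{1..n}. u k * partial k (\<lambda>y. \<pi> (multF x y) j) origin)"
    unfolding lie_der_def F.linv_eq sum_distrib_right
    by (subst sum.swap) (simp add: 1 sum_distrib_left mult_ac)
  also have "\<dots> = (\<Sum>k\<in>{1..n}. \<Sum>i\<in>{1..m}. u k *
      (partial i (\<lambda>y. multG (\<pi> x) y j) origin * partial k (\<lambda>y. \<pi> y i) origin))"
    unfolding sum_distrib_left[symmetric] by (rule sum.cong[OF refl]) (simp add: 2)
  also have "\<dots> = G.linv (push u) (\<pi> x) j"
    unfolding G.linv_eq push_eq sum_distrib_right by (subst sum.swap) (simp add: mult_ac)
  finally show ?thesis .
qed

lemma push_br: "push (F.br u w) = G.br (push u) (push w)"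
proof (rule pts_eqI[OF push_pts G.br_pts])
  fix j assume j: "j \<in> {1..m}"
  have "lie_der n (vf_bracket n (F.linv u) (F.linv w)) (\<lambda>y. \<pi> y j) origin
      = vf_bracket m (G.linv (push u)) (G.linv (push w)) (\<pi> origin) j"
    by (rule vf_bracket_related[OF \<pi>_pts smooth_\<pi> F.smooth_linv F.smooth_linv G.smooth_linv
        G.smooth_linv linv_related linv_related origin_pts j])
  then show "push (F.br u w) j = G.br (push u) (push w) j"
    by (simp only: push_eq lie_br_def lie_der_def \<pi>_origin)
qed

text \<open>The function f u of the overview, with the covector w made explicit; the name refers to
  the coadjoint action on w.\<close>

definition coadj :: "pt \<Rightarrow> pt \<Rightarrow> pt \<Rightarrow> real" where
  "coadj w u x = (\<Sum>j\<in>{1..m}. w j * G.ad u (\<pi> x) j)"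

lemma smooth_ad_sum: "smooth_fun m (\<lambda>p. \<Sum>j\<in>{1..m}. w j * G.ad u p j)"
  by (intro smooth_fun_sum smooth_fun_mult smooth_fun_const G.smooth_ad finite_atLeastAtMost)

lemma smooth_coadj: "smooth_fun n (coadj w u)"
  unfolding coadj_def[abs_def] by (rule smooth_fun_comp[OF smooth_ad_sum \<pi>_pts smooth_\<pi>])

text \<open>\<pi> relates the left-invariant field of a on F to that of \<open>push a\<close> on G,
  so the derivative can be taken on G, where \<open>lie_der_ad\<close> applies.\<close>

lemma lie_der_coadj:
  assumes x: "x \<in> pts n"
  shows "lie_der n (F.linv a) (coadj w u) x = coadj w (G.br (push a) u) x"
proof -
  let ?D = "lie_der m (G.linv (push a))"
  have p: "\<pi> x \<in> pts m" using x by simp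
  have "lie_der n (F.linv a) (coadj w u) x = ?D (\<lambda>p. \<Sum>j\<in>{1..m}. w j * G.ad u p j) (\<pi> x)"
    unfolding coadj_def[abs_def]
    by (rule lie_der_chain[where \<phi> = \<pi> and X' = "G.linv (push a)"])
      (use smooth_ad_sum smooth_\<pi> x linv_related in auto)
  also have "\<dots> = (\<Sum>j\<in>{1..m}. ?D (\<lambda>p. w j * G.ad u p j) (\<pi> x))"
    by (rule lie_der_sum[OF _ p]) (intro smooth_fun_mult smooth_fun_const G.smooth_ad)
  also have "\<dots> = (\<Sum>j\<in>{1..m}. w j * G.ad (G.br (push a) u) (\<pi> x) j)"
  proof (rule sum.cong[OF refl])
    fix j assume j: "j \<in> {1..m}"
    have "?D (\<lambda>p. w j) (\<pi> x) = 0" by (simp add: lie_der_def)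
    then show "?D (\<lambda>p. w j * G.ad u p j) (\<pi> x) = w j * G.ad (G.br (push a) u) (\<pi> x) j"
      using lie_der_mult[OF smooth_fun_const G.smooth_ad[OF j] p] G.lie_der_ad[OF p j] by simp
  qed
  finally show ?thesis by (simp add: coadj_def)
qed

lemma coadj_scale: "coadj w (\<lambda>i. c * u i) x = c * coadj w u x"
  by (simp add: coadj_def G.ad_scale sum_distrib_left mult_ac)

lemma coadj_zero: "coadj w origin x = 0"
  using coadj_scale[of w 0 origin x] by (simp add: origin_def)

lemma coadj_origin: "u \<in> pts m \<Longrightarrow> coadj w u origin = (\<Sum>j\<in>{1..m}. w j * u j)"
  by (simp add: coadj_def)

end

subsection \<open>Extremal polynomials\<close>

text \<open>Nilpotency is assumed in the form the Taylor expansion consumes: s or more successive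
  brackets with images of Hall basis elements give 0. The images are spelled out with
  \<open>dmap\<close> because \<open>y\<close> is introduced only inside the locale. The
  stratification supplies this assumption in the end.\<close>

locale free_hom = hall r s n L + smooth_group_hom n multF m multG \<pi>
  for r s n L multF m multG \<pi> +
  assumes free: "free_group_law n r L multF"
    and nilpotent: "\<And>u js. u \<in> pts m \<Longrightarrow> set js \<subseteq> {1..n} \<Longrightarrow> s \<le> length js \<Longrightarrow>
      foldl (\<lambda>W j. lie_br m multG W (dmap n \<pi> origin (hgg n r L j origin))) u js = origin"
begin

definition y :: "nat \<Rightarrow> pt" where "y i = push (unit i)"

lemma y_pts [simp]: "y i \<in> pts m"
  by (simp add: y_def)

lemma hgg_linv: "i \<in> {1..n} \<Longrightarrow> p \<in> pts n \<Longrightarrow> Y i p = F.linv (unit i) p"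
  using free hgg_origin unfolding free_group_law_def by simp

lemma push0_eq: "i \<in> {1..n} \<Longrightarrow> push0 n \<pi> (Y i) = y i"
  by (simp add: push0_def y_def push_def hgg_origin)

abbreviation nest :: "pt \<Rightarrow> nat list \<Rightarrow> pt" where
  "nest \<equiv> foldl (\<lambda>W j. G.br W (y j))"

lemma nest_pts: "u \<in> pts m \<Longrightarrow> nest u js \<in> pts m"
  by (induction js arbitrary: u) auto

lemma nest_nilpotent:
  assumes "u \<in> pts m" "set js \<subseteq> {1..n}" "s \<le> length js"
  shows "nest u js = origin"
proof -
  have "nest u js = foldl (\<lambda>W j. G.br W (dmap n \<pi> origin (Y j origin))) u js"
    by (rule foldl_cong) (use assms(2) in \<open>auto simp: y_def push_def hgg_origin subset_iff\<close>)
  then show ?thesis using nilpotent[OF assms] by simp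
qed

lemma y_parents:
  assumes "l \<in> {r<..n}"
  shows "y l = G.br (y (fst (L l))) (y (snd (L l)))"
proof -
  have "unit l = F.br (unit (fst (L l))) (unit (snd (L l)))"
  proof -
    have "unit l = vf_bracket n (Y (fst (L l))) (Y (snd (L l))) origin"
      using assms hgg_origin[of l] hgg_parents[OF assms] by simp
    also have "\<dots> = F.br (unit (fst (L l))) (unit (snd (L l)))"
      unfolding lie_br_def by (rule vf_bracket_cong) (use hgg_linv parents(5,6)[OF assms] in auto)
    finally show ?thesis .
  qed
  then show ?thesis unfolding y_def by (metis push_br)
qed

section \<open>Generalized structure constants\<close>

lemma foldl_vf_bracket:
  assumes "set js \<subseteq> {1..n}" "\<And>x. x \<in> pts n \<Longrightarrow> Z x = F.linv u x" "x \<in> pts n"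
  shows "foldl (\<lambda>W j. vf_bracket n W (Y j)) Z js x = F.linv (foldl (\<lambda>W j. F.br W (unit j)) u js) x"
  using assms
proof (induction js arbitrary: Z u)
  case (Cons j js)
  have "vf_bracket n Z (Y j) x = F.linv (F.br u (unit j)) x" if "x \<in> pts n" for x
  proof -
    have "vf_bracket n Z (Y j) x = vf_bracket n (F.linv u) (F.linv (unit j)) x"
      by (rule vf_bracket_cong) (use Cons.prems hgg_linv that in auto)
    then show ?thesis using F.vf_bracket_linv[OF that] by simp
  qed
  then show ?case using Cons by simp
qed simp

text \<open>The letters stop before l, so raising l by one appends the block
  \<open>replicate (\<alpha> l) l\<close>; the full multi-index corresponds to l = n + 1.\<close>

abbreviation word :: "nat \<Rightarrow> (nat \<Rightarrow> nat) \<Rightarrow> nat list" where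
  "word l \<alpha> \<equiv> concat (map (\<lambda>j. replicate (\<alpha> j) j) [1..<l])"

lemma set_word: "set (word (n + 1) \<alpha>) \<subseteq> {1..n}"
  by auto

lemma length_word: "length (word l \<alpha>) = (\<Sum>j\<in>{1..<l}. \<alpha> j)"
  by (simp add: length_concat o_def interv_sum_list_conv_sum_set_nat)

text \<open>The choice in \<open>gsc\<close> is forced: a constant combination of the
  \<open>Y k\<close> is the left-invariant field of its coefficient vector, and such a field is
  determined by its value at the identity.\<close>

lemma gsc_eq:
  assumes i: "i \<in> {1..n}"
  shows "gsc n r L i \<alpha> = foldl (\<lambda>W j. F.br W (unit j)) (unit i) (word (n + 1) \<alpha>)" (is "_ = ?U")
proof -
  have U: "?U \<in> pts n"
  proof -
    have "foldl (\<lambda>W j. F.br W (unit j)) v js \<in> pts n" if "v \<in> pts n" for v js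
      using that by (induction js arbitrary: v) auto
    then show ?thesis using i by simp
  qed
  have nest: "nest_br n r L (Y i) \<alpha> x = F.linv ?U x" if "x \<in> pts n" for x
    unfolding nest_br_def by (rule foldl_vf_bracket[OF set_word _ that]) (rule hgg_linv[OF i])
  have coeff: "F.linv c x j = (\<Sum>k\<in>{1..n}. c k * Y k x j)" if x: "x \<in> pts n" for c x j
  proof -
    have "Y k x j = partial k (\<lambda>y. multF x y j) origin" if "k \<in> {1..n}" for k
    proof -
      have "Y k x j = (\<Sum>l\<in>{1..n}. if l = k then partial l (\<lambda>y. multF x y j) origin else 0)"
        unfolding hgg_linv[OF that x] F.linv_eq unit_def by (rule sum.cong) auto
      then show ?thesis using that by simp
    qed
    then show ?thesis by (simp add: F.linv_eq)
  qed
  define P where "P c \<longleftrightarrow> (\<forall>k. k \<notin> {1..n} \<longrightarrow> c k = 0) \<and>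
      (\<forall>x\<in>pts n. nest_br n r L (Y i) \<alpha> x = (\<lambda>j. \<Sum>k\<in>{1..n}. c k * Y k x j))" for c
  have "P ?U"
    unfolding P_def
  proof (intro conjI allI impI ballI)
    show "?U k = 0" if "k \<notin> {1..n}" for k
      using pts_outside[OF U that] .
    show "nest_br n r L (Y i) \<alpha> x = (\<lambda>j. \<Sum>k\<in>{1..n}. ?U k * Y k x j)" if "x \<in> pts n" for x
      unfolding nest[OF that] by (rule ext) (rule coeff[OF that])
  qed
  moreover have "c = ?U" if c: "P c" for c
  proof -
    have cp: "c \<in> pts n" using c unfolding P_def pts_def by blast
    have "F.linv ?U origin = F.linv c origin"
      using c coeff[OF origin_pts, of c] nest[OF origin_pts] unfolding P_def by (simp add: fun_eq_iff)
    then show ?thesis using U cp by simp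
  qed
  ultimately have "(SOME c. P c) = ?U" by (rule some_equality)
  then show ?thesis unfolding gsc_def P_def .
qed

lemma push_sum_unit:
  shows "push U j = (\<Sum>k\<in>{1..n}. U k * y k j)"
proof -
  have "y k j = partial k (\<lambda>x. \<pi> x j) origin" if "k \<in> {1..n}" for k
  proof -
    have "y k j = (\<Sum>l\<in>{1..n}. if l = k then partial l (\<lambda>x. \<pi> x j) origin else 0)"
      unfolding y_def push_eq unit_def by (rule sum.cong) auto
    then show ?thesis using that by simp
  qed
  then show ?thesis by (simp add: push_eq)
qed

text \<open>With v k the pairing of w with \<open>y k\<close>, the coefficient sum in the extremal
  polynomial becomes the pairing of w with an iterated bracket in G, because the differential of
  \<pi> respects brackets.\<close>

lemma gsc_pairing:
  assumes i: "i \<in> {1..n}"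
  shows "(\<Sum>k\<in>{1..n}. gsc n r L i \<alpha> k * (\<Sum>j\<in>{1..m}. w j * y k j)) =
    (\<Sum>j\<in>{1..m}. w j * nest (y i) (word (n + 1) \<alpha>) j)"
proof -
  have "push (foldl (\<lambda>W j. F.br W (unit j)) u js) = nest (push u) js" for u js
    by (induction js arbitrary: u) (simp_all add: push_br y_def)
  then have "nest (y i) (word (n + 1) \<alpha>) j = (\<Sum>k\<in>{1..n}. gsc n r L i \<alpha> k * y k j)" for j
    unfolding gsc_eq[OF i] push_sum_unit[symmetric] by (simp add: y_def)
  then show ?thesis
    unfolding sum_distrib_left by (subst sum.swap) (simp only: sum_distrib_left mult_ac)
qed

text \<open>On flag l the l-th coordinate direction is an integral direction of Y l, so differentiating
  coadj along it amounts to bracketing with y l, and nilpotency makes the Maclaurin series a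
  polynomial. Applying this to the coordinates 1, ..., n in turn yields the extremal polynomial.\<close>

lemma coadj_DERIV:
  assumes x: "x \<in> flag l" and l: "l \<in> {1..n}"
  shows "((\<lambda>t. coadj w u (x(l := t))) has_real_derivative coadj w (G.br (y l) u) (x(l := t))) (at t)"
proof -
  have x': "x(l := t) \<in> flag l" using flag_upd[OF x l] by simp
  then have p: "x \<in> pts n" "x(l := t) \<in> pts n" using x by (auto simp: flag_def)
  have "coadj w (G.br (y l) u) (x(l := t)) = lie_der n (F.linv (unit l)) (coadj w u) (x(l := t))"
    using lie_der_coadj[OF p(2)] by (simp add: y_def)
  also have "F.linv (unit l) (x(l := t)) = unit l"
    using hgg_flag[OF l x'] hgg_linv[OF l p(2)] by simp
  then have "lie_der n (F.linv (unit l)) (coadj w u) (x(l := t)) =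
      (\<Sum>k\<in>{1..n}. if k = l then partial k (coadj w u) (x(l := t)) else 0)"
    unfolding lie_der_def by (intro sum.cong) (auto simp: unit_def)
  also have "\<dots> = partial l (coadj w u) (x(l := t))" using l by simp
  finally show ?thesis
    using smooth_fun_DERIV[OF smooth_coadj p(1) l] by simp
qed

text \<open>Differentiation brackets with \<open>y l\<close> on the left, while \<open>nest\<close>
  brackets on the right; each exchange costs a sign. This is the source of the factor
  (-1)^|\<alpha>| in the extremal polynomials.\<close>

lemma nest_replicate:
  assumes "u \<in> pts m"
  shows "nest u (replicate q l) = (\<lambda>i. (-1) ^ q * (G.br (y l) ^^ q) u i) \<and> (G.br (y l) ^^ q) u \<in> pts m"
proof (induction q)
  case (Suc q)
  let ?U = "(G.br (y l) ^^ q) u"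
  have "nest u (replicate (Suc q) l) = G.br (nest u (replicate q l)) (y l)"
    by (simp only: replicate_Suc replicate_append_same[symmetric] foldl_append foldl.simps)
  also have "\<dots> = (\<lambda>i. - G.br (y l) (\<lambda>i. (-1) ^ q * ?U i) i)"
    using Suc G.br_antisym[OF nest_pts[OF assms] y_pts] by metis
  also have "G.br (y l) (\<lambda>i. (-1) ^ q * ?U i) = (\<lambda>i. (-1) ^ q * G.br (y l) ?U i)"
    using G.br_add_right[of ?U ?U "y l" "(-1) ^ q" 0] Suc by simp
  finally show ?case by simp
qed (use assms in simp)

lemma coadj_taylor:
  assumes x: "x \<in> flag l" and l: "l \<in> {1..n}" and u: "u \<in> pts m"
  shows "coadj w u x = (\<Sum>q<s. (- x l) ^ q / fact q * coadj w (nest u (replicate q l)) (x(l := 0)))"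
proof -
  define D where "D q t = coadj w ((G.br (y l) ^^ q) u) (x(l := t))" for q t
  have "\<exists>t. \<bar>t\<bar> \<le> \<bar>x l\<bar> \<and> D 0 (x l) = (\<Sum>q<s. D q 0 / fact q * x l ^ q) + D s t / fact s * x l ^ s"
    by (rule Maclaurin_all_le) (use coadj_DERIV[OF x l] in \<open>auto simp: D_def\<close>)
  \<comment> \<open>The remainder is taken at order s, the first order at which the iterated bracket
    is known to vanish.\<close>
  moreover have "D s t = 0" for t
  proof -
    have "nest u (replicate s l) = origin"
      using nest_nilpotent[OF u, of "replicate s l"] l by (auto simp: set_replicate_conv_if)
    then have "(\<lambda>i. (-1) ^ s * (G.br (y l) ^^ s) u i) = (\<lambda>i. 0)"
      using nest_replicate[OF u, of s l] by (simp add: origin_def)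
    then have "(G.br (y l) ^^ s) u = origin"
      by (simp add: fun_eq_iff origin_def)
    then show ?thesis by (simp add: D_def coadj_zero)
  qed
  ultimately have "coadj w u x = (\<Sum>q<s. D q 0 / fact q * x l ^ q)"
    by (auto simp: D_def)
  also have "\<dots> = (\<Sum>q<s. (- x l) ^ q / fact q * coadj w (nest u (replicate q l)) (x(l := 0)))"
  proof (rule sum.cong[OF refl])
    fix q
    have "coadj w (nest u (replicate q l)) (x(l := 0)) = (-1) ^ q * D q 0"
      using nest_replicate[OF u, of q l] by (simp add: coadj_scale D_def)
    moreover have "(- x l) ^ q = (-1) ^ q * x l ^ q" by (rule power_minus)
    ultimately show "D q 0 / fact q * x l ^ q =
        (- x l) ^ q / fact q * coadj w (nest u (replicate q l)) (x(l := 0))"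
      by (simp add: power_mult_distrib[symmetric])
  qed
  finally show ?thesis .
qed

text \<open>A finite set of exponents carrying the whole expansion: an exponent of s or more in one
  variable already produces s brackets. Only variables below l occur, matching
  \<open>word l\<close>.\<close>

definition box :: "nat \<Rightarrow> (nat \<Rightarrow> nat) set" where
  "box l = {\<alpha>. \<forall>j. (j \<in> {1..<l} \<longrightarrow> \<alpha> j < s) \<and> (j \<notin> {1..<l} \<longrightarrow> \<alpha> j = 0)}"

lemma box_1: "box 1 = {\<lambda>_. 0}"
  by (auto simp: box_def)

lemma box_Suc:
  assumes "1 \<le> l"
  shows "bij_betw (\<lambda>(\<alpha>, q). \<alpha>(l := q)) (box l \<times> {..<s}) (box (Suc l))"
proof (rule bij_betw_byWitness[where f' = "\<lambda>\<alpha>. (\<alpha>(l := 0), \<alpha> l)"])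
qed (use assms in \<open>auto simp: box_def fun_eq_iff\<close>)

lemma finite_box: "finite (box (Suc l))"
proof (induction l)
  case (Suc l)
  then show ?case
    using bij_betw_finite[OF box_Suc[of "Suc l"]] by simp
qed (simp add: box_1[simplified])

text \<open>After l steps the variables 1, ..., l have been expanded and set to 0. This puts the
  remaining point in \<open>flag (Suc l)\<close>, exactly where the expansion in the next variable
  is available; its brackets are appended at the end of the word.\<close>

lemma coadj_expansion:
  assumes x: "x \<in> pts n" and u: "u \<in> pts m" and l: "l \<le> n"
  shows "coadj w u x = (\<Sum>\<alpha>\<in>box (Suc l). (\<Prod>j\<in>{1..<Suc l}. (- x j) ^ \<alpha> j / fact (\<alpha> j)) *
    coadj w (nest u (word (Suc l) \<alpha>)) (\<lambda>k. if k < Suc l then 0 else x k))"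
  using l
proof (induction l)
  case 0
  have "(\<lambda>k. if k < Suc 0 then 0 else x k) = x"
    using x by (auto simp: pts_def fun_eq_iff)
  then show ?case by (simp add: box_1[simplified])
next
  case (Suc l)
  let ?l = "Suc l"
  let ?T = "\<lambda>l \<alpha>. \<Prod>j\<in>{1..<l}. (- x j) ^ \<alpha> j / fact (\<alpha> j)"
  let ?x = "\<lambda>l k. if k < l then 0 else x k"
  have l: "?l \<in> {1..n}" using Suc.prems by simp
  have flag: "?x ?l \<in> flag ?l" using x by (auto simp: flag_def pts_def)
  have upd: "(?x ?l)(?l := 0) = ?x (Suc ?l)" by (auto simp: fun_eq_iff)
  have "coadj w u x = (\<Sum>\<alpha>\<in>box ?l. ?T ?l \<alpha> * coadj w (nest u (word ?l \<alpha>)) (?x ?l))"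
    using Suc by simp
  also have "\<dots> = (\<Sum>\<alpha>\<in>box ?l. \<Sum>q<s. ?T ?l \<alpha> * ((- x ?l) ^ q / fact q *
      coadj w (nest (nest u (word ?l \<alpha>)) (replicate q ?l)) (?x (Suc ?l))))"
    unfolding sum_distrib_left[symmetric]
    using coadj_taylor[OF flag l nest_pts[OF u]] unfolding upd by simp
  also have "\<dots> = (\<Sum>(\<alpha>, q)\<in>box ?l \<times> {..<s}. ?T ?l \<alpha> * ((- x ?l) ^ q / fact q *
      coadj w (nest (nest u (word ?l \<alpha>)) (replicate q ?l)) (?x (Suc ?l))))"
    by (rule sum.cartesian_product)
  also have "\<dots> = (\<Sum>(\<alpha>, q)\<in>box ?l \<times> {..<s}. ?T (Suc ?l) (\<alpha>(?l := q)) *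
      coadj w (nest u (word (Suc ?l) (\<alpha>(?l := q)))) (?x (Suc ?l)))"
  proof (rule sum.cong[OF refl], clarify)
    fix \<alpha> q
    have "?T (Suc ?l) (\<alpha>(?l := q)) = ?T ?l \<alpha> * ((- x ?l) ^ q / fact q)"
      by (subst prod.atLeastLessThan_Suc) (auto intro!: prod.cong)
    moreover have "word (Suc ?l) (\<alpha>(?l := q)) = word ?l \<alpha> @ replicate q ?l"
    proof -
      have "map (\<lambda>j. replicate ((\<alpha>(?l := q)) j) j) [1..<?l] = map (\<lambda>j. replicate (\<alpha> j) j) [1..<?l]"
        by (rule map_cong) auto
      moreover have "[1..<Suc ?l] = [1..<?l] @ [?l]" by simp
      ultimately show ?thesis
        by (simp only: map_append concat_append list.map concat.simps fun_upd_same append_Nil2)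
    qed
    ultimately show "?T ?l \<alpha> * ((- x ?l) ^ q / fact q *
        coadj w (nest (nest u (word ?l \<alpha>)) (replicate q ?l)) (?x (Suc ?l))) =
      ?T (Suc ?l) (\<alpha>(?l := q)) * coadj w (nest u (word (Suc ?l) (\<alpha>(?l := q)))) (?x (Suc ?l))"
      by (simp only: foldl_append mult.assoc)
  qed
  also have "\<dots> = (\<Sum>\<alpha>\<in>box (Suc ?l). ?T (Suc ?l) \<alpha> *
      coadj w (nest u (word (Suc ?l) \<alpha>)) (?x (Suc ?l)))"
    using sum.reindex_bij_betw[OF box_Suc[of ?l], of "\<lambda>\<alpha>. ?T (Suc ?l) \<alpha> *
      coadj w (nest u (word (Suc ?l) \<alpha>)) (?x (Suc ?l))"] by (simp only: case_prod_unfold)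
  finally show ?case .
qed

text \<open>With all n variables expanded the remaining point is the identity, where Ad is trivial,
  and the coefficients are those of \<open>gsc_pairing\<close>. The infinite sum in
  \<open>ext_poly\<close> collapses to \<open>box\<close> because every other multi-index yields a
  word of at least s letters.\<close>

lemma coadj_eq_ext_poly:
  assumes x: "x \<in> pts n" and i: "i \<in> {1..n}"
  shows "coadj w (y i) x = ext_poly n r L (\<lambda>k. \<Sum>j\<in>{1..m}. w j * y k j) i x"
proof -
  define T where "T \<alpha> = (-1) ^ (\<Sum>j\<in>{1..n}. \<alpha> j) / (\<Prod>j\<in>{1..n}. fact (\<alpha> j))
      * (\<Sum>k\<in>{1..n}. gsc n r L i \<alpha> k * (\<Sum>j\<in>{1..m}. w j * y k j)) * (\<Prod>j\<in>{1..n}. x j ^ \<alpha> j)"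
    for \<alpha> :: "nat \<Rightarrow> nat"
  have T: "T \<alpha> = (\<Prod>j\<in>{1..n}. (- x j) ^ \<alpha> j / fact (\<alpha> j)) *
      (\<Sum>j\<in>{1..m}. w j * nest (y i) (word (Suc n) \<alpha>) j)" for \<alpha>
  proof -
    have "(\<Prod>j\<in>{1..n}. (- x j) ^ \<alpha> j / fact (\<alpha> j)) =
        (-1) ^ (\<Sum>j\<in>{1..n}. \<alpha> j) * (\<Prod>j\<in>{1..n}. x j ^ \<alpha> j) / (\<Prod>j\<in>{1..n}. fact (\<alpha> j))"
      unfolding power_sum prod_dividef prod.distrib[symmetric]
      by (simp add: power_minus[of "x _"])
    then show ?thesis
      unfolding T_def gsc_pairing[OF i] by simp
  qed
  have "coadj w (y i) x = (\<Sum>\<alpha>\<in>box (Suc n). T \<alpha>)"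
  proof -
    have o: "(\<lambda>k. if k < Suc n then 0 else x k) = origin"
      using x by (auto simp: pts_def origin_def fun_eq_iff)
    show ?thesis
      using coadj_expansion[OF x y_pts le_refl, of w i] coadj_origin[OF nest_pts[OF y_pts]]
      unfolding o T by (simp add: atLeastLessThanSuc_atLeastAtMost)
  qed
  also have "\<dots> = infsum T (box (Suc n))"
    using finite_box by simp
  also have "\<dots> = infsum T (multi_idx n)"
  proof (rule infsum_cong_neutral)
    fix \<alpha> assume "\<alpha> \<in> multi_idx n - box (Suc n)"
    then obtain j where j: "j \<in> {1..n}" "s \<le> \<alpha> j"
      by (force simp: multi_idx_def box_def)
    then have "s \<le> (\<Sum>j\<in>{1..n}. \<alpha> j)"
      using member_le_sum[of j "{1..n}" \<alpha>] by simp
    then have "s \<le> length (word (Suc n) \<alpha>)"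
      unfolding length_word by (simp add: atLeastLessThanSuc_atLeastAtMost)
    then have "nest (y i) (word (Suc n) \<alpha>) = origin"
      using nest_nilpotent[OF y_pts] set_word[of \<alpha>] by simp
    then show "T \<alpha> = 0" by (simp add: T origin_def)
  next
    fix \<alpha> assume "\<alpha> \<in> box (Suc n) - multi_idx n"
    then have False by (auto simp: multi_idx_def box_def)
    then show "T \<alpha> = 0" ..
  qed simp
  also have "\<dots> = ext_poly n r L (\<lambda>k. \<Sum>j\<in>{1..m}. w j * y k j) i x"
    unfolding ext_poly_def T_def ..
  finally show ?thesis .
qed

end

subsection \<open>Stratified groups\<close>

text \<open>Gaussian elimination, by induction on the equations: a nonzero coefficient in equation j
  eliminates one unknown p and leaves one equation and one unknown less.\<close>

lemma homogeneous_system_solvable: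
  fixes c :: "'a \<Rightarrow> 'b \<Rightarrow> real"
  assumes "finite J" "finite I" "card J < card I"
  shows "\<exists>d. (\<exists>i\<in>I. d i \<noteq> 0) \<and> (\<forall>j\<in>J. (\<Sum>i\<in>I. d i * c i j) = 0)"
  using assms
proof (induction J arbitrary: I c rule: finite_induct)
  case empty
  then obtain i where "i \<in> I" by fastforce
  then show ?case by (intro exI[of _ "\<lambda>_. 1"]) auto
next
  case (insert j J)
  show ?case
  proof (cases "\<forall>i\<in>I. c i j = 0")
    case True
    obtain d where "\<exists>i\<in>I. d i \<noteq> 0" "\<forall>j\<in>J. (\<Sum>i\<in>I. d i * c i j) = 0"
      using insert.IH[of I c] insert.prems insert.hyps by auto
    then show ?thesis using True by (intro exI[of _ d]) auto
  next
    case False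
    then obtain p where p: "p \<in> I" "c p j \<noteq> 0" by blast
    define I' where "I' = I - {p}"
    define c' where "c' i k = c i k - c i j / c p j * c p k" for i k
    have "card J < card I'"
      using insert.prems insert.hyps p by (simp add: I'_def)
    then obtain d where d: "\<exists>i\<in>I'. d i \<noteq> 0" "\<forall>k\<in>J. (\<Sum>i\<in>I'. d i * c' i k) = 0"
      using insert.IH[of I' c'] insert.prems by (auto simp: I'_def)
    \<comment> \<open>The value at p is the one that solves equation j for the eliminated
      unknown.\<close>
    define d' where "d' i = (if i = p then - (\<Sum>i\<in>I'. d i * c i j) / c p j else d i)" for i
    have eq: "(\<Sum>i\<in>I. d' i * c i k) = (\<Sum>i\<in>I'. d i * c' i k)" for k
    proof -
      have "(\<Sum>i\<in>I. d' i * c i k) = d' p * c p k + (\<Sum>i\<in>I'. d' i * c i k)"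
        unfolding I'_def using insert.prems p by (simp add: sum.remove)
      also have "(\<Sum>i\<in>I'. d' i * c i k) = (\<Sum>i\<in>I'. d i * c i k)"
        by (rule sum.cong) (auto simp: d'_def I'_def)
      also have "d' p * c p k = (\<Sum>i\<in>I'. - (d i * (c i j / c p j * c p k)))"
        by (simp add: d'_def sum_distrib_right sum_divide_distrib sum_negf mult.assoc)
      finally show ?thesis
        by (simp add: c'_def right_diff_distrib sum.distrib[symmetric])
    qed
    have "(\<Sum>i\<in>I'. d i * c' i j) = 0"
      using p by (simp add: c'_def)
    then have "\<forall>k\<in>insert j J. (\<Sum>i\<in>I. d' i * c i k) = 0"
      using d(2) eq by simp
    moreover have "\<exists>i\<in>I. d' i \<noteq> 0"
      using d(1) by (auto simp: I'_def d'_def)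
    ultimately show ?thesis by blast
  qed
qed

text \<open>\<open>lin_span\<close> sums over a set of vectors, so repeated values of f have to be
  merged: the coefficients sit on a subset of A on which f is injective and are 0 elsewhere.\<close>

lemma lin_span_image:
  assumes "x \<in> lin_span d (f ` A)" "finite A"
  shows "\<exists>c. x = (\<lambda>i. \<Sum>a\<in>A. c a * f a i)"
proof -
  obtain B c where B: "B \<subseteq> f ` A" "x = (\<lambda>i. \<Sum>b\<in>B. c b * b i)"
    using assms(1) by (auto simp: lin_span_def)
  obtain A' where A': "A' \<subseteq> A" "inj_on f A'" "B = f ` A'"
    using B(1) by (meson subset_image_inj)
  have "x = (\<lambda>i. \<Sum>a\<in>A. (if a \<in> A' then c (f a) else 0) * f a i)"
  proof
    fix i
    have "x i = (\<Sum>a\<in>A'. c (f a) * f a i)"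
      unfolding B(2) A'(3) using A'(2) by (simp add: sum.reindex)
    also have "\<dots> = (\<Sum>a\<in>A. (if a \<in> A' then c (f a) else 0) * f a i)"
      by (rule sum.mono_neutral_cong_left) (use A' assms(2) in auto)
    finally show "x i = (\<Sum>a\<in>A. (if a \<in> A' then c (f a) else 0) * f a i)" .
  qed
  then show ?thesis by (rule exI[where x = "\<lambda>a. if a \<in> A' then c (f a) else 0"])
qed

lemma lin_span_superset: "z \<in> A \<Longrightarrow> z \<in> pts d \<Longrightarrow> z \<in> lin_span d A"
proof -
  assume z: "z \<in> A" "z \<in> pts d"
  then have "\<exists>B c. finite B \<and> B \<subseteq> A \<and> z = (\<lambda>i. \<Sum>b\<in>B. c b * b i)"
    by (intro exI[of _ "{z}"] exI[of _ "\<lambda>_. 1"]) simp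
  then show ?thesis using z(2) by (simp add: lin_span_def)
qed

lemma lsubspace_lincomb:
  assumes "lsubspace d V" "x \<in> V" "y \<in> V"
  shows "(\<lambda>i. a * x i + b * y i) \<in> V"
proof -
  have "(\<lambda>i. a * x i) \<in> V" "(\<lambda>i. b * y i) \<in> V"
    using assms unfolding lsubspace_def by blast+
  then show ?thesis
    using assms(1) unfolding lsubspace_def by fastforce
qed

lemma lsubspace_sum:
  assumes V: "lsubspace d V" and "finite A" "\<And>a. a \<in> A \<Longrightarrow> x a \<in> V"
  shows "(\<lambda>i. \<Sum>a\<in>A. c a * x a i) \<in> V"
  using assms(2,3)
proof (induction A rule: finite_induct)
  case empty
  then show ?case using V by (simp add: lsubspace_def origin_def)
next
  case (insert a A)
  then have "(\<lambda>i. c a * x a i + 1 * (\<Sum>a\<in>A. c a * x a i)) \<in> V"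
    by (intro lsubspace_lincomb[OF V]) auto
  then show ?case using insert by simp
qed

lemma lsubspace_pts: "lsubspace d (pts d)"
  by (auto simp: lsubspace_def pts_def origin_def)

context smooth_group
begin

lemma br_origin_right: "w \<in> pts d \<Longrightarrow> br w origin = origin"
  using br_add_right[OF origin_pts origin_pts, of w 0 0] by (simp add: origin_def)

lemma br_sum_right:
  assumes w: "w \<in> pts d" and "finite A" "\<And>a. a \<in> A \<Longrightarrow> x a \<in> pts d"
  shows "br w (\<lambda>i. \<Sum>a\<in>A. c a * x a i) = (\<lambda>i. \<Sum>a\<in>A. c a * br w (x a) i)"
  using assms(2,3)
proof (induction A rule: finite_induct)
  case empty
  then show ?case using br_origin_right[OF w] by (simp add: origin_def)
next
  case (insert a A)
  have p: "(\<lambda>i. \<Sum>a\<in>A. c a * x a i) \<in> pts d"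
    using insert by (intro lsubspace_sum[OF lsubspace_pts]) auto
  have "br w (\<lambda>i. c a * x a i + 1 * (\<Sum>a\<in>A. c a * x a i)) =
      (\<lambda>i. c a * br w (x a) i + 1 * br w (\<lambda>i. \<Sum>a\<in>A. c a * x a i) i)"
    by (rule br_add_right) (use p w insert.prems in auto)
  then show ?case using insert by simp
qed

lemma br_sum_left:
  assumes w: "w \<in> pts d" and A: "finite A" "\<And>a. a \<in> A \<Longrightarrow> x a \<in> pts d"
  shows "br (\<lambda>i. \<Sum>a\<in>A. c a * x a i) w = (\<lambda>i. \<Sum>a\<in>A. c a * br (x a) w i)"
proof -
  have p: "(\<lambda>i. \<Sum>a\<in>A. c a * x a i) \<in> pts d"
    using A by (intro lsubspace_sum[OF lsubspace_pts]) auto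
  have "br (\<lambda>i. \<Sum>a\<in>A. c a * x a i) w = (\<lambda>i. - (\<Sum>a\<in>A. c a * br w (x a) i))"
    unfolding br_antisym[OF p w] using br_sum_right[OF assms] by simp
  also have "\<dots> = (\<lambda>i. \<Sum>a\<in>A. c a * br (x a) w i)"
  proof
    fix i
    show "- (\<Sum>a\<in>A. c a * br w (x a) i) = (\<Sum>a\<in>A. c a * br (x a) w i)"
      unfolding sum_negf[symmetric]
      by (rule sum.cong[OF refl]) (use br_antisym[OF A(2) w] in simp)
  qed
  finally show ?thesis .
qed

end

locale strat_group = smooth_group d mul for d mul +
  fixes r s :: nat and V :: "nat \<Rightarrow> pt set"
  assumes strat: "stratified d mul r s V" and s_pos: "1 \<le> s"
begin

section \<open>The filtration induced by the layers\<close>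

lemma layer_subspace: "k \<in> {1..s} \<Longrightarrow> lsubspace d (V k)"
  and layers_span: "x \<in> pts d \<Longrightarrow> \<exists>w. (\<forall>k\<in>{1..s}. w k \<in> V k) \<and> x = (\<lambda>i. \<Sum>k\<in>{1..s}. w k i)"
  and layers_direct: "(\<And>k. k \<in> {1..s} \<Longrightarrow> w k \<in> V k) \<Longrightarrow> (\<lambda>i. \<Sum>k\<in>{1..s}. w k i) = origin \<Longrightarrow>
    k \<in> {1..s} \<Longrightarrow> w k = origin"
  and layer_Suc: "k \<in> {1..<s} \<Longrightarrow> lin_span d {br v w | v w. v \<in> V 1 \<and> w \<in> V k} = V (Suc k)"
  and last_layer: "v \<in> V 1 \<Longrightarrow> u \<in> V s \<Longrightarrow> br v u = origin"
  and first_layer_dim: "has_dim d (V 1) r"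
  using strat unfolding stratified_def by blast+

lemma layer_pts: "k \<in> {1..s} \<Longrightarrow> x \<in> V k \<Longrightarrow> x \<in> pts d"
  using layer_subspace unfolding lsubspace_def by blast

lemma layer_origin: "k \<in> {1..s} \<Longrightarrow> origin \<in> V k"
  using layer_subspace unfolding lsubspace_def by blast

text \<open>The sum of the layers from k on, a filtration that is everything for k = 1 and trivial
  for k > s. It is described by components so that directness of the decomposition can be applied to
  its elements.\<close>

definition W :: "nat \<Rightarrow> pt set" where
  "W k = {x. \<exists>w. (\<forall>i\<in>{1..s}. w i \<in> V i \<and> (i < k \<longrightarrow> w i = origin)) \<and> x = (\<lambda>j. \<Sum>i\<in>{1..s}. w i j)}"

lemma W_pts: "x \<in> W k \<Longrightarrow> x \<in> pts d"
proof -
  assume "x \<in> W k"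
  then obtain w where w: "\<forall>i\<in>{1..s}. w i \<in> V i" "x = (\<lambda>j. \<Sum>i\<in>{1..s}. w i j)"
    unfolding W_def by blast
  have "(\<lambda>j. \<Sum>i\<in>{1..s}. 1 * w i j) \<in> pts d"
    by (rule lsubspace_sum[OF lsubspace_pts]) (use w layer_pts in auto)
  then show ?thesis using w by simp
qed

lemma W_1: "W 1 = pts d"
proof
  show "pts d \<subseteq> W 1"
    using layers_span unfolding W_def by fastforce
qed (use W_pts in blast)

lemma W_above: "s < k \<Longrightarrow> x \<in> W k \<Longrightarrow> x = origin"
proof -
  assume k: "s < k" and "x \<in> W k"
  then obtain w where w: "\<forall>i\<in>{1..s}. w i \<in> V i \<and> (i < k \<longrightarrow> w i = origin)" "x = (\<lambda>j. \<Sum>i\<in>{1..s}. w i j)"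
    unfolding W_def by blast
  have "w i j = 0" if "i \<in> {1..s}" for i j
    using w(1) k that by (auto simp: origin_def)
  then show ?thesis using w(2) by (simp add: origin_def)
qed

lemma W_mono: "k \<le> l \<Longrightarrow> W l \<subseteq> W k"
proof
  fix x assume kl: "k \<le> l" and "x \<in> W l"
  then obtain w where "\<forall>i\<in>{1..s}. w i \<in> V i \<and> (i < l \<longrightarrow> w i = origin)" "x = (\<lambda>j. \<Sum>i\<in>{1..s}. w i j)"
    unfolding W_def by blast
  then show "x \<in> W k"
    unfolding W_def using kl by (intro CollectI exI[of _ w]) auto
qed

lemma origin_W: "origin \<in> W k"
  unfolding W_def using layer_origin
  by (auto intro!: exI[of _ "\<lambda>_. origin"] simp: origin_def)

lemma lsubspace_W: "lsubspace d (W k)"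
proof -
  have comb: "(\<lambda>i. a * x i + b * y i) \<in> W k" if x: "x \<in> W k" and y: "y \<in> W k" for a b x y
  proof -
    obtain w where w: "\<forall>i\<in>{1..s}. w i \<in> V i \<and> (i < k \<longrightarrow> w i = origin)" "x = (\<lambda>j. \<Sum>i\<in>{1..s}. w i j)"
      using x unfolding W_def by blast
    obtain z where z: "\<forall>i\<in>{1..s}. z i \<in> V i \<and> (i < k \<longrightarrow> z i = origin)" "y = (\<lambda>j. \<Sum>i\<in>{1..s}. z i j)"
      using y unfolding W_def by blast
    have "(\<lambda>j. a * w i j + b * z i j) \<in> V i \<and> (i < k \<longrightarrow> (\<lambda>j. a * w i j + b * z i j) = origin)"
      if i: "i \<in> {1..s}" for i
      using lsubspace_lincomb[OF layer_subspace[OF i]] w(1) z(1) i by (auto simp: origin_def)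
    moreover have "(\<lambda>i. a * x i + b * y i) = (\<lambda>j. \<Sum>i\<in>{1..s}. a * w i j + b * z i j)"
      by (simp add: w(2) z(2) sum.distrib sum_distrib_left)
    ultimately show ?thesis
      unfolding W_def by (intro CollectI exI[of _ "\<lambda>i j. a * w i j + b * z i j"]) blast
  qed
  show ?thesis
    unfolding lsubspace_def
  proof (intro conjI ballI allI)
    show "W k \<subseteq> pts d" using W_pts by blast
    show "origin \<in> W k" by (rule origin_W)
    show "(\<lambda>i. x i + y i) \<in> W k" if "x \<in> W k" "y \<in> W k" for x y
      using comb[OF that, of 1 1] by simp
    show "(\<lambda>i. a * x i) \<in> W k" if "x \<in> W k" for a x
      using comb[OF that that, of a 0] by simp
  qed
qed

lemma layer_W:
  assumes "k \<in> {1..s}" "x \<in> V k" "l \<le> k"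
  shows "x \<in> W l"
proof -
  have "x = (\<lambda>j. \<Sum>i\<in>{1..s}. (if i = k then x else origin) j)"
  proof
    fix j
    have "(\<Sum>i\<in>{1..s}. (if i = k then x else origin) j) = (\<Sum>i\<in>{1..s}. if i = k then x j else 0)"
      by (rule sum.cong) (auto simp: origin_def)
    then show "x j = (\<Sum>i\<in>{1..s}. (if i = k then x else origin) j)"
      using assms(1) by simp
  qed
  then show ?thesis
    unfolding W_def using assms layer_origin
    by (intro CollectI exI[of _ "\<lambda>i. if i = k then x else origin"]) auto
qed

text \<open>Componentwise: layers below k contribute nothing, the others are raised by one, and the
  last one is annihilated.\<close>

lemma br_first_layer_W:
  assumes v: "v \<in> V 1" and u: "u \<in> W k"
  shows "br v u \<in> W (Suc k)"
proof -
  obtain w where w: "\<And>i. i \<in> {1..s} \<Longrightarrow> w i \<in> V i" "\<And>i. i \<in> {1..s} \<Longrightarrow> i < k \<Longrightarrow> w i = origin"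
    "u = (\<lambda>j. \<Sum>i\<in>{1..s}. w i j)"
    using u unfolding W_def by blast
  have vp: "v \<in> pts d" using layer_pts[OF _ v] s_pos by simp
  have "br v (w i) \<in> W (Suc k)" if i: "i \<in> {1..s}" for i
  proof -
    consider "i < k" | "k \<le> i" "i < s" | "i = s" using i by fastforce
    then show ?thesis
    proof cases
      case 1
      then show ?thesis using w(2)[OF i] br_origin_right[OF vp] origin_W by simp
    next
      case 2
      have mem: "br v (w i) \<in> {br v w | v w. v \<in> V 1 \<and> w \<in> V i}"
        using v w(1)[OF i] by blast
      have "i \<in> {1..<s}" using i 2 by simp
      from lin_span_superset[OF mem br_pts] have "br v (w i) \<in> V (Suc i)"
        unfolding layer_Suc[OF \<open>i \<in> {1..<s}\<close>] .
      then show ?thesis using layer_W[of "Suc i"] 2 by simp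
    next
      case 3
      then show ?thesis using last_layer[OF v] w(1)[OF i] origin_W by simp
    qed
  qed
  then have "(\<lambda>j. \<Sum>i\<in>{1..s}. 1 * br v (w i) j) \<in> W (Suc k)"
    by (intro lsubspace_sum[OF lsubspace_W]) auto
  moreover have "br v u = (\<lambda>j. \<Sum>i\<in>{1..s}. 1 * br v (w i) j)"
    using br_sum_right[OF vp, of "{1..s}" w "\<lambda>_. 1"] w(1,3) layer_pts by simp
  ultimately show ?thesis by simp
qed

text \<open>An element of layer i + 1 is a combination of brackets [a, e] with a in layer 1 and e in
  layer i, and the Jacobi identity reduces bracketing with [a, e] to successive brackets with a and
  e.\<close>

lemma br_layer_W:
  assumes "i \<in> {1..s}" "v \<in> V i" "u \<in> W k"
  shows "br v u \<in> W (Suc k)"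
  using assms
proof (induction i arbitrary: v u k)
  case (Suc i)
  show ?case
  proof (cases "i = 0")
    case False
    then have i: "i \<in> {1..s}" "i \<in> {1..<s}" using Suc.prems by auto
    obtain B c where B: "finite B" "B \<subseteq> {br v w | v w. v \<in> V 1 \<and> w \<in> V i}"
      "v = (\<lambda>j. \<Sum>b\<in>B. c b * b j)"
      using layer_Suc[OF i(2)] Suc.prems(2) unfolding lin_span_def by blast
    have up: "u \<in> pts d" using W_pts Suc.prems by blast
    have "b \<in> pts d \<and> br b u \<in> W (Suc k)" if b: "b \<in> B" for b
    proof -
      obtain a e where ae: "a \<in> V 1" "e \<in> V i" "b = br a e" using B(2) b by blast
      have p: "a \<in> pts d" "e \<in> pts d" using ae layer_pts[of 1] layer_pts[OF i(1)] s_pos by auto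
      \<comment> \<open>Both double brackets even lie in \<open>W (Suc (Suc k))\<close>; the weaker
        membership is what the induction claims.\<close>
      have "br a (br e u) \<in> W (Suc k)" "br e (br a u) \<in> W (Suc k)"
        using br_first_layer_W[OF ae(1)] Suc.IH[OF i(1) ae(2)] Suc.prems(3) W_mono[of "Suc k" "Suc (Suc k)"]
        by (meson le_SucI order_refl subsetD)+
      then have "(\<lambda>j. 1 * br a (br e u) j + (-1) * br e (br a u) j) \<in> W (Suc k)"
        by (rule lsubspace_lincomb[OF lsubspace_W])
      then show ?thesis
        using br_jacobi[OF p up] by (simp add: ae(3))
    qed
    then have "(\<lambda>j. \<Sum>b\<in>B. c b * br b u j) \<in> W (Suc k)" "\<And>b. b \<in> B \<Longrightarrow> b \<in> pts d"
      using lsubspace_sum[OF lsubspace_W B(1), of "\<lambda>b. br b u" "Suc k" c] by auto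
    then show ?thesis
      unfolding B(3) using br_sum_left[OF up B(1), of "\<lambda>b. b" c] by simp
  qed (use br_first_layer_W Suc.prems in simp)
qed simp

lemma br_W:
  assumes v: "v \<in> pts d" and u: "u \<in> W k"
  shows "br v u \<in> W (Suc k)" "br u v \<in> W (Suc k)"
proof -
  obtain w where w: "\<And>i. i \<in> {1..s} \<Longrightarrow> w i \<in> V i" "v = (\<lambda>j. \<Sum>i\<in>{1..s}. w i j)"
    using layers_span[OF v] by blast
  have up: "u \<in> pts d" using W_pts u by blast
  have "(\<lambda>j. \<Sum>i\<in>{1..s}. 1 * br (w i) u j) \<in> W (Suc k)"
    using br_layer_W w(1) u by (intro lsubspace_sum[OF lsubspace_W]) auto
  moreover have "br v u = (\<lambda>j. \<Sum>i\<in>{1..s}. 1 * br (w i) u j)"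
    using br_sum_left[OF up, of "{1..s}" w "\<lambda>_. 1"] w layer_pts by simp
  ultimately show vu: "br v u \<in> W (Suc k)" by simp
  have "(\<lambda>j. (-1) * br v u j + 0 * br v u j) \<in> W (Suc k)"
    by (rule lsubspace_lincomb[OF lsubspace_W vu vu])
  then show "br u v \<in> W (Suc k)"
    using br_antisym[OF up v] by simp
qed

lemma nested_br_W:
  assumes "\<And>j. j \<in> set js \<Longrightarrow> z j \<in> pts d" "u \<in> W k"
  shows "foldl (\<lambda>U j. br U (z j)) u js \<in> W (k + length js)"
  using assms
proof (induction js arbitrary: u k)
  case (Cons j js)
  then show ?case using br_W(2)[of "z j" u k] Cons.IH[of "br u (z j)" "Suc k"] by simp
qed simp

lemma nested_br_nilpotent:
  assumes "\<And>j. j \<in> set js \<Longrightarrow> z j \<in> pts d" "u \<in> pts d" "s \<le> length js"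
  shows "foldl (\<lambda>U j. br U (z j)) u js = origin"
  using nested_br_W[of js z u 1] W_above[of "1 + length js"] assms W_1 by simp

text \<open>x has one decomposition concentrated in layer 1 and one avoiding layer 1; their
  difference decomposes 0, so directness gives x = 0.\<close>

lemma first_layer_W_2: "x \<in> V 1 \<Longrightarrow> x \<in> W 2 \<Longrightarrow> x = origin"
proof -
  assume x: "x \<in> V 1" "x \<in> W 2"
  obtain w where w: "\<And>i. i \<in> {1..s} \<Longrightarrow> w i \<in> V i" "\<And>i. i \<in> {1..s} \<Longrightarrow> i < 2 \<Longrightarrow> w i = origin"
    "x = (\<lambda>j. \<Sum>i\<in>{1..s}. w i j)"
    using x(2) unfolding W_def by blast
  have one: "1 \<in> {1..s}" using s_pos by simp
  define z where "z i = (if i = 1 then (\<lambda>j. - x j) else w i)" for i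
  have "(\<lambda>j. - x j) \<in> V 1"
    using lsubspace_lincomb[OF layer_subspace[OF one] x(1) x(1), of "-1" 0] by simp
  then have zV: "z i \<in> V i" if "i \<in> {1..s}" for i
    using w(1)[OF that] by (simp add: z_def)
  have "(\<Sum>i\<in>{1..s}. z i j) = 0" for j
  proof -
    have "x j = w 1 j + (\<Sum>i\<in>{1..s} - {1}. w i j)"
      unfolding w(3) by (rule sum.remove[OF _ one]) simp
    moreover have "(\<Sum>i\<in>{1..s}. z i j) = z 1 j + (\<Sum>i\<in>{1..s} - {1}. z i j)"
      by (rule sum.remove[OF _ one]) simp
    moreover have "(\<Sum>i\<in>{1..s} - {1}. z i j) = (\<Sum>i\<in>{1..s} - {1}. w i j)"
      by (rule sum.cong) (auto simp: z_def)
    moreover have "w 1 j = 0" using w(2)[OF one] by (simp add: origin_def)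
    ultimately show ?thesis by (simp add: z_def)
  qed
  then have "z 1 = origin"
    using layers_direct[OF zV _ one] by (simp add: origin_def)
  then show "x = origin" by (simp add: z_def origin_def fun_eq_iff)
qed

text \<open>A spanning family splits into members of the first layer and members of W 2; modulo W 2
  only the former count, and at least r of them are needed to generate the first layer.\<close>

lemma first_layer_selected:
  fixes sel :: "nat \<Rightarrow> nat"
  assumes sel: "inj_on sel {1..m'}"
    and low: "\<And>i. i \<in> {1..r} \<Longrightarrow> z i \<in> V 1" and high: "\<And>j. j \<in> {1..m'} \<Longrightarrow> r < sel j \<Longrightarrow> z (sel j) \<in> W 2"
    and pos: "\<And>j. j \<in> {1..m'} \<Longrightarrow> 1 \<le> sel j"
    and span: "lin_span d ((\<lambda>j. z (sel j)) ` {1..m'}) = pts d"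
  shows "{1..r} \<subseteq> sel ` {1..m'}"
proof (rule ccontr)
  assume "\<not> {1..r} \<subseteq> sel ` {1..m'}"
  then obtain i0 where i0: "i0 \<in> {1..r}" "i0 \<notin> sel ` {1..m'}" by blast
  have one: "1 \<in> {1..s}" using s_pos by simp
  define J where "J = {j \<in> {1..m'}. sel j \<le> r}"
  have J: "J \<subseteq> {1..m'}" unfolding J_def by blast
  have fin: "finite J" by (rule finite_subset[OF J]) simp
  have "sel ` J \<subseteq> {1..r} - {i0}"
    using pos i0(2) by (auto simp: J_def)
  moreover have "inj_on sel J" using sel J inj_on_subset by blast
  ultimately have "card J \<le> card ({1..r} - {i0})"
    by (metis card_image card_mono finite_Diff finite_atLeastAtMost)
  then have card: "card J < card {1..r}"
    using i0(1) by (auto simp: card_Diff_singleton)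
  \<comment> \<open>The part of x carried by the indices above r lies in \<open>W 2\<close>; being
    the difference of two first-layer vectors it also lies in the first layer, hence it is
    0.\<close>
  have rep: "\<exists>c. x = (\<lambda>i. \<Sum>j\<in>J. c j * z (sel j) i)" if x: "x \<in> V 1" for x
  proof -
    obtain c where c: "x = (\<lambda>i. \<Sum>j\<in>{1..m'}. c j * z (sel j) i)"
      using lin_span_image[of x d "\<lambda>j. z (sel j)" "{1..m'}"] layer_pts[OF one x] span by auto
    let ?a = "\<lambda>i. \<Sum>j\<in>J. c j * z (sel j) i" and ?b = "\<lambda>i. \<Sum>j\<in>{1..m'} - J. c j * z (sel j) i"
    have a: "?a \<in> V 1"
      by (rule lsubspace_sum[OF layer_subspace[OF one] fin]) (use low pos in \<open>auto simp: J_def\<close>)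
    have b: "?b \<in> W 2"
      by (rule lsubspace_sum[OF lsubspace_W]) (use high in \<open>auto simp: J_def\<close>)
    have eq: "x i = ?a i + ?b i" for i
      unfolding c using J sum.subset_diff[OF J, of "\<lambda>j. c j * z (sel j) i"] by simp
    have "?b = (\<lambda>i. 1 * x i + (-1) * ?a i)" using eq by (simp add: fun_eq_iff)
    then have "?b \<in> V 1" using lsubspace_lincomb[OF layer_subspace[OF one] x a, of 1 "-1"] by simp
    then have "?b = origin" using first_layer_W_2 b by blast
    then have "x = ?a" using eq by (simp add: fun_eq_iff origin_def)
    then show ?thesis by (rule exI[of _ c])
  qed
  obtain u where u: "\<And>j. j \<in> {1..r} \<Longrightarrow> u j \<in> V 1" "lindep_free u {1..r}"
    using first_layer_dim unfolding has_dim_def by blast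
  have "\<forall>i\<in>{1..r}. \<exists>c. u i = (\<lambda>k. \<Sum>j\<in>J. c j * z (sel j) k)"
    using rep u(1) by blast
  then obtain c where c: "\<And>i. i \<in> {1..r} \<Longrightarrow> u i = (\<lambda>k. \<Sum>j\<in>J. c i j * z (sel j) k)"
    by metis
  \<comment> \<open>Expressing r independent vectors through fewer than r others gives a homogeneous
    system with more unknowns than equations; its nontrivial solution is a forbidden linear
    relation.\<close>
  obtain e where e: "\<exists>i\<in>{1..r}. e i \<noteq> 0" "\<forall>j\<in>J. (\<Sum>i\<in>{1..r}. e i * c i j) = 0"
    using homogeneous_system_solvable[OF fin _ card, of c] by auto
  have "(\<Sum>i\<in>{1..r}. e i * u i k) = 0" for k
  proof -
    have "(\<Sum>i\<in>{1..r}. e i * u i k) = (\<Sum>i\<in>{1..r}. \<Sum>j\<in>J. e i * (c i j * z (sel j) k))"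
      unfolding sum_distrib_left[symmetric] by (rule sum.cong) (simp_all add: c)
    also have "\<dots> = (\<Sum>j\<in>J. (\<Sum>i\<in>{1..r}. e i * c i j) * z (sel j) k)"
      by (subst sum.swap) (simp add: sum_distrib_right mult.assoc)
    also have "\<dots> = 0" using e(2) by simp
    finally show ?thesis .
  qed
  then have "\<forall>i\<in>{1..r}. e i = 0"
    using u(2) unfolding lindep_free_def by blast
  then show False using e(1) by blast
qed

end

text \<open>If j = sel i, then i \<le> sel i = j by monotonicity, and i < j would give sel i = i < j
  by induction; so i = j.\<close>

lemma strict_mono_selection_id:
  fixes sel :: "nat \<Rightarrow> nat"
  assumes mono: "strict_mono_on {1..m} sel" and range: "{1..r} \<subseteq> sel ` {1..m}"
    and pos: "\<And>j. j \<in> {1..m} \<Longrightarrow> 1 \<le> sel j" and j: "j \<in> {1..r}"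
  shows "sel j = j \<and> j \<le> m"
  using j
proof (induction j rule: less_induct)
  case (less j)
  obtain i where i: "i \<in> {1..m}" "j = sel i" using range less.prems by blast
  have ge: "k \<le> sel k" if "k \<in> {1..m}" for k
    using that
  proof (induction k)
    case (Suc k)
    show ?case
    proof (cases "k = 0")
      case False
      then have "k \<le> sel k" "sel k < sel (Suc k)"
        using Suc strict_mono_onD[OF mono, of k "Suc k"] by auto
      then show ?thesis by simp
    qed (use pos[OF Suc.prems] in simp)
  qed simp
  have "\<not> i < j"
    using less.IH[of i] less.prems i by auto
  then have "i = j" using ge[OF i(1)] i(2) by simp
  then show ?case using i by simp
qed

subsection \<open>Dual curves\<close>

text \<open>The adjoint equation is what makes derivatives of fields combine into brackets: moving
  \<gamma> differentiates \<open>linv u\<close> along the fields of \<open>z j\<close>, and moving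
  \<xi> contributes minus the derivative of those fields along \<open>linv u\<close>.\<close>

lemma (in smooth_group) dual_pairing_DERIV:
  assumes \<gamma>: "\<And>\<tau>. \<tau> \<in> {0..1} \<Longrightarrow> \<gamma> \<tau> \<in> pts d" and t: "t \<in> {0..1}"
    and D\<gamma>: "\<And>i. i \<in> {1..d} \<Longrightarrow> ((\<lambda>\<tau>. \<gamma> \<tau> i) has_real_derivative
      (\<Sum>j\<in>{1..r}. h j * linv (z j) (\<gamma> t) i)) (at t within {0..1})"
    and D\<xi>: "\<And>k. k \<in> {1..d} \<Longrightarrow> ((\<lambda>\<tau>. \<xi> \<tau> k) has_real_derivative
      - (\<Sum>j\<in>{1..r}. \<Sum>i\<in>{1..d}. partial k (\<lambda>y. linv (z j) y i) (\<gamma> t) * h j * \<xi> t i))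
      (at t within {0..1})"
  shows "((\<lambda>\<tau>. \<Sum>k\<in>{1..d}. \<xi> \<tau> k * linv u (\<gamma> \<tau>) k) has_real_derivative
    (\<Sum>j\<in>{1..r}. h j * (\<Sum>k\<in>{1..d}. \<xi> t k * linv (br (z j) u) (\<gamma> t) k))) (at t within {0..1})"
proof -
  let ?p = "\<gamma> t"
  let ?P = "\<lambda>k j i. partial k (\<lambda>y. linv (z j) y i) ?p"
  let ?Q = "\<lambda>i k. partial i (\<lambda>y. linv u y k) ?p"
  let ?Z = "\<lambda>j i. linv (z j) ?p i" and ?U = "\<lambda>k. linv u ?p k" and ?\<xi> = "\<xi> t"
  have p: "?p \<in> pts d" by (rule \<gamma>[OF t])
  have "((\<lambda>\<tau>. linv u (\<gamma> \<tau>) k) has_real_derivative (\<Sum>i\<in>{1..d}. ?Q i k * (\<Sum>j\<in>{1..r}. h j * ?Z j i)))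
      (at t within {0..1})" if "k \<in> {1..d}" for k
    by (rule smooth_fun_chain_curve[OF smooth_linv_comp[OF that] \<gamma> t D\<gamma>])
  then have D: "((\<lambda>\<tau>. \<Sum>k\<in>{1..d}. \<xi> \<tau> k * linv u (\<gamma> \<tau>) k) has_real_derivative
      (\<Sum>k\<in>{1..d}. - (\<Sum>j\<in>{1..r}. \<Sum>i\<in>{1..d}. ?P k j i * h j * ?\<xi> i) * ?U k +
        (\<Sum>i\<in>{1..d}. ?Q i k * (\<Sum>j\<in>{1..r}. h j * ?Z j i)) * ?\<xi> k)) (at t within {0..1})"
    by (intro DERIV_sum DERIV_mult D\<xi>)
  \<comment> \<open>\<open>first\<close> collects the terms from the motion of \<xi>,
    \<open>second\<close> those from the motion of \<gamma>; both only exchange sums to bring out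
    the factor \<open>h j\<close>.\<close>
  have first: "(\<Sum>k\<in>{1..d}. (\<Sum>j\<in>{1..r}. \<Sum>i\<in>{1..d}. ?P k j i * h j * ?\<xi> i) * ?U k)
      = (\<Sum>j\<in>{1..r}. h j * (\<Sum>i\<in>{1..d}. ?\<xi> i * (\<Sum>k\<in>{1..d}. ?U k * ?P k j i)))"
  proof -
    have "(\<Sum>k\<in>{1..d}. (\<Sum>j\<in>{1..r}. \<Sum>i\<in>{1..d}. ?P k j i * h j * ?\<xi> i) * ?U k)
        = (\<Sum>j\<in>{1..r}. \<Sum>k\<in>{1..d}. \<Sum>i\<in>{1..d}. h j * (?\<xi> i * (?U k * ?P k j i)))"
      unfolding sum_distrib_right by (subst sum.swap) (simp add: mult_ac)
    also have "\<dots> = (\<Sum>j\<in>{1..r}. \<Sum>i\<in>{1..d}. \<Sum>k\<in>{1..d}. h j * (?\<xi> i * (?U k * ?P k j i)))"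
      by (rule sum.cong[OF refl]) (rule sum.swap)
    finally show ?thesis by (simp only: sum_distrib_left)
  qed
  have second: "(\<Sum>k\<in>{1..d}. (\<Sum>i\<in>{1..d}. ?Q i k * (\<Sum>j\<in>{1..r}. h j * ?Z j i)) * ?\<xi> k)
      = (\<Sum>j\<in>{1..r}. h j * (\<Sum>k\<in>{1..d}. ?\<xi> k * (\<Sum>i\<in>{1..d}. ?Z j i * ?Q i k)))"
  proof -
    have "(\<Sum>k\<in>{1..d}. (\<Sum>i\<in>{1..d}. ?Q i k * (\<Sum>j\<in>{1..r}. h j * ?Z j i)) * ?\<xi> k)
        = (\<Sum>k\<in>{1..d}. \<Sum>j\<in>{1..r}. \<Sum>i\<in>{1..d}. h j * (?\<xi> k * (?Z j i * ?Q i k)))"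
      unfolding sum_distrib_left sum_distrib_right
      by (rule sum.cong[OF refl], subst sum.swap) (simp add: mult_ac)
    also have "\<dots> = (\<Sum>j\<in>{1..r}. \<Sum>k\<in>{1..d}. \<Sum>i\<in>{1..d}. h j * (?\<xi> k * (?Z j i * ?Q i k)))"
      by (rule sum.swap)
    finally show ?thesis by (simp only: sum_distrib_left)
  qed
  have br: "linv (br (z j) u) ?p k = (\<Sum>i\<in>{1..d}. ?Z j i * ?Q i k) - (\<Sum>i\<in>{1..d}. ?U i * ?P i j k)" for j k
    unfolding vf_bracket_linv[OF p, symmetric] vf_bracket_eq_lie_der lie_der_def ..
  have "(\<Sum>k\<in>{1..d}. - (\<Sum>j\<in>{1..r}. \<Sum>i\<in>{1..d}. ?P k j i * h j * ?\<xi> i) * ?U k +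
        (\<Sum>i\<in>{1..d}. ?Q i k * (\<Sum>j\<in>{1..r}. h j * ?Z j i)) * ?\<xi> k)
      = (\<Sum>j\<in>{1..r}. h j * (\<Sum>k\<in>{1..d}. ?\<xi> k * linv (br (z j) u) ?p k))"
    unfolding br right_diff_distrib sum_subtractf sum.distrib mult_minus_left sum_negf first second
    by simp
  then show ?thesis using D by (simp only:)
qed

text \<open>This is the system satisfied by the dual pairing, now for \<open>coadj\<close> along the
  lifted curve: the velocity is a combination of the \<open>Y j\<close>, and each \<open>Y j\<close>
  acts on \<open>coadj\<close> by a bracket.\<close>

lemma (in free_hom) coadj_curve_DERIV:
  assumes \<kappa>: "\<And>\<tau>. \<tau> \<in> {0..1} \<Longrightarrow> \<kappa> \<tau> \<in> pts n" and t: "t \<in> {0..1}"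
    and D\<kappa>: "\<And>i. i \<in> {1..n} \<Longrightarrow> ((\<lambda>\<tau>. \<kappa> \<tau> i) has_real_derivative
      (\<Sum>j\<in>{1..r}. h j * Y j (\<kappa> t) i)) (at t within {0..1})"
  shows "((\<lambda>\<tau>. coadj w u (\<kappa> \<tau>)) has_real_derivative
    (\<Sum>j\<in>{1..r}. h j * coadj w (G.br (y j) u) (\<kappa> t))) (at t within {0..1})"
proof -
  have p: "\<kappa> t \<in> pts n" by (rule \<kappa>[OF t])
  have "coadj w (G.br (y j) u) (\<kappa> t) = (\<Sum>i\<in>{1..n}. Y j (\<kappa> t) i * partial i (coadj w u) (\<kappa> t))"
    if "j \<in> {1..r}" for j
  proof -
    have "j \<in> {1..n}" using that rank_le by simp
    then show ?thesis
      using lie_der_coadj[OF p, of "unit j" w u] hgg_linv[OF _ p] by (simp add: lie_der_def y_def)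
  qed
  then have "(\<Sum>j\<in>{1..r}. h j * coadj w (G.br (y j) u) (\<kappa> t)) =
      (\<Sum>j\<in>{1..r}. \<Sum>i\<in>{1..n}. partial i (coadj w u) (\<kappa> t) * (h j * Y j (\<kappa> t) i))"
    by (intro sum.cong refl) (simp add: sum_distrib_left mult_ac)
  also have "\<dots> = (\<Sum>i\<in>{1..n}. partial i (coadj w u) (\<kappa> t) * (\<Sum>j\<in>{1..r}. h j * Y j (\<kappa> t) i))"
    by (subst sum.swap) (simp add: sum_distrib_left)
  finally show ?thesis
    using smooth_fun_chain_curve[OF smooth_coadj \<kappa> t D\<kappa>, of w u] by simp
qed

theorem theorem5p4:
  fixes m n r s :: nat
    and multG multF :: "pt \<Rightarrow> pt \<Rightarrow> pt"
    and V :: "nat \<Rightarrow> pt set"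
    and L :: "nat \<Rightarrow> nat \<times> nat"
    and \<pi> :: "pt \<Rightarrow> pt"
    and sel :: "nat \<Rightarrow> nat"
    and \<zeta> :: "nat \<Rightarrow> nat \<Rightarrow> real"
    and \<gamma> \<kappa> \<xi> :: "real \<Rightarrow> pt"
    and h :: "nat \<Rightarrow> real \<Rightarrow> real"
    and \<xi>0 :: real
  defines "Y \<equiv> hgg n r L"
    and "X \<equiv> (\<lambda>i. linv_ext m multG (push0 n \<pi> (hgg n r L (sel i))))"
  assumes rs: "2 \<le> r" "2 \<le> s"
    and G: "stratified_group m multG r s V"
    and hall: "hall_basis r s n L"
    and F: "free_group_law n r L multF"
    and hom: "lie_hom_onto n m multF multG \<pi>"
    and layer1: "\<forall>i\<in>{1..r}. push0 n \<pi> (Y i) \<in> V 1"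
    and S: "strict_mono_on {1..m} sel" "sel ` {1..m} \<subseteq> {1..n}"
    and basis: "lindep_free (\<lambda>j. push0 n \<pi> (Y (sel j))) {1..m}"
      "lin_span m ((\<lambda>j. push0 n \<pi> (Y (sel j))) ` {1..m}) = pts m"
    and zeta: "\<forall>i\<in>{1..n}. \<forall>p\<in>pts m.
       linv_ext m multG (push0 n \<pi> (Y i)) p = (\<lambda>k. \<Sum>j\<in>{1..m}. \<zeta> i j * X j p k)"
    and hor: "horizontal m r X \<gamma> h" and g0: "\<gamma> 0 = origin"
    and lift: "ctrl_curve n r Y \<kappa> h" and k0: "\<kappa> 0 = origin"
    and ext: "extremal m r X \<gamma> h \<xi>0 \<xi>"
  shows "\<exists>v :: pt. (\<forall>i\<in>{1..n}. v i = (\<Sum>j\<in>{1..m}. \<zeta> i j * v (sel j))) \<and>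
     (\<forall>t\<in>{0..1}. \<forall>i\<in>{1..m}.
        (\<Sum>k\<in>{1..m}. \<xi> t k * X i (\<gamma> t) k) = ext_poly n r L v (sel i) (\<kappa> t))"
proof -
  interpret G: strat_group m multG r s V
    using G rs by unfold_locales (auto simp: stratified_group_def)
  interpret H: smooth_group_hom n multF m multG \<pi>
    using F hom by unfold_locales (auto simp: free_group_law_def)
  interpret K: free_hom r s n L multF m multG \<pi>
  proof unfold_locales
    \<comment> \<open>Each bracket goes one step down a filtration with s steps, so s brackets
      annihilate every vector.\<close>
    fix u and js :: "nat list" assume "u \<in> pts m" "s \<le> length js"
    then show "foldl (\<lambda>W j. lie_br m multG W (dmap n \<pi> origin (hgg n r L j origin))) u js = origin"
      by (intro G.nested_br_nilpotent) (use H.push_pts in \<open>auto simp: H.push_def\<close>)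
  qed (rule hall F)+
  let ?y = K.y
  have sel_n: "sel j \<in> {1..n}" if "j \<in> {1..m}" for j
    using S(2) that by blast
  have push0: "push0 n \<pi> (Y i) = ?y i" if "i \<in> {1..n}" for i
    using K.push0_eq[OF that] by (simp add: Y_def)
  have X: "X j = G.linv (?y (sel j))" if "j \<in> {1..m}" for j
    using push0[OF sel_n[OF that]] by (simp add: X_def Y_def)
  have rn: "i \<in> {1..n}" if "i \<in> {1..r}" for i
    using that K.rank_le by simp
  have "{1..r} \<subseteq> sel ` {1..m}"
  proof (rule G.first_layer_selected[where z = ?y])
    show "inj_on sel {1..m}" using S(1) strict_mono_on_imp_inj_on by blast
    show "?y i \<in> V 1" if "i \<in> {1..r}" for i
      using layer1 that push0[OF rn[OF that]] by metis
    show "1 \<le> sel j" if "j \<in> {1..m}" for j using sel_n[OF that] by simp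
    \<comment> \<open>Beyond the generators a Hall element is a bracket, and so is its image in the
      Lie algebra of G, which therefore lies one step below \<open>W 1\<close>, the whole
      algebra.\<close>
    show "?y (sel j) \<in> G.W 2" if "j \<in> {1..m}" "r < sel j" for j
    proof -
      have "sel j \<in> {r<..n}" using sel_n[OF that(1)] that(2) by simp
      then have "?y (sel j) = G.br (?y (fst (L (sel j)))) (?y (snd (L (sel j))))"
        by (rule K.y_parents)
      then show ?thesis
        using G.br_W(1)[of "?y (fst (L (sel j)))" "?y (snd (L (sel j)))" 1] G.W_1
        by (simp add: numeral_2_eq_2)
    qed
    have "(\<lambda>j. push0 n \<pi> (Y (sel j))) ` {1..m} = (\<lambda>j. ?y (sel j)) ` {1..m}"
      using push0 sel_n by (intro image_cong) auto
    then show "lin_span m ((\<lambda>j. ?y (sel j)) ` {1..m}) = pts m"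
      using basis(2) by simp
  qed
  \<comment> \<open>The controls multiply X 1, ..., X r on G but Y 1, ..., Y r on F. The
    identification of these indices makes X j the image of Y j, so that the two systems have the
    same form.\<close>
  then have sel_id: "sel j = j" "j \<in> {1..m}" if "j \<in> {1..r}" for j
    using strict_mono_selection_id[OF S(1), of r j] sel_n that by auto
  have Xr: "X j = G.linv (?y j)" if "j \<in> {1..r}" for j
    using X[OF sel_id(2)[OF that]] sel_id(1)[OF that] by simp

  have \<gamma>: "lip_curve m \<gamma>" and \<xi>: "lip_curve m \<xi>" and \<kappa>: "lip_curve n \<kappa>"
    using hor ext lift unfolding horizontal_def ctrl_curve_def extremal_def by blast+
  have \<gamma>_pts: "\<gamma> t \<in> pts m" and \<kappa>_pts: "\<kappa> t \<in> pts n" if "t \<in> {0..1}" for t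
    using that \<gamma> \<kappa> unfolding lip_curve_def by blast+
  define w where "w = \<xi> 0"
  define \<Lambda> where "\<Lambda> u t = (\<Sum>k\<in>{1..m}. \<xi> t k * G.linv u (\<gamma> t) k)" for u t
  define D where "D u t = \<Lambda> u t - H.coadj w u (\<kappa> t)" for u t

  have D_lip: "\<exists>C. C-lipschitz_on {0..1} (D u)" for u
  proof -
    have "\<exists>C. C-lipschitz_on {0..1} (\<lambda>t. \<xi> t k * G.linv u (\<gamma> t) k)" if k: "k \<in> {1..m}" for k
    proof -
      obtain A where "A-lipschitz_on {0..1} (\<lambda>t. \<xi> t k)"
        using \<xi> k unfolding lip_curve_def by blast
      moreover obtain B where "B-lipschitz_on {0..1} (\<lambda>t. G.linv u (\<gamma> t) k)"
        using smooth_fun_lipschitz[OF G.smooth_linv_comp[OF k] \<gamma>] by blast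
      ultimately show ?thesis by (rule lipschitz_mult)
    qed
    then obtain A where "A-lipschitz_on {0..1} (\<Lambda> u)"
      using lipschitz_sum[of "{1..m}" "\<lambda>k t. \<xi> t k * G.linv u (\<gamma> t) k"] unfolding \<Lambda>_def by blast
    moreover obtain B where "B-lipschitz_on {0..1} (\<lambda>t. H.coadj w u (\<kappa> t))"
      using smooth_fun_lipschitz[OF H.smooth_coadj \<kappa>] by blast
    ultimately show ?thesis
      unfolding D_def using lipschitz_on_diff by blast
  qed
  \<comment> \<open>One null set serves for all u, since the exceptional times come only from the
    three curves \<gamma>, \<kappa> and \<xi>.\<close>
  have D_deriv: "AE t in lborel. t \<in> {0..1} \<longrightarrow>
      (\<forall>u. (D u has_real_derivative (\<Sum>j\<in>{1..r}. h j t * D (G.br (?y j) u) t)) (at t within {0..1}))"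
  proof -
    have "AE t in lborel. t \<in> {0..1} \<longrightarrow> (\<forall>i\<in>{1..m}.
        ((\<lambda>\<tau>. \<gamma> \<tau> i) has_real_derivative (\<Sum>j\<in>{1..r}. h j t * X j (\<gamma> t) i)) (at t within {0..1}))"
      using hor by (simp add: horizontal_def ctrl_curve_def)
    moreover have "AE t in lborel. t \<in> {0..1} \<longrightarrow> (\<forall>i\<in>{1..n}.
        ((\<lambda>\<tau>. \<kappa> \<tau> i) has_real_derivative (\<Sum>j\<in>{1..r}. h j t * Y j (\<kappa> t) i)) (at t within {0..1}))"
      using lift by (simp add: ctrl_curve_def)
    moreover have "AE t in lborel. t \<in> {0..1} \<longrightarrow> (\<forall>k\<in>{1..m}.
        ((\<lambda>\<tau>. \<xi> \<tau> k) has_real_derivative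
          - (\<Sum>j\<in>{1..r}. \<Sum>i\<in>{1..m}. partial k (\<lambda>y. X j y i) (\<gamma> t) * h j t * \<xi> t i))
          (at t within {0..1}))"
      using ext by (simp add: extremal_def)
    ultimately show ?thesis
    proof eventually_elim
      case (elim t)
      show ?case
      proof (intro impI allI)
        fix u assume t: "t \<in> {0..1}"
        have "(\<Lambda> u has_real_derivative (\<Sum>j\<in>{1..r}. h j t * \<Lambda> (G.br (?y j) u) t)) (at t within {0..1})"
          unfolding \<Lambda>_def
          by (rule G.dual_pairing_DERIV[OF \<gamma>_pts t]) (use elim t Xr in simp_all)
        moreover have "((\<lambda>t. H.coadj w u (\<kappa> t)) has_real_derivative
            (\<Sum>j\<in>{1..r}. h j t * H.coadj w (G.br (?y j) u) (\<kappa> t))) (at t within {0..1})"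
          by (rule K.coadj_curve_DERIV[OF \<kappa>_pts t]) (use elim t in \<open>simp_all add: Y_def\<close>)
        ultimately have "(D u has_real_derivative (\<Sum>j\<in>{1..r}. h j t * \<Lambda> (G.br (?y j) u) t) -
            (\<Sum>j\<in>{1..r}. h j t * H.coadj w (G.br (?y j) u) (\<kappa> t))) (at t within {0..1})"
          unfolding D_def by (rule DERIV_diff)
        then show "(D u has_real_derivative (\<Sum>j\<in>{1..r}. h j t * D (G.br (?y j) u) t)) (at t within {0..1})"
          by (simp only: D_def right_diff_distrib sum_subtractf)
      qed
    qed
  qed
  \<comment> \<open>Both curves start at the identity, where Ad is trivial and \<open>linv u\<close>
    has the value u; the choice w = \<xi> 0 then makes the two pairings equal.\<close>
  have D_start: "D u 0 = 0" if "u \<in> pts m" for u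
    using that by (simp add: D_def \<Lambda>_def g0 k0 w_def H.coadj_origin)

  \<comment> \<open>For u in \<open>W k\<close> the derivative of \<open>D u\<close> only involves
    \<open>D\<close> on \<open>W (Suc k)\<close>. The induction starts at Suc s, where the
    filtration is trivial, and its result is used at 1, where it is everything.\<close>
  have D_zero: "\<forall>u\<in>G.W k. \<forall>t\<in>{0..1}. D u t = 0" if "k \<le> Suc s" for k
    using that
  proof (induction k rule: inc_induct)
    case base
    have "D origin t = 0" for t
      by (simp add: D_def \<Lambda>_def H.coadj_zero G.linv_eq origin_def[of, symmetric]) (simp add: origin_def)
    then show ?case using G.W_above[of "Suc s"] by auto
  next
    case (step k)
    show ?case
    proof (intro ballI)
      fix u t assume u: "u \<in> G.W k" and t: "t \<in> {0..1 :: real}"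
      have "AE t in lborel. t \<in> {0..1} \<longrightarrow> (D u has_real_derivative 0) (at t within {0..1})"
        using D_deriv
      proof eventually_elim
        case (elim t)
        have "(\<Sum>j\<in>{1..r}. h j t * D (G.br (?y j) u) t) = 0" if "t \<in> {0..1}"
          using step.IH G.br_W(1)[OF K.y_pts u] that by (intro sum.neutral) auto
        then show ?case using elim by metis
      qed
      moreover obtain C where "C-lipschitz_on {0..1} (D u)" using D_lip by blast
      ultimately have "D u t = D u 0" using lipschitz_AE_deriv_zero_const t by blast
      then show "D u t = 0" using D_start[OF G.W_pts[OF u]] by simp
    qed
  qed

  define v where "v i = (\<Sum>k\<in>{1..m}. w k * ?y i k)" for i
  have "v i = (\<Sum>j\<in>{1..m}. \<zeta> i j * v (sel j))" if i: "i \<in> {1..n}" for i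
  proof -
    \<comment> \<open>The relation defining \<zeta> is evaluated at the identity, where
      left-invariant fields reduce to their vectors; pairing with w then gives the constraints on
      v.\<close>
    have "?y i = (\<lambda>k. \<Sum>j\<in>{1..m}. \<zeta> i j * X j origin k)"
      using zeta i push0[OF i] G.linv_origin[OF K.y_pts] origin_pts by metis
    also have "\<dots> = (\<lambda>k. \<Sum>j\<in>{1..m}. \<zeta> i j * ?y (sel j) k)"
      using X by simp
    finally have yi: "?y i k = (\<Sum>j\<in>{1..m}. \<zeta> i j * ?y (sel j) k)" for k by (rule fun_cong)
    have "v i = (\<Sum>k\<in>{1..m}. \<Sum>j\<in>{1..m}. \<zeta> i j * (w k * ?y (sel j) k))"
      unfolding v_def yi by (simp add: sum_distrib_left mult_ac)
    also have "\<dots> = (\<Sum>j\<in>{1..m}. \<zeta> i j * v (sel j))"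
      unfolding v_def sum_distrib_left by (rule sum.swap)
    finally show ?thesis .
  qed
  moreover have "(\<Sum>k\<in>{1..m}. \<xi> t k * X i (\<gamma> t) k) = ext_poly n r L v (sel i) (\<kappa> t)"
    if t: "t \<in> {0..1}" and i: "i \<in> {1..m}" for t i
  proof -
    have "D (?y (sel i)) t = 0"
      using D_zero[of 1] t G.W_1 K.y_pts by auto
    then have "\<Lambda> (?y (sel i)) t = H.coadj w (?y (sel i)) (\<kappa> t)"
      by (simp add: D_def)
    also have "\<dots> = ext_poly n r L v (sel i) (\<kappa> t)"
      using K.coadj_eq_ext_poly[OF \<kappa>_pts[OF t] sel_n[OF i], of w] by (simp add: v_def[abs_def])
    finally show ?thesis using X[OF i] by (simp add: \<Lambda>_def)
  qed
  ultimately show ?thesis by blast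
qed

end
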